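(* Let $a>0$, $\mu>0$, let $W\in L^1[a,\infty)$ and fix $z\ge0$. Let $$H=D_\mu+X^2\cdot W,\qquad D_\mu=-\frac{d}{dx}\Bigl(x^2\frac{d}{dx}\,\cdot\Bigr)+x^2\mu^2-\frac14\quad\text{on }[a,\infty),$$ and put $\psi_z(x)=x^{-1/2}K_z(\mu x)$, $\phi_z(x)=x^{-1/2}I_z(\mu x)$. Then the differential equation $(H+z^2)f=0$ has a fundamental system of solutions $h_1,h_2$ such that $$h_1(x)=\psi_z(x)\cdot g_1(x),\qquad h_2(x)=\phi_z(x)\cdot g_2(x),$$ with $g_j\in C_b[a,\infty)$ and $\lim_{x\to\infty}g_j(x)=1$, $j=1,2$. Furthermore, $$h_1'(x)=\psi_z'(x)\cdot\tilde g_1(x),\qquad h_2'(x)=\phi_z'(x)\cdot\tilde g_2(x),$$ where $\tilde g_j\in C_b[a,\infty)$, $\lim_{x\to\infty}\tilde g_j(x)=1$, $j=1,2$, and $x^2\cdot(h_1h_2'-h_1'h_2)(x)=1$.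
   Context: $X$ is multiplication by $x$. $C_b[a,\infty)$ denotes the bounded continuous functions on $[a,\infty)$. $I_z,K_z$ are the modified Bessel functions of the first and second kind of order $z$ (standard normalization, $xW(K_z,I_z)(x)=1$ with $W(f,g)=fg'-f'g$). Thus $\psi_z,\phi_z$ is a fundamental system of solutions to $(D_\mu+z^2)f=0$ with $x^2W(\psi_z,\phi_z)=1$.
   Formalization: The clause h_2' = φ_z'·g̃_2 with g̃_2 in C_b is asserted only on some [b,∞), b ≥ a, with b = a when φ_z' has no zero on [a,∞); as printed it fails for z < 1/2 if φ_z' vanishes at some x_0 > a and W is unbounded there, e.g. like |x−x_0|^{-1/2}. *)

theory Defs
  imports "HOL-Analysis.Analysis"
begin

text \<open>
  Modified Bessel functions of real order at a real argument x > 0, in the standard normalization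
  (so that x (K I' - K' I) = 1): the power series for the first kind, and for the second kind the
  integral over t in [0, \<infinity>) of exp (- x cosh t) cosh (\<nu> t), which is convergent for x > 0 and
  every real order, integer or not.  Using \<^const>\<open>rGamma\<close> covers the poles of \<^const>\<open>Gamma\<close> as well.
\<close>

definition bessel_I :: "real \<Rightarrow> real \<Rightarrow> real" where
  "bessel_I \<nu> x = (\<Sum>k. (x / 2) powr (2 * real k + \<nu>) * rGamma (real k + \<nu> + 1) / fact k)"

definition bessel_K :: "real \<Rightarrow> real \<Rightarrow> real" where
  "bessel_K \<nu> x = (LBINT t:{0..}. exp (- x * cosh t) * cosh (\<nu> * t))"

definition psi :: "real \<Rightarrow> real \<Rightarrow> real \<Rightarrow> real" where
  "psi \<mu> z x = x powr (- 1 / 2) * bessel_K z (\<mu> * x)"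

definition phi :: "real \<Rightarrow> real \<Rightarrow> real \<Rightarrow> real" where
  "phi \<mu> z x = x powr (- 1 / 2) * bessel_I z (\<mu> * x)"

text \<open>
  Pitfall: if z < 1/2, then phi \<mu> z is strictly decreasing near 0 and increasing near \<infinity>, so its
  derivative has a zero.  If such a zero lies in [a, \<infinity>), the derivative of a solution
  asymptotic to phi cannot in general be written there as phi' times a bounded continuous function:
  it need not vanish at the zero, and for unbounded W the quotient may be unbounded even if it does.
\<close>

text \<open>The derivative of a function on [a, \<infinity>), one-sided at the endpoint a.\<close>

definition deriv_from :: "real \<Rightarrow> (real \<Rightarrow> 'a::real_normed_vector) \<Rightarrow> real \<Rightarrow> 'a" where
  "deriv_from a f x = vector_derivative f (at x within {a..})"

text \<open>
  F is locally absolutely continuous on [a, \<infinity>) with almost-everywhere derivative p, that is, F is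
  an indefinite Lebesgue integral of the locally integrable function p.
\<close>

definition has_ac_derivative ::
    "real \<Rightarrow> (real \<Rightarrow> 'a::euclidean_space) \<Rightarrow> (real \<Rightarrow> 'a) \<Rightarrow> bool" where
  "has_ac_derivative a F p \<longleftrightarrow>
     (\<forall>x\<ge>a. p absolutely_integrable_on {a..x} \<and> F x = F a + integral {a..x} p)"

text \<open>
  As W is merely integrable, differential equations are understood in the sense of Caratheodory:
  f is differentiable, the product of the square of x with f' is locally absolutely continuous, and equations hold almost everywhere.
  In the following two relations u = D f respectively v = H f, almost everywhere on [a, \<infinity>).
  The scalar type is meant to be \<^typ>\<open>real\<close> or \<^typ>\<open>complex\<close>, which are both instances of
  the two classes.
\<close>

definition D_maps ::
    "real \<Rightarrow> real \<Rightarrow> (real \<Rightarrow> 'a::{real_normed_field,euclidean_space}) \<Rightarrow> (real \<Rightarrow> 'a) \<Rightarrow> bool" where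
  "D_maps a \<mu> f u \<longleftrightarrow>
     (\<forall>x\<ge>a. f differentiable (at x within {a..})) \<and>
     (\<exists>p. has_ac_derivative a (\<lambda>x. x\<^sup>2 *\<^sub>R deriv_from a f x) p \<and>
          (AE x in lebesgue. x \<ge> a \<longrightarrow> u x = - p x + (x\<^sup>2 * \<mu>\<^sup>2 - 1 / 4) *\<^sub>R f x))"

definition H_maps ::
    "real \<Rightarrow> real \<Rightarrow> (real \<Rightarrow> 'a::{real_normed_field,euclidean_space}) \<Rightarrow>
     (real \<Rightarrow> 'a) \<Rightarrow> (real \<Rightarrow> 'a) \<Rightarrow> bool" where
  "H_maps a \<mu> W f v \<longleftrightarrow>
     (\<exists>u. D_maps a \<mu> f u \<and> (AE x in lebesgue. x \<ge> a \<longrightarrow> v x = u x + x\<^sup>2 *\<^sub>R (W x * f x)))"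

text \<open>The equation (H + z * z) f = 0.\<close>

definition is_solution ::
    "real \<Rightarrow> real \<Rightarrow> (real \<Rightarrow> 'a::{real_normed_field,euclidean_space}) \<Rightarrow> real \<Rightarrow>
     (real \<Rightarrow> 'a) \<Rightarrow> bool" where
  "is_solution a \<mu> W z f \<longleftrightarrow>
     (\<exists>v. H_maps a \<mu> W f v \<and> (AE x in lebesgue. x \<ge> a \<longrightarrow> v x + z\<^sup>2 *\<^sub>R f x = 0))"

text \<open>A basis of the solution space; functions are compared on [a, \<infinity>) only.\<close>

definition fundamental_system ::
    "real \<Rightarrow> real \<Rightarrow> (real \<Rightarrow> 'a::{real_normed_field,euclidean_space}) \<Rightarrow> real \<Rightarrow>
     (real \<Rightarrow> 'a) \<Rightarrow> (real \<Rightarrow> 'a) \<Rightarrow> bool" where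
  "fundamental_system a \<mu> W z h\<^sub>1 h\<^sub>2 \<longleftrightarrow>
     is_solution a \<mu> W z h\<^sub>1 \<and> is_solution a \<mu> W z h\<^sub>2 \<and>
     (\<forall>c\<^sub>1 c\<^sub>2. (\<forall>x\<ge>a. c\<^sub>1 * h\<^sub>1 x + c\<^sub>2 * h\<^sub>2 x = 0) \<longrightarrow> c\<^sub>1 = 0 \<and> c\<^sub>2 = 0) \<and>
     (\<forall>f. is_solution a \<mu> W z f \<longrightarrow> (\<exists>c\<^sub>1 c\<^sub>2. \<forall>x\<ge>a. f x = c\<^sub>1 * h\<^sub>1 x + c\<^sub>2 * h\<^sub>2 x))"

definition Cb :: "real \<Rightarrow> (real \<Rightarrow> 'a::metric_space) set" where
  "Cb a = {g. continuous_on {a..} g \<and> bounded (g ` {a..})}"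

end

theory Submission
  imports Defs
begin

text \<open>
  A solution of the perturbed equation is sought in the form \<psi> A + \<phi> B (variation of parameters).
  For the quotient by \<psi> (respectively \<phi>) this is a Volterra equation on [x, \<infinity>) (respectively [a, x])
  whose kernel is bounded by the supremum of t^2 \<phi>(t) \<psi>(t), because \<phi> / \<psi> is increasing; that
  supremum is finite because the Wronskian is 1 and the logarithmic derivatives tend to -\<mu> and \<mu>.
  Integration from infinity yields the solution asymptotic to \<psi>.  Any solution with Wronskian 1
  against it is asymptotic to \<phi>, by reduction of order, and integration from a provides one.

  For the Bessel functions themselves, all properties of K come from its integral representation;
  log-convexity of a Laplace transform gives K' / K \<rightarrow> -1.  The Wronskian of I and K is computed
  as x \<rightarrow> 0, where the substitution s = (x / 2) e^t turns the integral for K into Euler's integral.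
  No asymptotic expansion of I is needed: the Wronskian and l'Hospital's rule give 2 x K I \<rightarrow> 1.
\<close>


section \<open>Indefinite integrals\<close>

text \<open>As W is only integrable, the equation cannot be treated pointwise: solutions are handled
  through x^2 f' as an indefinite integral, and the product rule and the rule for exp are proved for
  such integrals directly. W need not be small on [a, \<infinity>), so the Volterra operators are
  contractions only in a weighted supremum norm. The weights are exponentials of integrals of a
  multiple of |W|; this is where the rule for exp is needed. The decaying solution h = \<psi> g may
  have zeros, so a second solution cannot be produced by integrating 1 / (x h)^2 from a. It is
  chosen instead among the combinations of two initial value solutions at a; reduction of order
  serves only beyond a point after which g has no zero, to read off the growth. The derivatives
  break the symmetry of the pair: psi' is negative everywhere, so division by it is harmless, while
  phi' may vanish and is only known to be positive for large x. Near 0, the behaviour of K is needed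
  only at the orders \<nu> + 1 \<ge> 1, which avoids the logarithm of order 0.\<close>

lemmas absint_integrable = set_lebesgue_integral_eq_integral(1)

text \<open>Over a partition into pieces shorter than d, both sides telescope to norm (F b - F a)
  \<le> e (m b - m a), and e is arbitrary. This replaces the argument by a vanishing derivative, as
  the integrands need not be continuous; m will be the indefinite integral of a norm.\<close>

lemma eq_if_increments_small:
  fixes F :: "real \<Rightarrow> 'a::real_normed_vector" and m :: "real \<Rightarrow> real"
  assumes "a \<le> b"
    and small: "\<And>e. e > 0 \<Longrightarrow> \<exists>d>0. \<forall>x y. a \<le> x \<longrightarrow> x \<le> y \<longrightarrow> y \<le> b \<longrightarrow> y - x < d \<longrightarrow>
                  norm (F y - F x) \<le> e * (m y - m x)"
  shows "F b = F a"
proof -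
  have "norm (F b - F a) \<le> e * (m b - m a)" if e: "e > 0" for e
  proof -
    obtain d where "d > 0" and d: "\<And>x y. \<lbrakk>a \<le> x; x \<le> y; y \<le> b; y - x < d\<rbrakk> \<Longrightarrow>
        norm (F y - F x) \<le> e * (m y - m x)"
      using small[OF e] by auto
    obtain n :: nat where n: "(b - a) / d < real n"
      using reals_Archimedean2 by blast
    have "n > 0"
      using n \<open>a \<le> b\<close> \<open>d > 0\<close> by (cases "n = 0") (auto simp: divide_less_0_iff)
    define h where "h = (b - a) / n"
    have h: "h \<ge> 0" "h < d" "n * h = b - a"
      using n \<open>a \<le> b\<close> \<open>d > 0\<close> \<open>n > 0\<close> by (auto simp: h_def field_simps)
    define t where "t k = a + real k * h" for k
    have t: "t 0 = a" "t n = b"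
      using h by (auto simp: t_def)
    have "norm (F (t n) - F (t 0)) = norm (\<Sum>k<n. F (t (Suc k)) - F (t k))"
      using sum_lessThan_telescope[of "\<lambda>k. F (t k)" n] by simp
    also have "\<dots> \<le> (\<Sum>k<n. e * (m (t (Suc k)) - m (t k)))"
    proof (rule sum_norm_le)
      fix k assume "k \<in> {..<n}"
      then have "real (Suc k) * h \<le> n * h"
        using h(1) by (intro mult_right_mono) auto
      then show "norm (F (t (Suc k)) - F (t k)) \<le> e * (m (t (Suc k)) - m (t k))"
        using h by (intro d) (auto simp: t_def algebra_simps)
    qed
    also have "\<dots> = e * (m (t n) - m (t 0))"
      using sum_lessThan_telescope[of "\<lambda>k. m (t k)" n] by (simp flip: sum_distrib_left)
    finally show ?thesis using t by simp
  qed
  note * = this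
  have "norm (F b - F a) \<le> 0"
  proof (rule field_le_epsilon)
    fix e :: real assume "e > 0"
    \<comment> \<open>The summand 1 makes the division by c legitimate even if m b = m a.\<close>
    define c where "c = \<bar>m b - m a\<bar> + 1"
    have "norm (F b - F a) \<le> e / c * (m b - m a)"
      using \<open>e > 0\<close> by (intro *) (auto simp: c_def)
    also have "\<dots> \<le> e / c * c"
      using \<open>e > 0\<close> by (intro mult_left_mono) (auto simp: c_def)
    also have "\<dots> = e"
      by (auto simp: c_def)
    finally show "norm (F b - F a) \<le> 0 + e" by simp
  qed
  then show ?thesis by simp
qed

lemma absolutely_integrable_continuous_bilinear:
  fixes G :: "real \<Rightarrow> 'a::euclidean_space" and f :: "real \<Rightarrow> 'b::euclidean_space"
    and prod :: "'a \<Rightarrow> 'b \<Rightarrow> 'c::euclidean_space"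
  assumes "bounded_bilinear prod" "continuous_on S G" "bounded (G ` S)" "S \<in> sets lebesgue"
    and "f absolutely_integrable_on S"
  shows "(\<lambda>x. prod (G x) (f x)) absolutely_integrable_on S"
  using assms continuous_imp_measurable_on_sets_lebesgue[OF assms(2,4)]
  by (intro absolutely_integrable_bounded_measurable_product[of prod G S f])
     (auto simp: bilinear_conv_bounded_bilinear)

lemma absolutely_integrable_continuous_bilinear_Icc:
  fixes G :: "real \<Rightarrow> 'a::euclidean_space" and f :: "real \<Rightarrow> 'b::euclidean_space"
    and prod :: "'a \<Rightarrow> 'b \<Rightarrow> 'c::euclidean_space"
  assumes "bounded_bilinear prod" "continuous_on {a..b} G" "f absolutely_integrable_on {a..b}"
  shows "(\<lambda>x. prod (G x) (f x)) absolutely_integrable_on {a..b}"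
  using assms
  by (intro absolutely_integrable_continuous_bilinear[of prod "{a..b}" G f])
     (auto intro!: compact_imp_bounded compact_continuous_image)

lemma has_ac_derivativeI:
  assumes "\<And>x. x \<ge> a \<Longrightarrow> f absolutely_integrable_on {a..x}"
    and "\<And>x. x \<ge> a \<Longrightarrow> F x = F a + integral {a..x} f"
  shows "has_ac_derivative a F f"
  using assms unfolding has_ac_derivative_def by blast

lemma ac_eq: "has_ac_derivative a F f \<Longrightarrow> x \<ge> a \<Longrightarrow> F x = F a + integral {a..x} f"
  unfolding has_ac_derivative_def by blast

lemma ac_integrable:
  assumes "has_ac_derivative a F f" "a \<le> x"
  shows "f absolutely_integrable_on {x..y}"
proof -
  have "f absolutely_integrable_on {a..max x y}"
    using assms unfolding has_ac_derivative_def by simp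
  then show ?thesis
    by (rule absolutely_integrable_on_subinterval) (use assms in auto)
qed

lemma ac_increment:
  assumes "has_ac_derivative a F f" "a \<le> x" "x \<le> y"
  shows "F y - F x = integral {x..y} f"
proof -
  have "integral {a..x} f + integral {x..y} f = integral {a..y} f"
    using assms ac_integrable[OF assms(1) order_refl, of y]
    by (intro Henstock_Kurzweil_Integration.integral_combine) (auto intro: absint_integrable)
  moreover have "F y = F a + integral {a..y} f" "F x = F a + integral {a..x} f"
    using assms by (auto intro: ac_eq)
  ultimately show ?thesis by (metis add_diff_cancel_left add_diff_cancel_left' group_cancel.add1)
qed

lemma ac_continuous:
  assumes "has_ac_derivative a F f"
  shows "continuous_on {a..} F"
proof -
  have "continuous_on {a..x} F" for x
  proof -
    have "continuous_on {a..x} (\<lambda>y. F a + integral {a..y} f)"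
      using ac_integrable[OF assms order_refl, of x]
      by (intro continuous_intros indefinite_integral_continuous_1) (auto intro: set_lebesgue_integral_eq_integral(1))
    then show ?thesis
      by (rule continuous_on_eq) (auto intro: ac_eq[OF assms, symmetric])
  qed
  \<comment> \<open>The interval must reach beyond x: {a..x} would only give continuity from the
    left.\<close>
  then have "continuous (at x within {a..x+1}) F" if "x \<ge> a" for x
    using that by (auto simp: continuous_on_eq_continuous_within)
  moreover have "at x within {a..x+1} = at x within {a..}" for x :: real
    by (rule at_within_nhd[of _ "{..<x+1}"]) auto
  ultimately show ?thesis
    by (auto simp: continuous_on_eq_continuous_within)
qed

text \<open>Null sets are invisible to the integral. Through this, relations that hold only almost
  everywhere enter the calculus.\<close>

lemma ac_cong_AE:
  assumes "has_ac_derivative a F f" "AE x in lebesgue. x \<ge> a \<longrightarrow> f x = g x"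
    and "\<And>x. x \<ge> a \<Longrightarrow> F x = G x"
  shows "has_ac_derivative a G g"
proof -
  obtain N where N: "{x. \<not> (x \<ge> a \<longrightarrow> f x = g x)} \<subseteq> N" "N \<in> null_sets lebesgue"
    using assms(2) by (auto simp: eventually_ae_filter)
  have neg: "negligible N"
    using N by (simp add: negligible_iff_null_sets)
  have "g absolutely_integrable_on {a..x}" for x
    by (rule absolutely_integrable_spike[OF ac_integrable[OF assms(1) order_refl] neg]) (use N in auto)
  moreover have "integral {a..x} f = integral {a..x} g" for x
    by (rule integral_spike[OF neg]) (use N in auto)
  ultimately show ?thesis
    by (metis has_ac_derivativeI ac_eq[OF assms(1)] assms(3) order_refl)
qed

lemma ac_cong:
  assumes "has_ac_derivative a F f" "\<And>x. x \<ge> a \<Longrightarrow> f x = g x" "\<And>x. x \<ge> a \<Longrightarrow> F x = G x"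
  shows "has_ac_derivative a G g"
  by (rule ac_cong_AE[OF assms(1)]) (use assms in auto)

lemma ac_add:
  assumes "has_ac_derivative a F f" "has_ac_derivative a G g"
  shows "has_ac_derivative a (\<lambda>x. F x + G x) (\<lambda>x. f x + g x)"
proof -
  have "integral {a..x} (\<lambda>x. f x + g x) = integral {a..x} f + integral {a..x} g" for x
    using ac_integrable[OF assms(1) order_refl, of x] ac_integrable[OF assms(2) order_refl, of x]
    by (intro Henstock_Kurzweil_Integration.integral_add) (auto intro: set_lebesgue_integral_eq_integral(1))
  then have "F x + G x = F a + G a + integral {a..x} (\<lambda>x. f x + g x)" if "x \<ge> a" for x
    using ac_eq[OF assms(1) that] ac_eq[OF assms(2) that] by simp
  with set_integral_add(1)[OF ac_integrable[OF assms(1) order_refl] ac_integrable[OF assms(2) order_refl]]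
  show ?thesis
    by (rule has_ac_derivativeI)
qed

lemma ac_linear:
  fixes F :: "real \<Rightarrow> 'a::euclidean_space" and T :: "'a \<Rightarrow> 'b::euclidean_space"
  assumes "bounded_linear T" "has_ac_derivative a F f"
  shows "has_ac_derivative a (\<lambda>x. T (F x)) (\<lambda>x. T (f x))"
proof -
  interpret bounded_linear T by fact
  have "integral {a..x} (\<lambda>x. T (f x)) = T (integral {a..x} f)" for x
    using integral_linear[OF _ assms(1), of f] ac_integrable[OF assms(2) order_refl, of x]
    by (auto simp: o_def intro: set_lebesgue_integral_eq_integral(1))
  moreover have "(\<lambda>x. T (f x)) absolutely_integrable_on {a..x}" for x
    using absolutely_integrable_linear[OF ac_integrable[OF assms(2) order_refl] assms(1)]
    by (simp add: o_def)
  ultimately show ?thesis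
    by (metis has_ac_derivativeI ac_eq[OF assms(2)] add)
qed

lemma ac_diff:
  fixes F G :: "real \<Rightarrow> 'a::euclidean_space"
  assumes "has_ac_derivative a F f" "has_ac_derivative a G g"
  shows "has_ac_derivative a (\<lambda>x. F x - G x) (\<lambda>x. f x - g x)"
  using ac_add[OF assms(1) ac_linear[OF bounded_linear_minus[OF bounded_linear_ident] assms(2)]]
  by simp

text \<open>
  The product rule is checked on short intervals: there F G minus the indefinite integral of
  f G + F g changes by the integral of f (t) (G y - G t) + (F x - F t) g (t).
\<close>

lemma ac_prod:
  fixes F :: "real \<Rightarrow> 'a::euclidean_space" and G :: "real \<Rightarrow> 'b::euclidean_space"
    and prod :: "'a \<Rightarrow> 'b \<Rightarrow> 'c::euclidean_space"
  assumes bil: "bounded_bilinear prod"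
    and F: "has_ac_derivative a F f" and G: "has_ac_derivative a G g"
  shows "has_ac_derivative a (\<lambda>x. prod (F x) (G x)) (\<lambda>x. prod (f x) (G x) + prod (F x) (g x))"
proof -
  interpret bounded_bilinear prod by fact
  let ?D = "\<lambda>x. prod (f x) (G x) + prod (F x) (g x)"
  have bil': "bounded_bilinear (\<lambda>x y. prod y x)"
    by (rule bounded_bilinear.flip[OF bil])
  have cF: "continuous_on {x..y} F" and cG: "continuous_on {x..y} G" if "a \<le> x" for x y
    using ac_continuous[OF F] ac_continuous[OF G] that by (auto intro: continuous_on_subset)
  have iG: "(\<lambda>t. prod (f t) (H t)) absolutely_integrable_on {x..y}"
    if "a \<le> x" "continuous_on {x..y} H" for x y H
    by (rule absolutely_integrable_continuous_bilinear_Icc[OF bil' that(2) ac_integrable[OF F that(1)]])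
  have iF: "(\<lambda>t. prod (H t) (g t)) absolutely_integrable_on {x..y}"
    if "a \<le> x" "continuous_on {x..y} H" for x y H
    by (rule absolutely_integrable_continuous_bilinear_Icc[OF bil that(2) ac_integrable[OF G that(1)]])
  have iD: "?D absolutely_integrable_on {x..y}" if "a \<le> x" for x y
    by (intro set_integral_add(1) iG iF cF cG that)
  define E where "E x = prod (F x) (G x) - integral {a..x} ?D" for x
  obtain K where K: "K > 0" "\<And>x y. norm (prod x y) \<le> norm x * norm y * K"
    using pos_bounded by blast
  \<comment> \<open>Serves as comparison function for both factors at once: on a short interval, the
    error is at most e times the integral of norm f + norm g.\<close>
  define m where "m x = integral {a..x} (\<lambda>t. norm (f t) + norm (g t))" for x
  have im: "(\<lambda>t. norm (f t) + norm (g t)) absolutely_integrable_on {x..y}" if "a \<le> x" for x y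
    by (intro set_integral_add(1) absolutely_integrable_norm[unfolded o_def]
          ac_integrable[OF F that] ac_integrable[OF G that])
  have "E b = E a" if "a \<le> b" for b
  proof (rule eq_if_increments_small[OF that, where m=m])
    fix e :: real assume "e > 0"
    then have eK: "e / K > 0" using K by simp
    obtain d1 where d1: "d1 > 0" "\<And>x y. \<lbrakk>x \<in> {a..b}; y \<in> {a..b}; dist y x < d1\<rbrakk> \<Longrightarrow> dist (F y) (F x) < e / K"
      using uniformly_continuous_onE[OF compact_uniformly_continuous[OF cF[OF order_refl, of b] compact_Icc] eK] by blast
    obtain d2 where d2: "d2 > 0" "\<And>x y. \<lbrakk>x \<in> {a..b}; y \<in> {a..b}; dist y x < d2\<rbrakk> \<Longrightarrow> dist (G y) (G x) < e / K"
      using uniformly_continuous_onE[OF compact_uniformly_continuous[OF cG[OF order_refl, of b] compact_Icc] eK] by blast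
    show "\<exists>d>0. \<forall>x y. a \<le> x \<longrightarrow> x \<le> y \<longrightarrow> y \<le> b \<longrightarrow> y - x < d \<longrightarrow>
            norm (E y - E x) \<le> e * (m y - m x)"
    proof (intro exI[of _ "min d1 d2"] conjI allI impI)
      fix x y assume xy: "a \<le> x" "x \<le> y" "y \<le> b" "y - x < min d1 d2"
      have 1: "integral {a..y} ?D = integral {a..x} ?D + integral {x..y} ?D"
        using xy by (intro Henstock_Kurzweil_Integration.integral_combine[symmetric] absint_integrable iD) auto
      have 2: "m y = m x + integral {x..y} (\<lambda>t. norm (f t) + norm (g t))"
        unfolding m_def
        using xy by (intro Henstock_Kurzweil_Integration.integral_combine[symmetric] set_lebesgue_integral_eq_integral(1) im) auto
      have "prod (F y) (G y) - prod (F x) (G x) = prod (F y - F x) (G y) + prod (F x) (G y - G x)"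
        by (simp add: diff_left diff_right)
      also have "\<dots> = prod (integral {x..y} f) (G y) + prod (F x) (integral {x..y} g)"
        using ac_increment[OF F] ac_increment[OF G] xy by simp
      also have "\<dots> = integral {x..y} (\<lambda>t. prod (f t) (G y)) + integral {x..y} (\<lambda>t. prod (F x) (g t))"
        using integral_linear[OF absint_integrable[OF ac_integrable[OF F xy(1)]] bounded_linear_left, of y "G y"]
          integral_linear[OF absint_integrable[OF ac_integrable[OF G xy(1)]] bounded_linear_right, of y "F x"]
        by (simp add: o_def)
      also have "\<dots> = integral {x..y} (\<lambda>t. prod (f t) (G y) + prod (F x) (g t))"
        by (intro Henstock_Kurzweil_Integration.integral_add[symmetric] set_lebesgue_integral_eq_integral(1) iF iG
              continuous_intros xy)
      finally have 3: "E y - E x = integral {x..y} (\<lambda>t. prod (f t) (G y) + prod (F x) (g t)) - integral {x..y} ?D"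
        unfolding E_def 1 by simp
      also have "\<dots> = integral {x..y} (\<lambda>t. prod (f t) (G y) + prod (F x) (g t) - ?D t)"
        by (intro Henstock_Kurzweil_Integration.integral_diff[symmetric] set_lebesgue_integral_eq_integral(1) iD
              set_integral_add(1) iF iG continuous_intros xy)
      also have "norm \<dots> \<le> integral {x..y} (\<lambda>t. e * (norm (f t) + norm (g t)))"
      proof (rule integral_norm_bound_integral)
        show "(\<lambda>t. prod (f t) (G y) + prod (F x) (g t) - ?D t) integrable_on {x..y}"
          by (intro set_lebesgue_integral_eq_integral(1) set_integral_diff(1) iD
              set_integral_add(1) iF iG continuous_intros xy)
        show "(\<lambda>t. e * (norm (f t) + norm (g t))) integrable_on {x..y}"
          using set_lebesgue_integral_eq_integral(1)[OF im[OF xy(1), of y]] by (intro integrable_on_mult_right)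
        fix t assume t: "t \<in> {x..y}"
        have "prod (f t) (G y) + prod (F x) (g t) - ?D t = prod (f t) (G y - G t) + prod (F x - F t) (g t)"
          by (simp add: diff_left diff_right)
        also have "norm \<dots> \<le> norm (f t) * norm (G y - G t) * K + norm (F x - F t) * norm (g t) * K"
          by (intro norm_triangle_le add_mono K(2))
        also have "\<dots> \<le> norm (f t) * (e / K) * K + (e / K) * norm (g t) * K"
          using d1(2)[of t x] d2(2)[of t y] t xy K(1)
          by (intro add_mono mult_left_mono mult_right_mono) (auto simp: dist_norm abs_if less_imp_le)
        finally show "norm (prod (f t) (G y) + prod (F x) (g t) - ?D t) \<le> e * (norm (f t) + norm (g t))"
          using K(1) by (simp add: algebra_simps)
      qed
      also have "\<dots> = e * (m y - m x)"
        by (simp add: 2)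
      finally show "norm (E y - E x) \<le> e * (m y - m x)" .
    qed (use d1 d2 in auto)
  qed
  note E_const = this
  have "prod (F x) (G x) = prod (F a) (G a) + integral {a..x} ?D" if "a \<le> x" for x
    using E_const[OF that] by (simp add: E_def diff_eq_eq)
  with iD[OF order_refl] show ?thesis
    by (rule has_ac_derivativeI)
qed

lemma ac_of_vector_derivative:
  fixes F :: "real \<Rightarrow> 'a::euclidean_space"
  assumes "\<And>x. x \<ge> a \<Longrightarrow> (F has_vector_derivative f x) (at x within {a..})" "continuous_on {a..} f"
  shows "has_ac_derivative a F f"
proof (rule has_ac_derivativeI)
  fix x assume "x \<ge> a"
  show "f absolutely_integrable_on {a..x}"
    by (intro absolutely_integrable_continuous_real continuous_on_subset[OF assms(2)]) auto
  have "(f has_integral (F x - F a)) {a..x}"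
    using \<open>x \<ge> a\<close> by (intro fundamental_theorem_of_calculus has_vector_derivative_within_subset[OF assms(1)]) auto
  from integral_unique[OF this] show "F x = F a + integral {a..x} f"
    by simp
qed

lemma ac_of_real_derivative:
  fixes F :: "real \<Rightarrow> real"
  assumes "\<And>x. x \<ge> a \<Longrightarrow> (F has_real_derivative f x) (at x)" "continuous_on {a..} f"
  shows "has_ac_derivative a F f"
  by (rule ac_of_vector_derivative[OF _ assms(2)])
     (rule assms(1)[THEN has_field_derivative_at_within, unfolded has_real_derivative_iff_has_vector_derivative])

text \<open>The way back to classical derivatives: a solution must be differentiable at every point,
  whereas variation of parameters first yields h only as an indefinite integral.\<close>

lemma ac_vector_derivative:
  fixes F :: "real \<Rightarrow> 'a::euclidean_space"
  assumes F: "has_ac_derivative a F f" and f: "continuous_on {a..} f" and "x \<ge> a"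
  shows "(F has_vector_derivative f x) (at x within {a..})"
proof -
  define G where "G u = F a + integral {a..u} f" for u
  have "(G has_vector_derivative f x) (at x within {a..x+1})"
    unfolding G_def using \<open>x \<ge> a\<close> continuous_on_subset[OF f]
    by (auto intro!: derivative_eq_intros integral_has_vector_derivative)
  moreover have "F u = G u" if "u \<in> {a..x+1}" for u
    using ac_eq[OF F, of u] that by (simp add: G_def)
  ultimately have "(F has_vector_derivative f x) (at x within {a..x+1})"
    using \<open>x \<ge> a\<close> by (intro has_vector_derivative_transform[of x "{a..x+1}" F G]) auto
  moreover have "at x within {a..x+1} = at x within {a..}"
    by (rule at_within_nhd[of _ "{..<x+1}"]) auto
  ultimately show ?thesis by simp
qed

lemma ac_zero_const:
  assumes "has_ac_derivative a F (\<lambda>_. 0)" "x \<ge> a"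
  shows "F x = F a"
  using ac_increment[OF assms(1) order_refl assms(2)] by simp

section \<open>The modified Bessel function of the first kind\<close>

definition bessel_coeff :: "real \<Rightarrow> nat \<Rightarrow> real" where
  "bessel_coeff \<nu> k = rGamma (real k + \<nu> + 1) / fact k"

text \<open>With y = (x / 2)^2, this is what remains of I after the factor (x / 2)^\<nu> is split
  off: the regularized hypergeometric function 0F1(; \<nu> + 1; y). It is entire, so power series
  can be differentiated termwise.\<close>

definition bessel_series :: "real \<Rightarrow> real \<Rightarrow> real" where
  "bessel_series \<nu> y = (\<Sum>k. bessel_coeff \<nu> k * y ^ k)"

lemma rGamma_real_pos: "x > 0 \<Longrightarrow> rGamma (x :: real) > 0"
  by (simp add: rGamma_inverse_Gamma Gamma_real_pos)

text \<open>Each step divides by k + \<nu> + 1 \<ge> 1. This dominates the series by that of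
  exp.\<close>

lemma rGamma_shift_le:
  assumes "\<nu> \<ge> 0"
  shows "rGamma (real k + \<nu> + 1) \<le> rGamma (\<nu> + 1)"
proof (induction k)
  case (Suc k)
  have "0 \<le> (real k + \<nu>) * rGamma (real (Suc k) + \<nu> + 1)"
    using assms rGamma_real_pos[of "real (Suc k) + \<nu> + 1"] by (intro mult_nonneg_nonneg) auto
  then have "rGamma (real (Suc k) + \<nu> + 1) \<le> rGamma (real k + \<nu> + 1)"
    using rGamma_plus1[of "real k + \<nu> + 1"] by (simp add: algebra_simps)
  with Suc show ?case by simp
qed simp

lemma summable_bessel_series:
  assumes "\<nu> \<ge> 0"
  shows "summable (\<lambda>k. bessel_coeff \<nu> k * y ^ k)"
proof (rule summable_comparison_test')
  show "summable (\<lambda>k. rGamma (\<nu> + 1) * (inverse (fact k) * \<bar>y\<bar> ^ k))"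
    using summable_exp[of "\<bar>y\<bar>"] by (intro summable_mult) simp
  fix k
  show "norm (bessel_coeff \<nu> k * y ^ k) \<le> rGamma (\<nu> + 1) * (inverse (fact k) * \<bar>y\<bar> ^ k)"
    using rGamma_shift_le[OF assms, of k] rGamma_real_pos[of "real k + \<nu> + 1"] assms
    by (auto simp: bessel_coeff_def abs_mult power_abs divide_simps intro!: mult_right_mono)
qed

lemma bessel_series_sums:
  "\<nu> \<ge> 0 \<Longrightarrow> (\<lambda>k. bessel_coeff \<nu> k * y ^ k) sums bessel_series \<nu> y"
  unfolding bessel_series_def by (intro summable_sums summable_bessel_series)

lemma bessel_coeff_Suc: "real (Suc k) * bessel_coeff \<nu> (Suc k) = bessel_coeff (\<nu> + 1) k"
  by (simp add: bessel_coeff_def divide_simps add_ac del: of_nat_Suc) (simp add: add_ac)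

text \<open>Termwise differentiation merely raises the order by 1, by
  \<open>bessel_coeff_Suc\<close>.\<close>

lemma DERIV_bessel_series:
  assumes "\<nu> \<ge> 0"
  shows "(bessel_series \<nu> has_real_derivative bessel_series (\<nu> + 1) y) (at y)"
proof -
  have "diffs (bessel_coeff \<nu>) = bessel_coeff (\<nu> + 1)"
    by (auto simp: diffs_def bessel_coeff_Suc simp del: of_nat_Suc)
  then show ?thesis
    using termdiffs_strong_converges_everywhere[OF summable_bessel_series[OF assms], of y]
    by (simp add: bessel_series_def[abs_def])
qed

text \<open>Comparison of coefficients: the one of order \<nu> is \<nu> + 1 + k times the one of
  order \<nu> + 1, and the part with factor k is a shifted series of order \<nu> + 2. It is the
  three-term recurrence behind the differential equation of I.\<close>

lemma bessel_series_rec: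
  assumes "\<nu> \<ge> 0"
  shows "bessel_series \<nu> y = (\<nu> + 1) * bessel_series (\<nu> + 1) y + y * bessel_series (\<nu> + 2) y"
proof -
  have "(\<lambda>k. y * (bessel_coeff (\<nu> + 2) k * y ^ k)) sums (y * bessel_series (\<nu> + 2) y)"
    using assms by (intro sums_mult bessel_series_sums) auto
  also have "(\<lambda>k. y * (bessel_coeff (\<nu> + 2) k * y ^ k)) =
      (\<lambda>k. real (Suc k) * bessel_coeff (\<nu> + 1) (Suc k) * y ^ Suc k)"
    using bessel_coeff_Suc[of _ "\<nu> + 1"] by (auto simp: algebra_simps)
  \<comment> \<open>The factor k kills the term k = 0, so the index shift leaves no
    remainder.\<close>
  finally have "(\<lambda>k. real k * bessel_coeff (\<nu> + 1) k * y ^ k) sums (y * bessel_series (\<nu> + 2) y)"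
    using sums_Suc_iff[of "\<lambda>k. real k * bessel_coeff (\<nu> + 1) k * y ^ k"] by simp
  moreover have "(\<lambda>k. (\<nu> + 1) * (bessel_coeff (\<nu> + 1) k * y ^ k)) sums ((\<nu> + 1) * bessel_series (\<nu> + 1) y)"
    using assms by (intro sums_mult bessel_series_sums) auto
  ultimately have "(\<lambda>k. (\<nu> + 1) * (bessel_coeff (\<nu> + 1) k * y ^ k) + real k * bessel_coeff (\<nu> + 1) k * y ^ k) sums
      ((\<nu> + 1) * bessel_series (\<nu> + 1) y + y * bessel_series (\<nu> + 2) y)"
    by (intro sums_add)
  moreover have "bessel_coeff \<nu> k = (\<nu> + 1 + real k) * bessel_coeff (\<nu> + 1) k" for k
    using rGamma_plus1[of "real k + \<nu> + 1"] by (simp add: bessel_coeff_def field_simps)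
  then have "(\<nu> + 1) * (bessel_coeff (\<nu> + 1) k * y ^ k) + real k * bessel_coeff (\<nu> + 1) k * y ^ k =
      bessel_coeff \<nu> k * y ^ k" for k
    by (simp add: algebra_simps)
  ultimately show ?thesis
    using sums_unique2[OF bessel_series_sums[OF assms]] by simp
qed

lemma bessel_series_pos:
  assumes "\<nu> \<ge> 0" "y \<ge> 0"
  shows "bessel_series \<nu> y > 0"
proof -
  have pos: "bessel_coeff \<nu> k > 0" for k
    using assms by (auto simp: bessel_coeff_def intro!: divide_pos_pos rGamma_real_pos)
  have "0 < (\<Sum>k<1. bessel_coeff \<nu> k * y ^ k)"
    using pos by simp
  also have "\<dots> \<le> bessel_series \<nu> y"
    unfolding bessel_series_def using assms pos
    by (intro sum_le_suminf summable_bessel_series) (simp_all add: less_imp_le)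
  finally show ?thesis .
qed

lemma bessel_I_eq:
  assumes "\<nu> \<ge> 0" "x > 0"
  shows "bessel_I \<nu> x = (x / 2) powr \<nu> * bessel_series \<nu> ((x / 2)\<^sup>2)"
proof -
  have "(x / 2) powr (2 * real k + \<nu>) * rGamma (real k + \<nu> + 1) / fact k =
      (x / 2) powr \<nu> * (bessel_coeff \<nu> k * ((x / 2)\<^sup>2) ^ k)" for k
  proof -
    have "(x / 2) powr (2 * real k) = ((x / 2)\<^sup>2) ^ k"
      using powr_realpow[of "x / 2" "2 * k"] assms by (simp add: power_mult)
    then show ?thesis
      by (simp add: powr_add bessel_coeff_def)
  qed
  then show ?thesis
    using summable_bessel_series[OF assms(1)] by (simp add: bessel_I_def bessel_series_def suminf_mult)
qed

lemma bessel_I_pos: "\<nu> \<ge> 0 \<Longrightarrow> x > 0 \<Longrightarrow> bessel_I \<nu> x > 0"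
  by (simp add: bessel_I_eq bessel_series_pos)

lemma bessel_I_rec:
  assumes "\<nu> \<ge> 0" "x > 0"
  shows "bessel_I \<nu> x = 2 * (\<nu> + 1) / x * bessel_I (\<nu> + 1) x + bessel_I (\<nu> + 2) x"
proof -
  have p: "(x / 2) powr (\<nu> + 1) = (x / 2) powr \<nu> * (x / 2)"
    "(x / 2) powr (\<nu> + 2) = (x / 2) powr \<nu> * (x / 2)\<^sup>2"
    using assms by (simp_all add: powr_add powr_numeral)
  show ?thesis
    using assms unfolding bessel_I_eq[OF assms]
    by (simp add: bessel_I_eq p bessel_series_rec[OF assms(1), of "(x / 2)\<^sup>2"] distrib_left)
qed

lemma DERIV_bessel_I:
  assumes "\<nu> \<ge> 0" "x > 0"
  shows "(bessel_I \<nu> has_real_derivative (\<nu> / x * bessel_I \<nu> x + bessel_I (\<nu> + 1) x)) (at x)"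
proof -
  let ?F = "\<lambda>x. (x / 2) powr \<nu> * bessel_series \<nu> ((x / 2)\<^sup>2)"
  have p: "(x / 2) powr (\<nu> + 1) = (x / 2) powr \<nu> * (x / 2)"
    "(x / 2) powr (\<nu> - 1) = (x / 2) powr \<nu> / (x / 2)"
    using assms by (simp_all add: powr_add powr_diff)
  have "((\<lambda>x. bessel_series \<nu> ((x / 2)\<^sup>2)) has_real_derivative
      bessel_series (\<nu> + 1) ((x / 2)\<^sup>2) * (x / 2)) (at x)"
    by (rule DERIV_chain2[OF DERIV_bessel_series[OF assms(1)]])
       (auto intro!: derivative_eq_intros simp: power2_eq_square)
  note series = this
  have "((\<lambda>x. (x / 2) powr \<nu>) has_real_derivative (\<nu> * (x / 2) powr (\<nu> - 1) * (1 / 2))) (at x)"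
    using assms by (auto intro!: derivative_eq_intros)
  from DERIV_mult[OF this series] have "(?F has_real_derivative
      (\<nu> * (x / 2) powr (\<nu> - 1) * (1 / 2)) * bessel_series \<nu> ((x / 2)\<^sup>2) +
      (bessel_series (\<nu> + 1) ((x / 2)\<^sup>2) * (x / 2)) * (x / 2) powr \<nu>) (at x)" .
  also have "(\<nu> * (x / 2) powr (\<nu> - 1) * (1 / 2)) * bessel_series \<nu> ((x / 2)\<^sup>2) +
      (bessel_series (\<nu> + 1) ((x / 2)\<^sup>2) * (x / 2)) * (x / 2) powr \<nu> =
      \<nu> / x * bessel_I \<nu> x + bessel_I (\<nu> + 1) x"
    using assms by (simp add: bessel_I_eq p mult_ac)
  finally show ?thesis
    by (rule DERIV_cong_ev[OF refl _ refl, THEN iffD1, rotated])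
       (auto intro!: eventually_mono[OF eventually_nhds_in_open[of "{0<..}"]] simp: assms bessel_I_eq)
qed

text \<open>The derivative from \<open>DERIV_bessel_I\<close>, kept as an expression in I of two
  orders so that it can be differentiated again.\<close>

definition bessel_I' :: "real \<Rightarrow> real \<Rightarrow> real" where
  "bessel_I' \<nu> x = \<nu> / x * bessel_I \<nu> x + bessel_I (\<nu> + 1) x"

text \<open>Bessel's equation as a first-order system. Differentiating the formula for I' produces
  order \<nu> + 2, which \<open>bessel_I_rec\<close> eliminates.\<close>

lemma DERIV_bessel_I':
  assumes "\<nu> \<ge> 0" "x > 0"
  shows "(bessel_I' \<nu> has_real_derivative ((1 + \<nu>\<^sup>2 / x\<^sup>2) * bessel_I \<nu> x - bessel_I' \<nu> x / x)) (at x)"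
proof -
  have "((\<lambda>x. \<nu> / x * bessel_I \<nu> x) has_real_derivative
      (- \<nu> / x\<^sup>2) * bessel_I \<nu> x + (\<nu> / x * bessel_I \<nu> x + bessel_I (\<nu> + 1) x) * (\<nu> / x)) (at x)"
    using assms by (intro DERIV_mult DERIV_bessel_I) (auto intro!: derivative_eq_intros simp: power2_eq_square)
  moreover have "(bessel_I (\<nu> + 1) has_real_derivative
      ((\<nu> + 1) / x * bessel_I (\<nu> + 1) x + bessel_I (\<nu> + 2) x)) (at x)"
    using DERIV_bessel_I[of "\<nu> + 1" x] assms by (simp add: add.commute)
  ultimately have "(bessel_I' \<nu> has_real_derivative
      ((- \<nu> / x\<^sup>2) * bessel_I \<nu> x + (\<nu> / x * bessel_I \<nu> x + bessel_I (\<nu> + 1) x) * (\<nu> / x)) +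
      ((\<nu> + 1) / x * bessel_I (\<nu> + 1) x + bessel_I (\<nu> + 2) x)) (at x)"
    unfolding bessel_I'_def[abs_def] by (rule DERIV_add)
  also have "((- \<nu> / x\<^sup>2) * bessel_I \<nu> x + (\<nu> / x * bessel_I \<nu> x + bessel_I (\<nu> + 1) x) * (\<nu> / x)) +
      ((\<nu> + 1) / x * bessel_I (\<nu> + 1) x + bessel_I (\<nu> + 2) x) =
      (1 + \<nu>\<^sup>2 / x\<^sup>2) * bessel_I \<nu> x - bessel_I' \<nu> x / x"
  proof -
    have "bessel_I (\<nu> + 2) x = bessel_I \<nu> x - 2 * (\<nu> + 1) / x * bessel_I (\<nu> + 1) x"
      using bessel_I_rec[OF assms] by simp
    show ?thesis
      unfolding \<open>bessel_I (\<nu> + 2) x = _\<close> bessel_I'_def using assms by (simp add: field_simps power2_eq_square)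
  qed
  finally show ?thesis .
qed

section \<open>The modified Bessel function of the second kind\<close>

lemma exp_minus_linear_bounds:
  fixes u :: real
  shows "0 \<le> exp u - 1 - u" "exp u - 1 - u \<le> u\<^sup>2 * exp \<bar>u\<bar>"
proof -
  show "0 \<le> exp u - 1 - u"
    using exp_ge_add_one_self[of u] by linarith
  have "1 - u \<le> exp (- u)"
    using exp_ge_add_one_self[of "- u"] by simp
  then have "(1 - u) * exp u \<le> exp (- u) * exp u"
    by (intro mult_right_mono) auto
  \<comment> \<open>Multiplying 1 - u \<le> exp (- u) by exp u gives the mean value bound; both
    signs of u follow from it.\<close>
  then have *: "exp u - 1 \<le> u * exp u"
    by (simp add: algebra_simps flip: exp_add)
  show "exp u - 1 - u \<le> u\<^sup>2 * exp \<bar>u\<bar>"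
  proof (cases "u \<ge> 0")
    case True
    then have "u * (exp u - 1) \<le> u * (u * exp u)"
      using * by (intro mult_left_mono)
    with * True show ?thesis by (simp add: algebra_simps power2_eq_square)
  next
    case False
    then have "- u * (1 - exp u) \<le> - u * (- u)"
      using exp_ge_add_one_self[of u] by (intro mult_left_mono; linarith)
    also have "\<dots> \<le> u\<^sup>2 * exp \<bar>u\<bar>"
      using mult_left_mono[of 1 "exp \<bar>u\<bar>" "u\<^sup>2"] by (simp add: power2_eq_square)
    finally show ?thesis using * by (simp add: algebra_simps)
  qed
qed

text \<open>After division by h the error is at most B |h|. A single explicit estimate thus suffices
  for differentiating an integral in its parameter.\<close>

lemma DERIV_quadratic_error:
  fixes F :: "real \<Rightarrow> real"
  assumes "d > 0" "\<And>h. \<bar>h\<bar> \<le> d \<Longrightarrow> \<bar>F (x + h) - F x - h * D\<bar> \<le> B * h\<^sup>2"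
  shows "(F has_real_derivative D) (at x)"
proof -
  have "((\<lambda>h. (F (x + h) - F x) / h - D) \<longlongrightarrow> 0) (at 0)"
  proof (rule Lim_null_comparison)
    show "((\<lambda>h. B * \<bar>h\<bar>) \<longlongrightarrow> 0) (at 0)"
      by (auto intro!: tendsto_eq_intros)
    have "eventually (\<lambda>h. h \<noteq> 0 \<and> \<bar>h\<bar> \<le> d) (at (0::real))"
      using assms(1) by (auto simp: eventually_at intro!: exI[of _ d])
    then show "eventually (\<lambda>h. norm ((F (x + h) - F x) / h - D) \<le> B * \<bar>h\<bar>) (at 0)"
    proof eventually_elim
      case (elim h)
      have "(F (x + h) - F x) / h - D = (F (x + h) - F x - h * D) / h"
        using elim by (simp add: field_simps)
      then have "norm ((F (x + h) - F x) / h - D) = \<bar>F (x + h) - F x - h * D\<bar> / \<bar>h\<bar>"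
        by (simp add: abs_divide)
      also have "\<dots> \<le> B * h\<^sup>2 / \<bar>h\<bar>"
        using elim by (intro divide_right_mono assms) auto
      also have "\<dots> = B * \<bar>h\<bar>"
        using elim by (simp add: divide_simps power2_eq_square flip: abs_mult)
      finally show ?case .
    qed
  qed
  then show ?thesis
    unfolding DERIV_def by (simp add: LIM_zero_iff)
qed

text \<open>A factor c costs only half of the exponential decay, as c \<le> (2 / x) exp (x c /
  2).\<close>

lemma integrable_laplace_mult:
  fixes c w :: "'a \<Rightarrow> real"
  assumes [measurable]: "c \<in> borel_measurable M" "w \<in> borel_measurable M"
    and c: "\<And>t. c t \<ge> 0"
    and int: "\<And>x. x > 0 \<Longrightarrow> integrable M (\<lambda>t. exp (- x * c t) * w t)" and "x > 0"
  shows "integrable M (\<lambda>t. exp (- x * c t) * (c t * w t))"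
proof (rule Bochner_Integration.integrable_bound)
  show "integrable M (\<lambda>t. 2 / x * (exp (- (x / 2) * c t) * w t))"
    using int[of "x / 2"] \<open>x > 0\<close> by (intro integrable_mult_right) auto
  show "AE t in M. norm (exp (- x * c t) * (c t * w t)) \<le> norm (2 / x * (exp (- (x / 2) * c t) * w t))"
  proof (rule AE_I2)
    fix t
    have "x / 2 * c t \<le> exp (x / 2 * c t)"
      using exp_ge_add_one_self[of "x / 2 * c t"] by linarith
    then have "c t \<le> 2 / x * exp (x / 2 * c t)"
      using \<open>x > 0\<close> by (simp add: field_simps)
    then have "exp (- x * c t) * c t \<le> exp (- x * c t) * (2 / x * exp (x / 2 * c t))"
      by (intro mult_left_mono) auto
    also have "\<dots> = 2 / x * exp (- (x / 2) * c t)"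
      by (simp add: exp_add[symmetric] field_simps)
    finally have "exp (- x * c t) * c t * \<bar>w t\<bar> \<le> 2 / x * exp (- (x / 2) * c t) * \<bar>w t\<bar>"
      by (intro mult_right_mono) auto
    then show "norm (exp (- x * c t) * (c t * w t)) \<le> norm (2 / x * (exp (- (x / 2) * c t) * w t))"
      using \<open>x > 0\<close> c[of t] by (simp add: abs_mult mult.assoc)
  qed
qed measurable

text \<open>For |h| \<le> x / 2, the second-order remainder of exp (- h c) is at most h^2 c^2 exp (x
  c / 2). The total error is then h^2 times the second absolute moment at x / 2, which is finite by
  \<open>integrable_laplace_mult\<close> used twice.\<close>

lemma DERIV_laplace:
  fixes c w :: "'a::euclidean_space \<Rightarrow> real"
  assumes meas[measurable]: "c \<in> borel_measurable M" "w \<in> borel_measurable M"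
    and c: "\<And>t. c t \<ge> 0"
    and int: "\<And>x. x > 0 \<Longrightarrow> integrable M (\<lambda>t. exp (- x * c t) * w t)" and "x > 0"
  shows "((\<lambda>x. \<integral>t. exp (- x * c t) * w t \<partial>M) has_real_derivative
           - (\<integral>t. exp (- x * c t) * (c t * w t) \<partial>M)) (at x)"
proof (rule DERIV_quadratic_error)
  show "x / 2 > 0" using \<open>x > 0\<close> by simp
  have int1: "integrable M (\<lambda>t. exp (- x * c t) * (c t * w t))" if "x > 0" for x
    by (rule integrable_laplace_mult[OF meas c int that])
  have int2: "integrable M (\<lambda>t. exp (- x * c t) * (c t * (c t * w t)))" if "x > 0" for x
    by (rule integrable_laplace_mult[OF _ _ c int1 that]) measurable
  let ?B = "\<integral>t. norm (exp (- (x / 2) * c t) * (c t * (c t * w t))) \<partial>M"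
  fix h :: real assume h: "\<bar>h\<bar> \<le> x / 2"
  let ?e = "\<lambda>t. exp (- (x + h) * c t) * w t - exp (- x * c t) * w t - h * - (exp (- x * c t) * (c t * w t))"
  have inth: "integrable M (\<lambda>t. exp (- (x + h) * c t) * w t)"
    using h \<open>x > 0\<close> by (intro int) linarith
  have intx: "integrable M (\<lambda>t. exp (- x * c t) * w t)" "integrable M (\<lambda>t. exp (- x * c t) * (c t * w t))"
    using int int1 \<open>x > 0\<close> by auto
  have inte: "integrable M ?e"
    using inth intx by (intro Bochner_Integration.integrable_diff integrable_mult_right integrable_minus) auto
  have eq: "(\<integral>t. exp (- (x + h) * c t) * w t \<partial>M) - (\<integral>t. exp (- x * c t) * w t \<partial>M)
      - h * - (\<integral>t. exp (- x * c t) * (c t * w t) \<partial>M) = (\<integral>t. ?e t \<partial>M)"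
    using inth intx by (subst Bochner_Integration.integral_diff; simp add: Bochner_Integration.integral_diff)+
  have "\<bar>\<integral>t. ?e t \<partial>M\<bar> \<le> (\<integral>t. h\<^sup>2 * norm (exp (- (x / 2) * c t) * (c t * (c t * w t))) \<partial>M)"
    unfolding real_norm_def[symmetric]
  proof (rule Bochner_Integration.integral_norm_bound_integral[OF inte])
    show "integrable M (\<lambda>t. h\<^sup>2 * norm (exp (- (x / 2) * c t) * (c t * (c t * w t))))"
      using int2[of "x / 2"] \<open>x > 0\<close> by (intro integrable_mult_right integrable_norm) auto
    fix t
    have "?e t = exp (- x * c t) * (exp (- h * c t) - 1 - (- h * c t)) * w t"
      by (simp add: algebra_simps flip: exp_add)
    then have "norm (?e t) = exp (- x * c t) * (exp (- h * c t) - 1 - (- h * c t)) * \<bar>w t\<bar>"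
      using exp_minus_linear_bounds(1)[of "- h * c t"] by (simp add: abs_mult)
    also have "\<dots> \<le> exp (- x * c t) * ((- h * c t)\<^sup>2 * exp (x / 2 * c t)) * \<bar>w t\<bar>"
    proof (intro mult_right_mono mult_left_mono)
      have "exp \<bar>- h * c t\<bar> \<le> exp (x / 2 * c t)"
        using mult_right_mono[OF h c[of t]] c[of t] by (simp only: exp_le_cancel_iff abs_mult abs_minus_cancel abs_of_nonneg)
      with exp_minus_linear_bounds(2)[of "- h * c t"]
      show "exp (- h * c t) - 1 - (- h * c t) \<le> (- h * c t)\<^sup>2 * exp (x / 2 * c t)"
        by (meson dual_order.trans mult_left_mono zero_le_power2)
    qed auto
    also have "\<dots> = h\<^sup>2 * ((exp (- x * c t) * exp (x / 2 * c t)) * (c t * (c t * \<bar>w t\<bar>)))"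
      by (simp add: power2_eq_square mult_ac)
    also have "exp (- x * c t) * exp (x / 2 * c t) = exp (- (x / 2) * c t)"
      by (simp add: field_simps flip: exp_add)
    also have "h\<^sup>2 * (exp (- (x / 2) * c t) * (c t * (c t * \<bar>w t\<bar>))) =
        h\<^sup>2 * norm (exp (- (x / 2) * c t) * (c t * (c t * w t)))"
      using c[of t] by (simp add: abs_mult)
    finally show "norm (?e t) \<le> h\<^sup>2 * norm (exp (- (x / 2) * c t) * (c t * (c t * w t)))" .
  qed
  also have "\<dots> = ?B * h\<^sup>2"
    by (subst integral_mult_right_zero) (rule mult.commute)
  finally show "\<bar>(\<integral>t. exp (- (x + h) * c t) * w t \<partial>M) - (\<integral>t. exp (- x * c t) * w t \<partial>M)
      - h * - (\<integral>t. exp (- x * c t) * (c t * w t) \<partial>M)\<bar> \<le> ?B * h\<^sup>2"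
    unfolding eq .
qed

section \<open>Moments of cosh, recurrences and the differential equation of K\<close>

definition bessel_K_weight :: "real \<Rightarrow> real \<Rightarrow> real" where
  "bessel_K_weight \<nu> t = indicator {0..} t * cosh (\<nu> * t)"

text \<open>For x > 0 and \<nu> \<ge> 0, this is (-1)^n times the n-th derivative of K; in
  particular \<open>bessel_K_moment 1\<close> stands for - K' throughout.\<close>

definition bessel_K_moment :: "nat \<Rightarrow> real \<Rightarrow> real \<Rightarrow> real" where
  "bessel_K_moment n \<nu> x = (\<integral>t. exp (- x * cosh t) * (cosh t ^ n * bessel_K_weight \<nu> t) \<partial>lborel)"

lemma bessel_K_eq_moment: "bessel_K \<nu> = bessel_K_moment 0 \<nu>"
  by (simp add: fun_eq_iff bessel_K_def bessel_K_moment_def bessel_K_weight_def set_lebesgue_integral_def mult_ac)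

lemma cosh_measurable [measurable]: "(cosh :: real \<Rightarrow> real) \<in> borel_measurable borel"
  by (intro borel_measurable_continuous_onI continuous_intros)

lemma bessel_K_weight_measurable [measurable]: "bessel_K_weight \<nu> \<in> borel_measurable borel"
  unfolding bessel_K_weight_def by measurable

lemma bessel_K_weight_nonneg: "bessel_K_weight \<nu> t \<ge> 0"
  by (simp add: bessel_K_weight_def)

lemma integrable_exp_minus_Ici: "integrable lborel (\<lambda>t. indicator {0..} t * exp (- t :: real))"
proof -
  have "(\<lambda>t::real. exp (- t)) absolutely_integrable_on {0..}"
    using integrable_on_exp_minus_to_infinity[of 1 0]
    by (intro nonnegative_absolutely_integrable_1) auto
  then have "integrable lebesgue (\<lambda>t. indicator {0..} t * exp (- t :: real))"
    by (simp add: set_integrable_def)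
  then show ?thesis
    by (subst (asm) integrable_completion) measurable
qed

text \<open>Since cosh t \<ge> exp t / 2 \<ge> t^2 / 4, it suffices to maximize (\<nu> + 1) t - x
  t^2 / 4. Completing the square gives the constant (\<nu> + 1)^2 / x; the 1 in \<nu> + 1 leaves the
  integrable factor exp (- t).\<close>

lemma exp_cosh_bound:
  fixes x \<nu> t :: real
  assumes "x > 0" "\<nu> \<ge> 0" "t \<ge> 0"
  shows "exp (- x * cosh t) * cosh (\<nu> * t) \<le> exp ((\<nu> + 1)\<^sup>2 / x) * exp (- t)"
proof -
  have "exp t \<ge> 1 + t + t\<^sup>2 / 2"
    using assms by (intro exp_lower_Taylor_quadratic)
  then have "exp t / 2 \<ge> t\<^sup>2 / 4"
    using assms by simp
  also have "exp t / 2 \<le> cosh t"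
    by (simp add: cosh_field_def)
  finally have "cosh t \<ge> t\<^sup>2 / 4" .
  then have "- x * cosh t \<le> - x * (t\<^sup>2 / 4)"
    using assms by simp
  moreover have "(\<nu> + 1) * t - x * (t\<^sup>2 / 4) \<le> (\<nu> + 1)\<^sup>2 / x"
  proof -
    have "0 \<le> (x * t / 2 - (\<nu> + 1))\<^sup>2 / x"
      using assms by simp
    also have "\<dots> = x * (t\<^sup>2 / 4) - (\<nu> + 1) * t + (\<nu> + 1)\<^sup>2 / x"
      using assms by (simp add: power2_diff divide_simps) (simp add: power2_eq_square algebra_simps)
    finally show ?thesis by simp
  qed
  ultimately have "- x * cosh t + \<nu> * t \<le> (\<nu> + 1)\<^sup>2 / x - t"
    by (simp add: algebra_simps)
  then have *: "exp (- x * cosh t) * exp (\<nu> * t) \<le> exp ((\<nu> + 1)\<^sup>2 / x) * exp (- t)"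
    by (simp flip: exp_add)
  have "cosh (\<nu> * t) \<le> exp (\<nu> * t)"
    using assms by (simp add: cosh_field_def)
  then have "exp (- x * cosh t) * cosh (\<nu> * t) \<le> exp (- x * cosh t) * exp (\<nu> * t)"
    by (intro mult_left_mono) auto
  with * show ?thesis by linarith
qed

lemma integrable_bessel_K_moment:
  assumes "x > 0" "\<nu> \<ge> 0"
  shows "integrable lborel (\<lambda>t. exp (- x * cosh t) * (cosh t ^ n * bessel_K_weight \<nu> t))"
  using assms(1)
proof (induction n arbitrary: x)
  case 0
  show ?case
  proof (rule Bochner_Integration.integrable_bound)
    show "integrable lborel (\<lambda>t. exp ((\<nu> + 1)\<^sup>2 / x) * (indicator {0..} t * exp (- t)))"
      by (intro integrable_mult_right integrable_exp_minus_Ici)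
    show "AE t in lborel. norm (exp (- x * cosh t) * (cosh t ^ 0 * bessel_K_weight \<nu> t)) \<le>
        norm (exp ((\<nu> + 1)\<^sup>2 / x) * (indicator {0..} t * exp (- t)))"
      using exp_cosh_bound[OF 0 assms(2)]
      by (intro AE_I2) (auto simp: bessel_K_weight_def indicator_def)
  qed measurable
next
  case (Suc n)
  have "integrable lborel (\<lambda>t. exp (- x * cosh t) * (cosh t * (cosh t ^ n * bessel_K_weight \<nu> t)))"
    by (rule integrable_laplace_mult[OF _ _ _ Suc.IH Suc.prems]) (auto intro: borel_measurable_times borel_measurable_power simp: cosh_measurable bessel_K_weight_measurable)
  then show ?case by (simp only: mult.assoc power_Suc)
qed

lemma DERIV_bessel_K_moment:
  assumes "x > 0" "\<nu> \<ge> 0"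
  shows "(bessel_K_moment n \<nu> has_real_derivative - bessel_K_moment (Suc n) \<nu> x) (at x)"
proof -
  have "((\<lambda>x. \<integral>t. exp (- x * cosh t) * (cosh t ^ n * bessel_K_weight \<nu> t) \<partial>lborel) has_real_derivative
      - (\<integral>t. exp (- x * cosh t) * (cosh t * (cosh t ^ n * bessel_K_weight \<nu> t)) \<partial>lborel)) (at x)"
    by (rule DERIV_laplace) (use integrable_bessel_K_moment[OF _ assms(2), of _ n] assms(1) in simp_all)
  then show ?thesis
    by (simp only: bessel_K_moment_def[abs_def] mult.assoc power_Suc)
qed

text \<open>Due to cosh \<ge> 1. For n = 0 it says - K' \<ge> K, which bounds the logarithmic
  derivative on one side and determines the sign of psi'.\<close>

lemma bessel_K_moment_le_Suc:
  assumes "x > 0" "\<nu> \<ge> 0"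
  shows "bessel_K_moment n \<nu> x \<le> bessel_K_moment (Suc n) \<nu> x"
  unfolding bessel_K_moment_def
proof (intro integral_mono integrable_bessel_K_moment assms mult_left_mono)
  fix t
  show "cosh t ^ n * bessel_K_weight \<nu> t \<le> cosh t ^ Suc n * bessel_K_weight \<nu> t"
    by (intro mult_right_mono power_increasing bessel_K_weight_nonneg) (auto simp: cosh_real_ge_1)
qed auto

lemma bessel_K_pos:
  assumes "x > 0" "\<nu> \<ge> 0"
  shows "bessel_K \<nu> x > 0"
proof -
  have "0 < exp (- x * cosh 1)" by simp
  also have "\<dots> = (\<integral>t. exp (- x * cosh 1) * indicator {0..1::real} t \<partial>lborel)"
    by simp
  also have "\<dots> \<le> bessel_K \<nu> x"
    unfolding bessel_K_eq_moment bessel_K_moment_def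
  proof (intro integral_mono integrable_bessel_K_moment assms)
    fix t :: real
    have "exp (- x * cosh 1) * 1 \<le> exp (- x * cosh t) * cosh (\<nu> * t)" if "t \<in> {0..1}"
      using that assms cosh_real_nonneg_le_iff[of t 1] cosh_real_ge_1[of "\<nu> * t"]
      by (intro mult_mono) auto
    then show "exp (- x * cosh 1) * indicator {0..1} t \<le> exp (- x * cosh t) * (cosh t ^ 0 * bessel_K_weight \<nu> t)"
      by (auto simp: indicator_def bessel_K_weight_def)
  qed auto
  finally show ?thesis .
qed

text \<open>Nonnegativity of a variance: K'^2 \<le> K'' K is the Cauchy-Schwarz inequality for 1 and
  cosh with respect to the measure that represents K.\<close>

lemma bessel_K_moment_log_convex:
  assumes "x > 0" "\<nu> \<ge> 0"
  shows "(bessel_K_moment 1 \<nu> x)\<^sup>2 \<le> bessel_K_moment 2 \<nu> x * bessel_K \<nu> x"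
proof -
  let ?m = "\<lambda>n. bessel_K_moment n \<nu> x"
  let ?f = "\<lambda>n t. exp (- x * cosh t) * (cosh t ^ n * bessel_K_weight \<nu> t)"
  have pos: "?m 0 > 0"
    using bessel_K_pos[OF assms] by (simp add: bessel_K_eq_moment)
  \<comment> \<open>The mean of cosh, which minimizes the integral of (cosh t - r)^2.\<close>
  define r where "r = ?m 1 / ?m 0"
  have int: "integrable lborel (?f n)" for n
    by (rule integrable_bessel_K_moment[OF assms])
  have "0 \<le> (\<integral>t. exp (- x * cosh t) * ((cosh t - r)\<^sup>2 * bessel_K_weight \<nu> t) \<partial>lborel)"
    by (intro integral_nonneg_AE AE_I2 mult_nonneg_nonneg bessel_K_weight_nonneg) auto
  also have "(\<lambda>t. exp (- x * cosh t) * ((cosh t - r)\<^sup>2 * bessel_K_weight \<nu> t)) =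
      (\<lambda>t. ?f 2 t - 2 * r * ?f 1 t + r\<^sup>2 * ?f 0 t)"
    by (simp add: fun_eq_iff power2_eq_square algebra_simps)
  also have "(\<integral>t. ?f 2 t - 2 * r * ?f 1 t + r\<^sup>2 * ?f 0 t \<partial>lborel) = ?m 2 - 2 * r * ?m 1 + r\<^sup>2 * ?m 0"
    unfolding bessel_K_moment_def using int
    by (simp only: Bochner_Integration.integral_add Bochner_Integration.integral_diff integral_mult_right
        integrable_mult_right Bochner_Integration.integrable_diff Bochner_Integration.integral_mult_right_zero)
  also have "\<dots> = ?m 2 - (?m 1)\<^sup>2 / ?m 0"
    using pos by (simp add: r_def power2_eq_square field_simps)
  finally show ?thesis
    using pos by (simp add: bessel_K_eq_moment field_simps)
qed

text \<open>The form in which integration by parts on the half-line is used: both boundary values of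
  G vanish.\<close>

lemma integral_Ici_derivative_eq_0:
  fixes G g :: "real \<Rightarrow> real"
  assumes deriv: "\<And>t. (G has_real_derivative g t) (at t)" and "continuous_on UNIV g"
    and int: "integrable lborel (\<lambda>t. indicator {0..} t * g t)"
    and "G 0 = 0" and lim: "(G \<longlongrightarrow> 0) at_top"
  shows "(\<integral>t. indicator {0..} t * g t \<partial>lborel) = 0"
proof -
  have set_int: "set_integrable lborel {0..} g"
    using int by (simp add: set_integrable_def)
  have "((\<lambda>b. LBINT t:{0..b}. g t) \<longlongrightarrow> (LBINT t:{0..}. g t)) at_top"
    using set_int by (intro tendsto_set_lebesgue_integral_at_top) auto
  moreover have "(LBINT t:{0..b}. g t) = G b" if "b \<ge> 0" for b
  proof -
    have "set_integrable lborel {0..b} g"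
      by (rule set_integrable_subset[OF set_int]) auto
    moreover have "(g has_integral (G b - G 0)) {0..b}"
      using that deriv
      by (intro fundamental_theorem_of_calculus)
         (auto simp flip: has_real_derivative_iff_has_vector_derivative intro: has_field_derivative_at_within)
    ultimately show ?thesis
      using \<open>G 0 = 0\<close> set_borel_integral_eq_integral(2)[of "{0..b}" g] by (simp add: integral_unique)
  qed
  then have "eventually (\<lambda>b. (LBINT t:{0..b}. g t) = G b) at_top"
    by (intro eventually_mono[OF eventually_ge_at_top[of 0]])
  ultimately have "(G \<longlongrightarrow> (LBINT t:{0..}. g t)) at_top"
    by (simp add: tendsto_cong)
  then have "(LBINT t:{0..}. g t) = 0"
    using tendsto_unique[OF _ lim] by simp
  then show ?thesis
    by (simp add: set_lebesgue_integral_def)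
qed

lemma bessel_K_weight_shift:
  "bessel_K_weight (\<nu> + 1) t = cosh t * bessel_K_weight \<nu> t + indicator {0..} t * (sinh t * sinh (\<nu> * t))"
  "bessel_K_weight (\<nu> - 1) t = cosh t * bessel_K_weight \<nu> t - indicator {0..} t * (sinh t * sinh (\<nu> * t))"
  by (simp_all add: bessel_K_weight_def cosh_add cosh_diff algebra_simps)

lemma abs_sinh_le_cosh: "\<bar>sinh (t::real)\<bar> \<le> cosh t"
  unfolding abs_le_iff sinh_field_def cosh_field_def
  using exp_gt_zero[of t] exp_gt_zero[of "- t"] by (simp add: divide_simps)

text \<open>Integration by parts: sinh (\<nu> t) exp (- x cosh t) vanishes at t = 0 and at infinity,
  and the two terms of its derivative are the two integrands.\<close>

lemma bessel_K_sinh_integral: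
  assumes "x > 0" "\<nu> \<ge> 0"
  defines "s \<equiv> \<lambda>t. exp (- x * cosh t) * (indicator {0..} t * (sinh t * sinh (\<nu> * t)))"
  shows "integrable lborel s" "x * integral\<^sup>L lborel s = \<nu> * bessel_K \<nu> x"
proof -
  let ?w = "\<lambda>t. exp (- x * cosh t) * (cosh t ^ 0 * bessel_K_weight \<nu> t)"
  \<comment> \<open>The addition formula exhibits s as a difference of integrands already known to
    be integrable.\<close>
  have s_eq: "s = (\<lambda>t. exp (- x * cosh t) * (cosh t ^ 0 * bessel_K_weight (\<nu> + 1) t) -
      exp (- x * cosh t) * (cosh t ^ 1 * bessel_K_weight \<nu> t))"
    unfolding s_def bessel_K_weight_shift(1) by (simp add: fun_eq_iff algebra_simps)
  show s: "integrable lborel s"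
    unfolding s_eq using assms by (intro Bochner_Integration.integrable_diff integrable_bessel_K_moment) auto
  have w: "integrable lborel ?w"
    by (rule integrable_bessel_K_moment[OF assms(1,2)])
  let ?G = "\<lambda>t. sinh (\<nu> * t) * exp (- x * cosh t)"
  let ?g = "\<lambda>t. \<nu> * cosh (\<nu> * t) * exp (- x * cosh t) - x * (exp (- x * cosh t) * (sinh t * sinh (\<nu> * t)))"
  have eq: "(\<lambda>t. indicator {0..} t * ?g t) = (\<lambda>t. \<nu> * ?w t - x * s t)"
    by (simp add: s_def fun_eq_iff bessel_K_weight_def algebra_simps)
  have "(\<integral>t. indicator {0..} t * ?g t \<partial>lborel) = 0"
  proof (rule integral_Ici_derivative_eq_0)
    show "(?G has_real_derivative ?g t) (at t)" for t
      by (auto intro!: derivative_eq_intros simp: algebra_simps)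
    show "continuous_on UNIV ?g"
      by (intro continuous_intros)
    show "integrable lborel (\<lambda>t. indicator {0..} t * ?g t)"
      unfolding eq using w s by (intro Bochner_Integration.integrable_diff integrable_mult_right)
    have "((\<lambda>t. exp ((\<nu> + 1)\<^sup>2 / x) * exp (- t)) \<longlongrightarrow> 0) at_top"
      by (intro tendsto_mult_right_zero filterlim_compose[OF exp_at_bot filterlim_uminus_at_bot_at_top])
    moreover have "norm (?G t) \<le> exp ((\<nu> + 1)\<^sup>2 / x) * exp (- t)" if "t \<ge> 0" for t
    proof -
      have "norm (?G t) \<le> exp (- x * cosh t) * cosh (\<nu> * t)"
        using mult_left_mono[OF abs_sinh_le_cosh[of "\<nu> * t"], of "exp (- x * cosh t)"]
        by (simp add: abs_mult mult.commute)
      also have "\<dots> \<le> exp ((\<nu> + 1)\<^sup>2 / x) * exp (- t)"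
        by (rule exp_cosh_bound[OF assms(1,2) that])
      finally show ?thesis .
    qed
    ultimately show "(?G \<longlongrightarrow> 0) at_top"
      by (intro Lim_null_comparison[of ?G] eventually_mono[OF eventually_ge_at_top[of 0]])
  qed simp
  then have "\<nu> * integral\<^sup>L lborel ?w - x * integral\<^sup>L lborel s = 0"
    unfolding eq using w s
    by (simp only: Bochner_Integration.integral_diff integrable_mult_right integral_mult_right_zero)
  then show "x * integral\<^sup>L lborel s = \<nu> * bessel_K \<nu> x"
    by (simp add: bessel_K_eq_moment bessel_K_moment_def)
qed

text \<open>In usual notation, K of order \<nu> + 1 is (\<nu> / x) K - K', and K of order \<nu> - 1
  is - (\<nu> / x) K - K'. Both come from the addition formulas for cosh ((\<nu> + 1) t) and cosh
  ((\<nu> - 1) t); the integral also makes sense if \<nu> - 1 is negative.\<close>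

lemma bessel_K_shift:
  assumes "x > 0" "\<nu> \<ge> 0"
  shows "bessel_K (\<nu> + 1) x = \<nu> / x * bessel_K \<nu> x + bessel_K_moment 1 \<nu> x"
    and "bessel_K (\<nu> - 1) x = bessel_K_moment 1 \<nu> x - \<nu> / x * bessel_K \<nu> x"
proof -
  let ?s = "\<lambda>t. exp (- x * cosh t) * (indicator {0..} t * (sinh t * sinh (\<nu> * t)))"
  let ?c = "\<lambda>t. exp (- x * cosh t) * (cosh t ^ 1 * bessel_K_weight \<nu> t)"
  have int: "integrable lborel ?c" "integrable lborel ?s"
    by (rule integrable_bessel_K_moment[OF assms], rule bessel_K_sinh_integral[OF assms])
  have s: "integral\<^sup>L lborel ?s = \<nu> / x * bessel_K \<nu> x"
    using bessel_K_sinh_integral(2)[OF assms] assms by (simp add: field_simps)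
  have "bessel_K (\<nu> + 1) x = (\<integral>t. ?c t + ?s t \<partial>lborel)"
    unfolding bessel_K_eq_moment bessel_K_moment_def bessel_K_weight_shift
    by (rule Bochner_Integration.integral_cong) (simp_all add: algebra_simps)
  also have "\<dots> = integral\<^sup>L lborel ?c + integral\<^sup>L lborel ?s"
    by (rule Bochner_Integration.integral_add[OF int])
  finally show "bessel_K (\<nu> + 1) x = \<nu> / x * bessel_K \<nu> x + bessel_K_moment 1 \<nu> x"
    unfolding s by (simp add: bessel_K_moment_def)
  have "bessel_K (\<nu> - 1) x = (\<integral>t. ?c t - ?s t \<partial>lborel)"
    unfolding bessel_K_eq_moment bessel_K_moment_def bessel_K_weight_shift
    by (rule Bochner_Integration.integral_cong) (simp_all add: algebra_simps)
  also have "\<dots> = integral\<^sup>L lborel ?c - integral\<^sup>L lborel ?s"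
    by (rule Bochner_Integration.integral_diff[OF int])
  finally show "bessel_K (\<nu> - 1) x = bessel_K_moment 1 \<nu> x - \<nu> / x * bessel_K \<nu> x"
    unfolding s by (simp add: bessel_K_moment_def)
qed

lemma DERIV_bessel_K:
  assumes "x > 0" "\<nu> \<ge> 0"
  shows "(bessel_K \<nu> has_real_derivative - bessel_K_moment 1 \<nu> x) (at x)"
  using DERIV_bessel_K_moment[OF assms, of 0] by (simp add: bessel_K_eq_moment)

text \<open>Bessel's equation for K. The formula for order \<nu> + 1 is solved for - K' and
  differentiated; this produces the derivative at order \<nu> + 1, which the downward shift brings
  back to order \<nu>.\<close>

lemma bessel_K_moment_2:
  assumes "x > 0" "\<nu> \<ge> 0"
  shows "bessel_K_moment 2 \<nu> x = (1 + \<nu>\<^sup>2 / x\<^sup>2) * bessel_K \<nu> x + bessel_K_moment 1 \<nu> x / x"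
proof -
  let ?K = "bessel_K \<nu> x" and ?M = "bessel_K_moment 1 \<nu> x"
  have "((\<lambda>x. bessel_K (\<nu> + 1) x - \<nu> / x * bessel_K \<nu> x) has_real_derivative
      (- bessel_K_moment 1 (\<nu> + 1) x - (- \<nu> / x\<^sup>2 * ?K + - ?M * (\<nu> / x)))) (at x)"
    using assms by (intro DERIV_diff DERIV_mult DERIV_bessel_K)
      (auto intro!: derivative_eq_intros simp: power2_eq_square)
  note deriv = this
  have "eventually (\<lambda>y. y \<in> {0<..}) (nhds x)"
    using assms by (intro eventually_nhds_in_open) auto
  then have "eventually (\<lambda>y. bessel_K (\<nu> + 1) y - \<nu> / y * bessel_K \<nu> y = bessel_K_moment 1 \<nu> y) (nhds x)"
    by eventually_elim (use bessel_K_shift(1)[OF _ assms(2)] in auto)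
  from DERIV_cong_ev[OF refl this refl, THEN iffD1, OF deriv] have "(bessel_K_moment 1 \<nu> has_real_derivative
      (- bessel_K_moment 1 (\<nu> + 1) x - (- \<nu> / x\<^sup>2 * ?K + - ?M * (\<nu> / x)))) (at x)" .
  with DERIV_bessel_K_moment[OF assms, of 1]
  have "bessel_K_moment 2 \<nu> x = bessel_K_moment 1 (\<nu> + 1) x + (- \<nu> / x\<^sup>2 * ?K + - ?M * (\<nu> / x))"
    using DERIV_unique by (fastforce simp: numeral_2_eq_2)
  \<comment> \<open>The downward shift is applied at order \<nu> + 1, the upward one at
    \<nu>.\<close>
  also have "bessel_K_moment 1 (\<nu> + 1) x = ?K + (\<nu> + 1) / x * (\<nu> / x * ?K + ?M)"
    using bessel_K_shift(2)[of x "\<nu> + 1"] bessel_K_shift(1)[OF assms] assms by simp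
  also have "?K + (\<nu> + 1) / x * (\<nu> / x * ?K + ?M) + (- \<nu> / x\<^sup>2 * ?K + - ?M * (\<nu> / x)) =
      (1 + \<nu>\<^sup>2 / x\<^sup>2) * ?K + ?M / x"
    using assms by (simp add: field_simps power2_eq_square)
  finally show ?thesis .
qed

lemma DERIV_bessel_K':
  assumes "x > 0" "\<nu> \<ge> 0"
  shows "(bessel_K_moment 1 \<nu> has_real_derivative
    - ((1 + \<nu>\<^sup>2 / x\<^sup>2) * bessel_K \<nu> x + bessel_K_moment 1 \<nu> x / x)) (at x)"
  using DERIV_bessel_K_moment[OF assms, of 1] bessel_K_moment_2[OF assms] by (simp add: numeral_2_eq_2)

section \<open>Behaviour of K at 0 and the Wronskian\<close>

lemma integral_exp_exp_substitution:
  fixes \<nu> y :: real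
  assumes "\<nu> \<ge> 1" "y > 0"
  shows "integrable lborel (\<lambda>t. indicator {0..} t * exp (\<nu> * t - y * exp t))"
    and "(\<lambda>s. s powr (\<nu> - 1) / exp s) integrable_on {y<..}"
    and "y powr \<nu> * (\<integral>t. indicator {0..} t * exp (\<nu> * t - y * exp t) \<partial>lborel) =
      integral {y<..} (\<lambda>s. s powr (\<nu> - 1) / exp s)"
proof -
  let ?f = "\<lambda>s::real. s powr (\<nu> - 1) / exp s"
  let ?h = "\<lambda>t. exp (\<nu> * t - y * exp t)"
  \<comment> \<open>For t \<ge> 0, the integrand is at most twice that of K at y, as cosh t \<le>
    exp t and exp (\<nu> t) \<le> 2 cosh (\<nu> t).\<close>
  show int: "integrable lborel (\<lambda>t. indicator {0..} t * ?h t)"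
  proof (rule Bochner_Integration.integrable_bound)
    show "integrable lborel (\<lambda>t. 2 * (exp (- y * cosh t) * (cosh t ^ 0 * bessel_K_weight \<nu> t)))"
      using assms by (intro integrable_mult_right integrable_bessel_K_moment) auto
    have "exp (\<nu> * t - y * exp t) \<le> 2 * (exp (- y * cosh t) * cosh (\<nu> * t))" if "t \<ge> 0" for t
    proof -
      have "cosh t \<le> exp t" "exp (\<nu> * t) \<le> 2 * cosh (\<nu> * t)"
        using that by (simp_all add: cosh_field_def)
      then have "exp (- y * exp t) * exp (\<nu> * t) \<le> exp (- y * cosh t) * (2 * cosh (\<nu> * t))"
        using assms by (intro mult_mono) auto
      then show ?thesis by (simp add: exp_diff exp_minus field_simps)
    qed
    then show "AE t in lborel. norm (indicator {0..} t * ?h t) \<le>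
        norm (2 * (exp (- y * cosh t) * (cosh t ^ 0 * bessel_K_weight \<nu> t)))"
      by (intro AE_I2) (auto simp: bessel_K_weight_def indicator_def)
  qed measurable
  \<comment> \<open>With s = y exp t and ds = s dt, the integrand s^(\<nu> - 1) exp (- s) ds becomes
    s^\<nu> exp (- s) dt; the integral is an upper incomplete Gamma function.\<close>
  have g: "?f (y * exp t) * (y * exp t) = y powr \<nu> * ?h t" for t
  proof -
    have "(y * exp t) powr (\<nu> - 1) * (y * exp t) = (y * exp t) powr \<nu>"
      using assms by (simp add: powr_diff)
    also have "\<dots> = y powr \<nu> * exp (\<nu> * t)"
      using assms by (simp add: powr_def ln_mult distrib_left exp_add)
    finally show ?thesis
      by (simp add: exp_diff)
  qed
  have "set_integrable lborel {0..} ?h"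
    using int by (simp add: set_integrable_def)
  then have "set_integrable lborel {0<..} ?h"
    by (rule set_integrable_subset) auto
  then have int': "set_integrable lborel (einterval 0 \<infinity>) (\<lambda>t. ?f (y * exp t) * (y * exp t))"
    unfolding g by (simp add: zero_ereal_def)
  have lim0: "((ereal \<circ> (\<lambda>t. y * exp t) \<circ> real_of_ereal) \<longlongrightarrow> ereal y) (at_right 0)"
    unfolding zero_ereal_def by (simp add: ereal_tendsto_simps) (auto intro!: tendsto_eq_intros)
  have lim1: "((ereal \<circ> (\<lambda>t. y * exp t) \<circ> real_of_ereal) \<longlongrightarrow> \<infinity>) (at_left \<infinity>)"
    using assms
    by (simp add: ereal_tendsto_simps)
       (intro filterlim_tendsto_pos_mult_at_top[OF tendsto_const] exp_at_top)
  have deriv: "((\<lambda>t. y * exp t) has_real_derivative y * exp t) (at t)" for t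
    by (auto intro!: derivative_eq_intros)
  have cont: "isCont ?f (y * exp t)" "isCont (\<lambda>t. y * exp t) t" for t
    using assms by (auto intro!: continuous_intros)
  have nonneg: "0 \<le> ?f (y * exp t)" "0 \<le> y * exp t" for t
    using assms by auto
  have pinf: "(0::ereal) < \<infinity>" by simp
  note subst = interval_integral_substitution_nonneg[of 0 \<infinity> "\<lambda>t. y * exp t" "\<lambda>t. y * exp t" ?f,
      OF pinf deriv cont nonneg lim0 lim1 int']
  have int_f: "set_integrable lborel {y<..} ?f"
    using subst(1) by simp
  show "?f integrable_on {y<..}"
    using set_borel_integral_eq_integral(1)[OF int_f] .
  have "(LBINT s=ereal y..\<infinity>. ?f s) = (LBINT t=0..\<infinity>. ?f (y * exp t) * (y * exp t))"
    by (rule subst(2))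
  also have "\<dots> = (LBINT t:{0<..}. y powr \<nu> * ?h t)"
    unfolding g zero_ereal_def by (rule interval_integral_to_infinity_eq)
  also have "\<dots> = y powr \<nu> * (LBINT t:{0<..}. ?h t)"
    by simp
  also have "(LBINT t:{0<..}. ?h t) = (LBINT t:{0..}. ?h t)"
  proof (rule set_integral_cong_set)
    show "AE t in lborel. (t \<in> {0..}) = (t \<in> {0::real<..})"
      using AE_lborel_singleton[of 0] by eventually_elim auto
  qed (auto simp: set_borel_measurable_def)
  finally show "y powr \<nu> * (\<integral>t. indicator {0..} t * ?h t \<partial>lborel) = integral {y<..} ?f"
    using set_borel_integral_eq_integral(2)[OF int_f]
    by (simp add: interval_integral_to_infinity_eq set_lebesgue_integral_def)
qed


text \<open>The missing integral over [0, y] has integrand at most 1, because \<nu> \<ge> 1 and s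
  \<le> y \<le> 1.\<close>

lemma incomplete_Gamma_bounds:
  fixes \<nu> y :: real
  assumes "\<nu> \<ge> 1" "y > 0" "y \<le> 1"
  shows "integral {y<..} (\<lambda>s. s powr (\<nu> - 1) / exp s) \<in> {Gamma \<nu> - y..Gamma \<nu>}"
proof -
  let ?f = "\<lambda>s::real. s powr (\<nu> - 1) / exp s"
  have G: "(?f has_integral Gamma \<nu>) {0..}"
    using assms by (intro Gamma_integral_real) auto
  then have f0: "?f integrable_on {0..y}"
    by (intro integrable_on_subinterval[of _ "{0..}"]) (auto simp: integrable_on_def)
  have le: "integral {0..y} ?f \<le> integral {0..y} (\<lambda>_. 1)"
  proof (rule integral_le[OF f0])
    fix s assume s: "s \<in> {0..y}"
    then have "s powr (\<nu> - 1) \<le> 1" "1 \<le> exp s"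
      using assms by (auto intro: powr_le1)
    then have "s powr (\<nu> - 1) \<le> exp s"
      by linarith
    then show "?f s \<le> 1"
      by simp
  qed auto
  have ge: "integral {0..y} ?f \<ge> 0"
    by (intro integral_nonneg f0) auto
  have "(?f has_integral (integral {0..y} ?f + integral {y<..} ?f)) ({0..y} \<union> {y<..})"
    using f0 integral_exp_exp_substitution(2)[OF assms(1,2)]
    by (intro has_integral_Un integrable_integral) (auto simp: ivl_disj_int)
  moreover have "{0..y} \<union> {y<..} = {0..}"
    using assms by auto
  ultimately have "integral {0..y} ?f + integral {y<..} ?f = Gamma \<nu>"
    using has_integral_unique[OF _ G] by metis
  with le ge assms show ?thesis by auto
qed

text \<open>The argument is 2 y because 2 y cosh t = y exp t + y exp (- t). Splitting 2 cosh (\<nu>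
  t) into its two exponentials, the growing one gives the incomplete Gamma integrand times exp (- y
  exp (- t)), which lies between exp (- y) and 1; the other contributes at most exp (- t), and
  y^\<nu> makes that negligible.\<close>

lemma tendsto_bessel_K_at_0:
  fixes \<nu> :: real
  assumes "\<nu> \<ge> 1"
  shows "((\<lambda>y. 2 * y powr \<nu> * bessel_K \<nu> (2 * y)) \<longlongrightarrow> Gamma \<nu>) (at_right 0)"
proof (rule tendsto_sandwich)
  define c where "c = (\<integral>t. indicator {0..} t * exp (- t :: real) \<partial>lborel)"
  let ?h = "\<lambda>y t. indicator {0..} t * exp (\<nu> * t - y * exp t)"
  have bounds: "exp (- y) * (Gamma \<nu> - y) \<le> 2 * y powr \<nu> * bessel_K \<nu> (2 * y) \<and>
      2 * y powr \<nu> * bessel_K \<nu> (2 * y) \<le> Gamma \<nu> + y powr \<nu> * c" if y: "y \<in> {0<..<1}" for y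
  proof -
    note h_int = integral_exp_exp_substitution(1)[OF assms, of y]
    have A: "y powr \<nu> * integral\<^sup>L lborel (?h y) \<in> {Gamma \<nu> - y..Gamma \<nu>}"
      using incomplete_Gamma_bounds[OF assms, of y] integral_exp_exp_substitution(3)[OF assms, of y] y by simp
    have K: "2 * bessel_K \<nu> (2 * y) = (\<integral>t. 2 * (exp (- (2 * y) * cosh t) * (cosh t ^ 0 * bessel_K_weight \<nu> t)) \<partial>lborel)"
      unfolding bessel_K_eq_moment bessel_K_moment_def by simp
    have K_int: "integrable lborel (\<lambda>t. 2 * (exp (- (2 * y) * cosh t) * (cosh t ^ 0 * bessel_K_weight \<nu> t)))"
      using y assms by (intro integrable_mult_right integrable_bessel_K_moment) auto
    have eq: "2 * (exp (- (2 * y) * cosh t) * (cosh t ^ 0 * bessel_K_weight \<nu> t)) =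
        indicator {0..} t * (exp (- y * exp (- t)) * exp (\<nu> * t - y * exp t) + exp (- (2 * y) * cosh t) * exp (- \<nu> * t))" for t
    proof -
      have "exp (- (2 * y) * cosh t) * exp (\<nu> * t) = exp (- y * exp (- t)) * exp (\<nu> * t - y * exp t)"
        unfolding cosh_field_def by (simp add: field_simps flip: exp_add)
      then show ?thesis
        unfolding bessel_K_weight_def cosh_field_def[of "\<nu> * t"] by (simp add: field_simps)
    qed
    have "exp (- y) * integral\<^sup>L lborel (?h y) = (\<integral>t. exp (- y) * ?h y t \<partial>lborel)"
      by simp
    also have "\<dots> \<le> 2 * bessel_K \<nu> (2 * y)"
      unfolding K
    proof (rule integral_mono[OF _ K_int])
      show "integrable lborel (\<lambda>t. exp (- y) * ?h y t)"
        using h_int y by (intro integrable_mult_right) auto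
      fix t
      have "exp (- y) \<le> exp (- y * exp (- t))" if "t \<ge> 0"
        using y that by simp
      then have "exp (- y) * exp (\<nu> * t - y * exp t) \<le>
          exp (- y * exp (- t)) * exp (\<nu> * t - y * exp t) + exp (- (2 * y) * cosh t) * exp (- \<nu> * t)" if "t \<ge> 0"
        using that by (intro add_increasing2 mult_right_mono) auto
      then show "exp (- y) * ?h y t \<le> 2 * (exp (- (2 * y) * cosh t) * (cosh t ^ 0 * bessel_K_weight \<nu> t))"
        unfolding eq by (auto simp: indicator_def)
    qed
    finally have "exp (- y) * integral\<^sup>L lborel (?h y) \<le> 2 * bessel_K \<nu> (2 * y)" .
    from mult_left_mono[OF this powr_ge_zero[of y \<nu>]]
    have "exp (- y) * (y powr \<nu> * integral\<^sup>L lborel (?h y)) \<le> y powr \<nu> * (2 * bessel_K \<nu> (2 * y))"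
      by (simp only: mult.left_commute)
    moreover have "exp (- y) * (Gamma \<nu> - y) \<le> exp (- y) * (y powr \<nu> * integral\<^sup>L lborel (?h y))"
      using A by (intro mult_left_mono) auto
    ultimately have lower: "exp (- y) * (Gamma \<nu> - y) \<le> y powr \<nu> * (2 * bessel_K \<nu> (2 * y))"
      by linarith
    have "2 * bessel_K \<nu> (2 * y) \<le> (\<integral>t. ?h y t + indicator {0..} t * exp (- t) \<partial>lborel)"
      unfolding K
    proof (rule integral_mono[OF K_int])
      show "integrable lborel (\<lambda>t. ?h y t + indicator {0..} t * exp (- t))"
        using h_int y by (intro Bochner_Integration.integrable_add integrable_exp_minus_Ici) auto
      fix t
      have "exp (- y * exp (- t)) * exp (\<nu> * t - y * exp t) + exp (- (2 * y) * cosh t) * exp (- \<nu> * t) \<le>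
          1 * exp (\<nu> * t - y * exp t) + 1 * exp (- t)" if "t \<ge> 0"
        using y assms that mult_right_mono[of 1 \<nu> t] by (intro add_mono mult_mono) auto
      then show "2 * (exp (- (2 * y) * cosh t) * (cosh t ^ 0 * bessel_K_weight \<nu> t)) \<le> ?h y t + indicator {0..} t * exp (- t)"
        unfolding eq by (auto simp: indicator_def)
    qed
    also have "\<dots> = integral\<^sup>L lborel (?h y) + c"
      unfolding c_def using h_int y by (intro Bochner_Integration.integral_add integrable_exp_minus_Ici) auto
    finally have "y powr \<nu> * (2 * bessel_K \<nu> (2 * y)) \<le> y powr \<nu> * (integral\<^sup>L lborel (?h y) + c)"
      by (intro mult_left_mono) auto
    then show ?thesis
      using lower A by (simp add: algebra_simps)
  qed
  have ev: "eventually (\<lambda>y. y \<in> {0<..<1}) (at_right (0::real))"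
    by (rule eventually_at_right_real) simp
  show "eventually (\<lambda>y. exp (- y) * (Gamma \<nu> - y) \<le> 2 * y powr \<nu> * bessel_K \<nu> (2 * y)) (at_right 0)"
    "eventually (\<lambda>y. 2 * y powr \<nu> * bessel_K \<nu> (2 * y) \<le> Gamma \<nu> + y powr \<nu> * c) (at_right 0)"
    by (rule eventually_mono[OF ev], use bounds in blast)+
  show "((\<lambda>y. exp (- y) * (Gamma \<nu> - y)) \<longlongrightarrow> Gamma \<nu>) (at_right 0)"
    by (auto intro!: tendsto_eq_intros)
  have "((\<lambda>y. y powr \<nu>) \<longlongrightarrow> 0 powr \<nu>) (at_right 0)"
    using assms ev
    by (intro tendsto_powr2 tendsto_ident_at tendsto_const) (auto elim: eventually_mono)
  from tendsto_add[OF tendsto_const tendsto_mult[OF this tendsto_const]]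
  show "((\<lambda>y. Gamma \<nu> + y powr \<nu> * c) \<longlongrightarrow> Gamma \<nu>) (at_right 0)"
    by simp
qed

lemma bessel_series_0: "bessel_series \<nu> 0 = rGamma (\<nu> + 1)"
  unfolding bessel_series_def using powser_zero[of "bessel_coeff \<nu>"] by (simp add: bessel_coeff_def)

text \<open>The two differential equations make the expression constant. Inserting the recurrences
  turns the bracket into K_{\<nu>+1} I_\<nu> + K_\<nu> I_{\<nu>+1}. As x tends to 0, x times the
  first product tends to Gamma (\<nu> + 1) times its reciprocal, and x times the second tends to
  0.\<close>

lemma bessel_wronskian:
  assumes "\<nu> \<ge> 0" "x > 0"
  shows "x * (bessel_K \<nu> x * bessel_I' \<nu> x + bessel_K_moment 1 \<nu> x * bessel_I \<nu> x) = 1"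
proof -
  let ?D = "\<lambda>x. x * (bessel_K \<nu> x * bessel_I' \<nu> x + bessel_K_moment 1 \<nu> x * bessel_I \<nu> x)"
  have "(?D has_real_derivative 0) (at x)" if "x > 0" for x
  proof -
    let ?K = "bessel_K \<nu> x" and ?M = "bessel_K_moment 1 \<nu> x" and ?I = "bessel_I \<nu> x" and ?J = "bessel_I' \<nu> x"
    let ?q = "1 + \<nu>\<^sup>2 / x\<^sup>2"
    have "(bessel_I \<nu> has_real_derivative ?J) (at x)"
      using DERIV_bessel_I[OF assms(1) that] by (simp add: bessel_I'_def)
    then have "(?D has_real_derivative
        1 * (?K * ?J + ?M * ?I) + (- ?M * ?J + (?q * ?I - ?J / x) * ?K + (- (?q * ?K + ?M / x) * ?I + ?J * ?M)) * x) (at x)"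
      using that assms(1)
      by (intro DERIV_mult DERIV_add DERIV_ident DERIV_bessel_K DERIV_bessel_K' DERIV_bessel_I')
    also have "1 * (?K * ?J + ?M * ?I) + (- ?M * ?J + (?q * ?I - ?J / x) * ?K + (- (?q * ?K + ?M / x) * ?I + ?J * ?M)) * x = 0"
      using that by (simp add: algebra_simps)
    finally show ?thesis .
  qed
  then obtain c where c: "\<And>x. x > 0 \<Longrightarrow> ?D x = c"
    using has_field_derivative_zero_constant[of "{0<..}" ?D] 
    by (auto simp: has_field_derivative_at_within)
  let ?L = "\<lambda>y. 2 * y powr (\<nu> + 1) * bessel_K (\<nu> + 1) (2 * y)"
  have L: "(?L \<longlongrightarrow> Gamma (\<nu> + 1)) (at_right 0)"
    using assms by (intro tendsto_bessel_K_at_0) auto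
  have ev: "eventually (\<lambda>y. y > 0) (at_right (0::real))"
    by (simp add: eventually_at_right_less)
  have series: "((\<lambda>y. bessel_series \<mu> (y\<^sup>2)) \<longlongrightarrow> bessel_series \<mu> (0\<^sup>2)) (at_right 0)" if "\<mu> \<ge> 0" for \<mu>
    using DERIV_isCont[OF DERIV_bessel_series[OF that]]
    by (intro isCont_tendsto_compose[of _ "bessel_series \<mu>"] tendsto_intros)
  have "((\<lambda>y. bessel_series \<nu> (y\<^sup>2) * ?L y) \<longlongrightarrow> rGamma (\<nu> + 1) * Gamma (\<nu> + 1)) (at_right 0)"
    using series[OF assms(1)] by (intro tendsto_mult L) (simp add: bessel_series_0)
  then have main: "((\<lambda>y. bessel_series \<nu> (y\<^sup>2) * ?L y) \<longlongrightarrow> 1) (at_right 0)"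
    using assms by (simp add: rGamma_inverse_Gamma less_imp_neq[OF Gamma_real_pos, symmetric])
  have "((\<lambda>y. y * ?L y * bessel_series (\<nu> + 1) (y\<^sup>2)) \<longlongrightarrow> 0 * Gamma (\<nu> + 1) * bessel_series (\<nu> + 1) (0\<^sup>2)) (at_right 0)"
    using assms by (intro tendsto_mult L series tendsto_ident_at) auto
  then have upper: "((\<lambda>y. y * ?L y * bessel_series (\<nu> + 1) (y\<^sup>2)) \<longlongrightarrow> 0) (at_right 0)"
    by simp
  \<comment> \<open>K of order \<nu> is estimated by K of order \<nu> + 1, whose singularity is
    known; a factor y is left over and forces the limit 0.\<close>
  have err: "((\<lambda>y. 2 * y * bessel_K \<nu> (2 * y) * bessel_I (\<nu> + 1) (2 * y)) \<longlongrightarrow> 0) (at_right 0)"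
  proof (rule tendsto_sandwich[OF _ _ tendsto_const upper])
    show "eventually (\<lambda>y. 0 \<le> 2 * y * bessel_K \<nu> (2 * y) * bessel_I (\<nu> + 1) (2 * y)) (at_right 0)"
      using ev by eventually_elim
        (use assms bessel_K_pos bessel_I_pos in \<open>auto intro!: mult_nonneg_nonneg simp: less_imp_le\<close>)
    show "eventually (\<lambda>y. 2 * y * bessel_K \<nu> (2 * y) * bessel_I (\<nu> + 1) (2 * y) \<le>
        y * ?L y * bessel_series (\<nu> + 1) (y\<^sup>2)) (at_right 0)"
      using ev
    proof eventually_elim
      case (elim y)
      have "bessel_K \<nu> (2 * y) \<le> bessel_K_moment 1 \<nu> (2 * y)"
        using bessel_K_moment_le_Suc[of "2 * y" \<nu> 0] elim assms by (simp add: bessel_K_eq_moment)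
      also have "\<dots> \<le> bessel_K (\<nu> + 1) (2 * y)"
        using bessel_K_shift(1)[of "2 * y" \<nu>] bessel_K_pos[of "2 * y" \<nu>] elim assms by simp
      finally have "bessel_K \<nu> (2 * y) * (2 * y * bessel_I (\<nu> + 1) (2 * y)) \<le>
          bessel_K (\<nu> + 1) (2 * y) * (2 * y * bessel_I (\<nu> + 1) (2 * y))"
        using elim assms bessel_I_pos[of "\<nu> + 1" "2 * y"] by (intro mult_right_mono) auto
      also have "bessel_I (\<nu> + 1) (2 * y) = y powr (\<nu> + 1) * bessel_series (\<nu> + 1) (y\<^sup>2)"
        using bessel_I_eq[of "\<nu> + 1" "2 * y"] elim assms by simp
      finally show ?case
        using bessel_I_eq[of "\<nu> + 1" "2 * y"] elim assms by (simp add: mult_ac)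
    qed
  qed
  have "((\<lambda>y. ?D (2 * y)) \<longlongrightarrow> 1 + 0) (at_right 0)"
  proof (rule Lim_transform_eventually[OF tendsto_add[OF main err]])
    show "eventually (\<lambda>y. bessel_series \<nu> (y\<^sup>2) * ?L y + 2 * y * bessel_K \<nu> (2 * y) * bessel_I (\<nu> + 1) (2 * y) = ?D (2 * y)) (at_right 0)"
      using ev
    proof eventually_elim
      case (elim y)
      have eq: "bessel_series \<nu> (y\<^sup>2) * ?L y = 2 * y * bessel_K (\<nu> + 1) (2 * y) * bessel_I \<nu> (2 * y)"
        using bessel_I_eq[of \<nu> "2 * y"] elim assms by (simp add: powr_add mult_ac)
      have K: "bessel_K (\<nu> + 1) (2 * y) = \<nu> / (2 * y) * bessel_K \<nu> (2 * y) + bessel_K_moment 1 \<nu> (2 * y)"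
        using bessel_K_shift(1)[of "2 * y" \<nu>] elim assms by simp
      show ?case
        unfolding eq unfolding K bessel_I'_def by (simp add: algebra_simps)
    qed
  qed
  moreover have "eventually (\<lambda>y. ?D (2 * y) = c) (at_right 0)"
    using ev by eventually_elim (rule c, simp)
  ultimately have "((\<lambda>y. c) \<longlongrightarrow> 1) (at_right (0::real))"
    by (simp add: tendsto_cong)
  then have "c = 1"
    by (simp add: tendsto_const_iff)
  then show ?thesis
    using c[OF assms(2)] by simp
qed


section \<open>Logarithmic derivatives of K and I at infinity\<close>

lemma tendsto_bessel_K_log_deriv:
  assumes "\<nu> \<ge> 0"
  shows "((\<lambda>x. bessel_K_moment 1 \<nu> x / bessel_K \<nu> x) \<longlongrightarrow> 1) at_top"
proof (rule tendsto_sandwich)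
  let ?r = "\<lambda>x. bessel_K_moment 1 \<nu> x / bessel_K \<nu> x"
  let ?u = "\<lambda>x. 1 / (2 * x) + sqrt (1 + (\<nu>\<^sup>2 + 1 / 4) / x\<^sup>2)"
  have bounds: "1 \<le> ?r x \<and> ?r x \<le> ?u x" if x: "x > 0" for x
  proof
    have K: "bessel_K \<nu> x > 0"
      by (rule bessel_K_pos[OF x assms])
    show "1 \<le> ?r x"
      using bessel_K_moment_le_Suc[OF x assms, of 0] K by (simp add: bessel_K_eq_moment)
    have "(?r x)\<^sup>2 = (bessel_K_moment 1 \<nu> x)\<^sup>2 / bessel_K \<nu> x / bessel_K \<nu> x"
      using K by (simp add: power2_eq_square)
    also have "\<dots> \<le> bessel_K_moment 2 \<nu> x * bessel_K \<nu> x / bessel_K \<nu> x / bessel_K \<nu> x"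
      using K by (intro divide_right_mono bessel_K_moment_log_convex x assms) auto
    also have "\<dots> = 1 + \<nu>\<^sup>2 / x\<^sup>2 + ?r x / x"
      using K by (simp add: bessel_K_moment_2[OF x assms] add_divide_distrib)
    \<comment> \<open>For r = - K' / K, log-convexity and the differential equation give r^2 \<le> 1
      + \<nu>^2 / x^2 + r / x. Completing the square in r produces the 1 / 4 and the term 1 / (2 x)
      of \<open>?u\<close>.\<close>
    finally have "(?r x - 1 / (2 * x))\<^sup>2 \<le> 1 + (\<nu>\<^sup>2 + 1 / 4) / x\<^sup>2"
      using x by (simp add: power2_diff power_divide add_divide_distrib power_mult_distrib)
    then have "?r x - 1 / (2 * x) \<le> sqrt (1 + (\<nu>\<^sup>2 + 1 / 4) / x\<^sup>2)"
      by (rule real_le_rsqrt)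
    then show "?r x \<le> ?u x" by simp
  qed
  show "eventually (\<lambda>x. 1 \<le> ?r x) at_top" "eventually (\<lambda>x. ?r x \<le> ?u x) at_top"
    by (rule eventually_mono[OF eventually_gt_at_top[of 0]], use bounds in blast)+
  have inv: "((\<lambda>x::real. inverse x) \<longlongrightarrow> 0) at_top"
    by (rule tendsto_inverse_0_at_top[OF filterlim_ident])
  have "((\<lambda>x. 1 / 2 * inverse x + sqrt (1 + (\<nu>\<^sup>2 + 1 / 4) * (inverse x)\<^sup>2)) \<longlongrightarrow>
      1 / 2 * 0 + sqrt (1 + (\<nu>\<^sup>2 + 1 / 4) * 0\<^sup>2)) at_top"
    by (intro tendsto_intros inv)
  then show "(?u \<longlongrightarrow> 1) at_top"
    by (simp add: field_simps power_divide)
qed simp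

text \<open>
  By l'Hospital's rule for the quotient of I / K by 1 / (x K^2), whose derivatives are known from
  the Wronskian and from the logarithmic derivative of K.
\<close>

lemma tendsto_bessel_K_mult_I:
  assumes "\<nu> \<ge> 0"
  shows "((\<lambda>x. x * bessel_K \<nu> x * bessel_I \<nu> x) \<longlongrightarrow> 1 / 2) at_top"
proof -
  let ?K = "bessel_K \<nu>" and ?M = "bessel_K_moment 1 \<nu>" and ?I = "bessel_I \<nu>" and ?J = "bessel_I' \<nu>"
  define r where "r x = ?M x / ?K x" for x
  have K: "?K x > 0" if "x > 0" for x
    by (rule bessel_K_pos[OF that assms])
  let ?f = "\<lambda>x. ?I x / ?K x" and ?g = "\<lambda>x. 1 / (x * (?K x)\<^sup>2)"
  have Df: "(?f has_real_derivative ?g x) (at x)" if "x > 0" for x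
  proof -
    have I: "(?I has_real_derivative ?J x) (at x)"
      using DERIV_bessel_I[OF assms that] by (simp add: bessel_I'_def)
    have "(?f has_real_derivative (?J x * ?K x - ?I x * - ?M x) / (?K x * ?K x)) (at x)"
      using K[OF that] by (intro DERIV_divide I DERIV_bessel_K that assms) auto
    also have "?J x * ?K x - ?I x * - ?M x = 1 / x"
      using bessel_wronskian[OF assms that] that by (simp add: field_simps)
    finally show ?thesis
      by (simp add: power2_eq_square)
  qed
  \<comment> \<open>With \<open>Df\<close>, the quotient of the derivatives is 1 / (2 r - 1 / x),
    which tends to 1 / 2 since r tends to 1.\<close>
  have Dg: "(?g has_real_derivative (2 * r x - 1 / x) * ?g x) (at x)" if "x > 0" for x
  proof -
    have "((\<lambda>x. x * (?K x)\<^sup>2) has_real_derivative (1 * (?K x)\<^sup>2 + (of_nat 2 * (- ?M x * (?K x) ^ (2 - Suc 0))) * x)) (at x)"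
      by (intro DERIV_mult DERIV_ident DERIV_power DERIV_bessel_K that assms)
    moreover have nz: "x * (?K x)\<^sup>2 \<noteq> 0"
      using K[OF that] that by simp
    ultimately have "((\<lambda>x. inverse (x * (?K x)\<^sup>2)) has_real_derivative
        - ((1 * (?K x)\<^sup>2 + (of_nat 2 * (- ?M x * (?K x) ^ (2 - Suc 0))) * x) * inverse ((x * (?K x)\<^sup>2) ^ Suc (Suc 0)))) (at x)"
      by (rule DERIV_inverse_fun)
    also have "- ((1 * (?K x)\<^sup>2 + (of_nat 2 * (- ?M x * (?K x) ^ (2 - Suc 0))) * x) * inverse ((x * (?K x)\<^sup>2) ^ Suc (Suc 0))) =
        (2 * r x - 1 / x) * ?g x"
      using K[OF that] that by (simp add: r_def field_simps power2_eq_square)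
    finally show ?thesis by (simp only: inverse_eq_divide)
  qed
  have r: "(r \<longlongrightarrow> 1) at_top"
    unfolding r_def by (rule tendsto_bessel_K_log_deriv[OF assms])
  have inv: "((\<lambda>x::real. 1 / x) \<longlongrightarrow> 0) at_top"
    using tendsto_inverse_0_at_top[OF filterlim_ident] by (simp add: inverse_eq_divide)
  have q: "((\<lambda>x. 2 * r x - 1 / x) \<longlongrightarrow> 2 * 1 - 0) at_top"
    by (intro tendsto_intros r inv)
  have gt1: "eventually (\<lambda>x. 2 * r x - 1 / x > 1) at_top"
    using order_tendstoD(1)[OF q, of 1] by simp
  have ev0: "eventually (\<lambda>x::real. x > 0) at_top"
    by (rule eventually_gt_at_top)
  have "((\<lambda>x. ?f x / ?g x) \<longlongrightarrow> 1 / 2) at_top"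
  proof (rule lhospital_at_top_at_top)
    show "eventually (\<lambda>x. (2 * r x - 1 / x) * ?g x \<noteq> 0) at_top"
      using gt1 ev0 by eventually_elim (use K in \<open>auto simp: less_le\<close>)
    show "eventually (\<lambda>x. (?f has_real_derivative ?g x) (at x)) at_top"
      using ev0 by eventually_elim (rule Df)
    show "eventually (\<lambda>x. (?g has_real_derivative (2 * r x - 1 / x) * ?g x) (at x)) at_top"
      using ev0 by eventually_elim (rule Dg)
    have "((\<lambda>x. 1 / (2 * r x - 1 / x)) \<longlongrightarrow> 1 / (2 * 1 - 0)) at_top"
      by (intro tendsto_divide tendsto_const q) auto
    then have "((\<lambda>x. 1 / (2 * r x - 1 / x)) \<longlongrightarrow> 1 / 2) at_top"
      by simp
    then show "((\<lambda>x. ?g x / ((2 * r x - 1 / x) * ?g x)) \<longlongrightarrow> 1 / 2) at_top"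
    proof (rule Lim_transform_eventually)
      show "eventually (\<lambda>x. 1 / (2 * r x - 1 / x) = ?g x / ((2 * r x - 1 / x) * ?g x)) at_top"
        using ev0 by eventually_elim (use K in \<open>auto simp: less_le\<close>)
    qed
    show "filterlim ?g at_top at_top"
    proof -
      obtain b where b: "b > 0" "\<And>x. x \<ge> b \<Longrightarrow> 2 * r x - 1 / x > 1"
        using eventually_conj[OF gt1 ev0] unfolding eventually_at_top_linorder by (metis order_refl)
      define c where "c = ?g b"
      have c: "c > 0"
        using b(1) K[OF b(1)] by (simp add: c_def)
      \<comment> \<open>Beyond b the logarithmic derivative of \<open>?g\<close> exceeds 1. So
        \<open>?g\<close> increases there, and its derivative is at least c: linear growth, which is
        enough for divergence.\<close>
      have growth: "c * (x - b) \<le> ?g x" if "x \<ge> b" for x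
      proof -
        have mono: "c \<le> ?g y" if "y \<ge> b" for y
          unfolding c_def
        proof (rule DERIV_nonneg_imp_nondecreasing[OF that])
          fix t assume t: "b \<le> t"
          have "0 \<le> (2 * r t - 1 / t) * ?g t"
            using b(2)[OF t] t b(1) by (intro mult_nonneg_nonneg) auto
          then show "\<exists>d. (?g has_real_derivative d) (at t) \<and> 0 \<le> d"
            using Dg[of t] t b(1) by (intro exI conjI) auto
        qed
        have "?g b - c * (b - b) \<le> ?g x - c * (x - b)"
        proof (rule DERIV_nonneg_imp_nondecreasing[OF that])
          fix t assume t: "b \<le> t"
          have "1 * c \<le> (2 * r t - 1 / t) * ?g t"
            using b(2)[OF t] mono[OF t] c by (intro mult_mono) auto
          moreover have "((\<lambda>x. ?g x - c * (x - b)) has_real_derivative ((2 * r t - 1 / t) * ?g t - c * (1 - 0))) (at t)"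
            using t b(1) by (intro DERIV_diff Dg DERIV_cmult DERIV_ident DERIV_const) auto
          ultimately show "\<exists>d. ((\<lambda>x. ?g x - c * (x - b)) has_real_derivative d) (at t) \<and> 0 \<le> d"
            by (intro exI conjI) auto
        qed
        then have "c \<le> ?g x - c * (x - b)"
          unfolding c_def by simp
        with c show ?thesis by linarith
      qed
      have "filterlim (\<lambda>x. c * (- b + x)) at_top at_top"
        using c by (intro filterlim_tendsto_pos_mult_at_top[OF tendsto_const]
            filterlim_tendsto_add_at_top[OF tendsto_const] filterlim_ident)
      then show ?thesis
        by (rule filterlim_at_top_mono) (use growth in \<open>auto intro!: eventually_mono[OF eventually_ge_at_top[of b]]\<close>)
    qed
  qed
  then show ?thesis
  proof (rule Lim_transform_eventually)
    show "eventually (\<lambda>x. ?f x / ?g x = x * ?K x * ?I x) at_top"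
      using ev0 by eventually_elim (use K in \<open>auto simp: less_le power2_eq_square\<close>)
  qed
qed

text \<open>Dividing the Wronskian identity by x K I gives I' / I = 1 / (x K I) + K' / K, with limit
  2 - 1.\<close>

lemma tendsto_bessel_I_log_deriv:
  assumes "\<nu> \<ge> 0"
  shows "((\<lambda>x. bessel_I' \<nu> x / bessel_I \<nu> x) \<longlongrightarrow> 1) at_top"
proof -
  have "((\<lambda>x. 1 / (x * bessel_K \<nu> x * bessel_I \<nu> x) - bessel_K_moment 1 \<nu> x / bessel_K \<nu> x) \<longlongrightarrow> 1 / (1 / 2) - 1) at_top"
    by (intro tendsto_intros tendsto_bessel_K_mult_I tendsto_bessel_K_log_deriv assms) simp
  moreover have "eventually (\<lambda>x. 1 / (x * bessel_K \<nu> x * bessel_I \<nu> x) - bessel_K_moment 1 \<nu> x / bessel_K \<nu> x =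
      bessel_I' \<nu> x / bessel_I \<nu> x) at_top"
    using eventually_gt_at_top[of 0]
  proof eventually_elim
    case (elim x)
    have "1 / (x * bessel_K \<nu> x * bessel_I \<nu> x) =
        x * (bessel_K \<nu> x * bessel_I' \<nu> x + bessel_K_moment 1 \<nu> x * bessel_I \<nu> x) / (x * bessel_K \<nu> x * bessel_I \<nu> x)"
      using bessel_wronskian[OF assms elim] by simp
    also have "\<dots> = bessel_I' \<nu> x / bessel_I \<nu> x + bessel_K_moment 1 \<nu> x / bessel_K \<nu> x"
      using elim bessel_K_pos[OF elim assms] bessel_I_pos[OF assms elim] by (simp add: field_simps)
    finally show ?case by simp
  qed
  ultimately show ?thesis
    by (auto intro: Lim_transform_eventually)
qed


section \<open>The functions psi and phi\<close>

lemma DERIV_powr_half_mult: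
  fixes u v :: "real \<Rightarrow> real"
  assumes u: "\<And>y. y > 0 \<Longrightarrow> (u has_real_derivative v y) (at y)"
    and v: "\<And>y. y > 0 \<Longrightarrow> (v has_real_derivative ((1 + z\<^sup>2 / y\<^sup>2) * u y - v y / y)) (at y)"
    and "\<mu> > 0" "x > 0"
  defines "f' \<equiv> \<lambda>x. x powr (- 1 / 2) * (\<mu> * v (\<mu> * x) - u (\<mu> * x) / (2 * x))"
  shows "((\<lambda>x. x powr (- 1 / 2) * u (\<mu> * x)) has_real_derivative f' x) (at x)"
    and "((\<lambda>x. x\<^sup>2 * f' x) has_real_derivative
           (x\<^sup>2 * \<mu>\<^sup>2 - 1 / 4 + z\<^sup>2) * (x powr (- 1 / 2) * u (\<mu> * x))) (at x)"
proof -
  let ?q = "\<lambda>x::real. x powr (- 1 / 2)"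
  have scale: "((\<lambda>x. \<mu> * x) has_real_derivative \<mu>) (at x)"
    by (auto intro!: derivative_eq_intros)
  have u': "((\<lambda>x. u (\<mu> * x)) has_real_derivative v (\<mu> * x) * \<mu>) (at x)"
    using assms by (intro DERIV_chain2[OF u scale]) auto
  have v': "((\<lambda>x. v (\<mu> * x)) has_real_derivative
      ((1 + z\<^sup>2 / (\<mu> * x)\<^sup>2) * u (\<mu> * x) - v (\<mu> * x) / (\<mu> * x)) * \<mu>) (at x)"
    using assms by (intro DERIV_chain2[OF v scale]) auto
  have "x powr (- 1 / 2 - 1) = ?q x / x"
    using \<open>x > 0\<close> by (subst powr_diff) simp
  then have q': "(?q has_real_derivative - ?q x / (2 * x)) (at x)"
    using has_real_derivative_powr[OF \<open>x > 0\<close>, of "- 1 / 2"] by simp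
  show "((\<lambda>x. ?q x * u (\<mu> * x)) has_real_derivative f' x) (at x)"
    using DERIV_mult[OF q' u'] \<open>x > 0\<close> by (simp add: f'_def algebra_simps)
  have "((\<lambda>x. \<mu> * x\<^sup>2) has_real_derivative \<mu> * (2 * x)) (at x)"
    "((\<lambda>x::real. x / 2) has_real_derivative 1 / 2) (at x)"
    by (auto intro!: derivative_eq_intros)
  \<comment> \<open>This is x^2 f' without the division by x inside the bracket. Differentiating the
    prefactor x^(- 1 / 2) and the summand x / 2 is what creates the potential - 1 / 4.\<close>
  then have "((\<lambda>x. ?q x * ((\<mu> * x\<^sup>2) * v (\<mu> * x) - x / 2 * u (\<mu> * x))) has_real_derivative
      - ?q x / (2 * x) * ((\<mu> * x\<^sup>2) * v (\<mu> * x) - x / 2 * u (\<mu> * x)) +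
      (\<mu> * (2 * x) * v (\<mu> * x) + ((1 + z\<^sup>2 / (\<mu> * x)\<^sup>2) * u (\<mu> * x) - v (\<mu> * x) / (\<mu> * x)) * \<mu> * (\<mu> * x\<^sup>2) -
        (1 / 2 * u (\<mu> * x) + v (\<mu> * x) * \<mu> * (x / 2))) * ?q x) (at x)"
    by (intro DERIV_mult q' DERIV_diff v' u')
  also have "- ?q x / (2 * x) * ((\<mu> * x\<^sup>2) * v (\<mu> * x) - x / 2 * u (\<mu> * x)) +
      (\<mu> * (2 * x) * v (\<mu> * x) + ((1 + z\<^sup>2 / (\<mu> * x)\<^sup>2) * u (\<mu> * x) - v (\<mu> * x) / (\<mu> * x)) * \<mu> * (\<mu> * x\<^sup>2) -
        (1 / 2 * u (\<mu> * x) + v (\<mu> * x) * \<mu> * (x / 2))) * ?q x =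
      (x\<^sup>2 * \<mu>\<^sup>2 - 1 / 4 + z\<^sup>2) * (?q x * u (\<mu> * x))"
    using \<open>x > 0\<close> \<open>\<mu> > 0\<close> by (simp add: field_simps power2_eq_square)
  finally have "((\<lambda>x. ?q x * ((\<mu> * x\<^sup>2) * v (\<mu> * x) - x / 2 * u (\<mu> * x))) has_real_derivative
      (x\<^sup>2 * \<mu>\<^sup>2 - 1 / 4 + z\<^sup>2) * (?q x * u (\<mu> * x))) (at x)" .
  \<comment> \<open>The identity is needed between functions on all of the real line, hence also at
    0, where both sides are 0.\<close>
  moreover have "?q x * ((\<mu> * x\<^sup>2) * v (\<mu> * x) - x / 2 * u (\<mu> * x)) = x\<^sup>2 * f' x" for x
    by (cases "x = 0") (simp_all add: f'_def field_simps power2_eq_square)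
  ultimately show "((\<lambda>x. x\<^sup>2 * f' x) has_real_derivative
           (x\<^sup>2 * \<mu>\<^sup>2 - 1 / 4 + z\<^sup>2) * (?q x * u (\<mu> * x))) (at x)"
    by simp
qed

definition psi' :: "real \<Rightarrow> real \<Rightarrow> real \<Rightarrow> real" where
  "psi' \<mu> z x = x powr (- 1 / 2) * (\<mu> * - bessel_K_moment 1 z (\<mu> * x) - bessel_K z (\<mu> * x) / (2 * x))"

definition phi' :: "real \<Rightarrow> real \<Rightarrow> real \<Rightarrow> real" where
  "phi' \<mu> z x = x powr (- 1 / 2) * (\<mu> * bessel_I' z (\<mu> * x) - bessel_I z (\<mu> * x) / (2 * x))"

context
  fixes \<mu> z :: real
  assumes mu: "\<mu> > 0" and z: "z \<ge> 0"
begin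

lemma psi_pos: "x > 0 \<Longrightarrow> psi \<mu> z x > 0"
  using mu z by (simp add: psi_def bessel_K_pos)

lemma phi_pos: "x > 0 \<Longrightarrow> phi \<mu> z x > 0"
  using mu z by (simp add: phi_def bessel_I_pos)

lemma psi_derivs:
  assumes "x > 0"
  shows "(psi \<mu> z has_real_derivative psi' \<mu> z x) (at x)"
    and "((\<lambda>x. x\<^sup>2 * psi' \<mu> z x) has_real_derivative (x\<^sup>2 * \<mu>\<^sup>2 - 1 / 4 + z\<^sup>2) * psi \<mu> z x) (at x)"
proof -
  have 1: "(bessel_K z has_real_derivative - bessel_K_moment 1 z y) (at y)" if "y > 0" for y
    by (rule DERIV_bessel_K[OF that z])
  have 2: "((\<lambda>y. - bessel_K_moment 1 z y) has_real_derivative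
      (1 + z\<^sup>2 / y\<^sup>2) * bessel_K z y - (- bessel_K_moment 1 z y) / y) (at y)" if "y > 0" for y
    using DERIV_minus[OF DERIV_bessel_K'[OF that z]] by (simp add: add.commute)
  show "(psi \<mu> z has_real_derivative psi' \<mu> z x) (at x)"
    "((\<lambda>x. x\<^sup>2 * psi' \<mu> z x) has_real_derivative (x\<^sup>2 * \<mu>\<^sup>2 - 1 / 4 + z\<^sup>2) * psi \<mu> z x) (at x)"
    unfolding psi_def[abs_def] psi'_def
    using DERIV_powr_half_mult[of "bessel_K z" "\<lambda>y. - bessel_K_moment 1 z y", OF 1 2 mu assms] by simp_all
qed

lemma phi_derivs:
  assumes "x > 0"
  shows "(phi \<mu> z has_real_derivative phi' \<mu> z x) (at x)"
    and "((\<lambda>x. x\<^sup>2 * phi' \<mu> z x) has_real_derivative (x\<^sup>2 * \<mu>\<^sup>2 - 1 / 4 + z\<^sup>2) * phi \<mu> z x) (at x)"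
proof -
  have 1: "(bessel_I z has_real_derivative bessel_I' z y) (at y)" if "y > 0" for y
    using DERIV_bessel_I[OF z that] by (simp add: bessel_I'_def)
  have 2: "(bessel_I' z has_real_derivative (1 + z\<^sup>2 / y\<^sup>2) * bessel_I z y - bessel_I' z y / y) (at y)" if "y > 0" for y
    by (rule DERIV_bessel_I'[OF z that])
  show "(phi \<mu> z has_real_derivative phi' \<mu> z x) (at x)"
    "((\<lambda>x. x\<^sup>2 * phi' \<mu> z x) has_real_derivative (x\<^sup>2 * \<mu>\<^sup>2 - 1 / 4 + z\<^sup>2) * phi \<mu> z x) (at x)"
    unfolding phi_def[abs_def] phi'_def
    using DERIV_powr_half_mult[of "bessel_I z" "bessel_I' z", OF 1 2 mu assms] by simp_all
qed

text \<open>Both K and - K' are positive. This allows division by psi' on all of [a, \<infinity>),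
  which has no counterpart for phi'.\<close>

lemma psi'_neg:
  assumes "x > 0"
  shows "psi' \<mu> z x < 0"
proof -
  have "bessel_K z (\<mu> * x) > 0" "bessel_K_moment 1 z (\<mu> * x) > 0"
    using bessel_K_pos[of "\<mu> * x" z] bessel_K_moment_le_Suc[of "\<mu> * x" z 0] mu z assms
    by (simp_all add: bessel_K_eq_moment)
  then have "0 < \<mu> * bessel_K_moment 1 z (\<mu> * x) + bessel_K z (\<mu> * x) / (2 * x)"
    using mu assms by (intro add_pos_pos mult_pos_pos divide_pos_pos) auto
  then have "0 < x powr (- 1 / 2) * (\<mu> * bessel_K_moment 1 z (\<mu> * x) + bessel_K z (\<mu> * x) / (2 * x))"
    using assms by simp
  then show ?thesis by (simp add: psi'_def algebra_simps)
qed

lemma psi_phi_wronskian: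
  assumes "x > 0"
  shows "x\<^sup>2 * (psi \<mu> z x * phi' \<mu> z x - psi' \<mu> z x * phi \<mu> z x) = 1"
proof -
  let ?y = "\<mu> * x"
  have "x\<^sup>2 * (psi \<mu> z x * phi' \<mu> z x - psi' \<mu> z x * phi \<mu> z x) =
      x\<^sup>2 * (x powr (- 1 / 2) * x powr (- 1 / 2)) * \<mu> *
      (bessel_K z ?y * bessel_I' z ?y + bessel_K_moment 1 z ?y * bessel_I z ?y)"
    by (simp add: psi_def phi_def psi'_def phi'_def algebra_simps)
  also have "x powr (- 1 / 2) * x powr (- 1 / 2) = 1 / x"
    using assms by (simp add: powr_minus_divide flip: powr_add)
  also have "x\<^sup>2 * (1 / x) * \<mu> = ?y"
    using assms by (simp add: power2_eq_square)
  finally show ?thesis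
    using bessel_wronskian[OF z, of ?y] mu assms by simp
qed

lemma tendsto_psi_log_deriv: "((\<lambda>x. psi' \<mu> z x / psi \<mu> z x) \<longlongrightarrow> - \<mu>) at_top"
  and tendsto_phi_log_deriv: "((\<lambda>x. phi' \<mu> z x / phi \<mu> z x) \<longlongrightarrow> \<mu>) at_top"
proof -
  have scale: "filterlim (\<lambda>x. \<mu> * x) at_top at_top"
    using mu by (intro filterlim_tendsto_pos_mult_at_top[OF tendsto_const] filterlim_ident)
  have inv: "((\<lambda>x::real. 1 / (2 * x)) \<longlongrightarrow> 0) at_top"
    using tendsto_mult[OF tendsto_const[of "1 / 2"] tendsto_inverse_0_at_top[OF filterlim_ident]]
    by (simp add: field_simps)
  have ev: "eventually (\<lambda>x::real. x > 0) at_top"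
    by (rule eventually_gt_at_top)
  have "((\<lambda>x. - (\<mu> * (bessel_K_moment 1 z (\<mu> * x) / bessel_K z (\<mu> * x))) - 1 / (2 * x)) \<longlongrightarrow> - (\<mu> * 1) - 0) at_top"
    by (intro tendsto_intros inv filterlim_compose[OF tendsto_bessel_K_log_deriv[OF z] scale])
  moreover have "eventually (\<lambda>x. - (\<mu> * (bessel_K_moment 1 z (\<mu> * x) / bessel_K z (\<mu> * x))) - 1 / (2 * x) =
      psi' \<mu> z x / psi \<mu> z x) at_top"
    using ev
  proof eventually_elim
    case (elim x)
    then show ?case
      using bessel_K_pos[of "\<mu> * x" z] mu z by (simp add: psi_def psi'_def field_simps)
  qed
  ultimately show "((\<lambda>x. psi' \<mu> z x / psi \<mu> z x) \<longlongrightarrow> - \<mu>) at_top"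
    by (auto intro: Lim_transform_eventually)
  have "((\<lambda>x. \<mu> * (bessel_I' z (\<mu> * x) / bessel_I z (\<mu> * x)) - 1 / (2 * x)) \<longlongrightarrow> \<mu> * 1 - 0) at_top"
    by (intro tendsto_intros inv filterlim_compose[OF tendsto_bessel_I_log_deriv[OF z] scale])
  moreover have "eventually (\<lambda>x. \<mu> * (bessel_I' z (\<mu> * x) / bessel_I z (\<mu> * x)) - 1 / (2 * x) =
      phi' \<mu> z x / phi \<mu> z x) at_top"
    using ev
  proof eventually_elim
    case (elim x)
    then show ?case
      using bessel_I_pos[of z "\<mu> * x"] mu z by (simp add: phi_def phi'_def field_simps)
  qed
  ultimately show "((\<lambda>x. phi' \<mu> z x / phi \<mu> z x) \<longlongrightarrow> \<mu>) at_top"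
    by (auto intro: Lim_transform_eventually)
qed

end

section \<open>Sturm-Liouville equations with integrable coefficients\<close>

lemma at_within_Ici_neq_bot: "x \<ge> a \<Longrightarrow> at x within {a..} \<noteq> (bot :: real filter)"
proof -
  assume "x \<ge> a"
  then have "at_right x \<le> at x within {a..}"
    by (intro at_le) auto
  then show ?thesis
    using trivial_limit_at_right_real[of x] by (metis bot.extremum_uniqueI)
qed

lemma deriv_from_eq:
  assumes "(f has_vector_derivative f') (at x within {a..})" "x \<ge> a"
  shows "deriv_from a f x = f'"
  unfolding deriv_from_def by (rule vector_derivative_within[OF at_within_Ici_neq_bot assms(1)]) fact

text \<open>The equation (x^2 f')' = q f with all zero-order terms collected in q. Carrying f' along
  keeps the almost-everywhere witnesses of \<open>is_solution\<close> out of the Wronskian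
  arguments.\<close>

definition solves ::
    "real \<Rightarrow> (real \<Rightarrow> 'a::{real_normed_field,euclidean_space}) \<Rightarrow> (real \<Rightarrow> 'a) \<Rightarrow> (real \<Rightarrow> 'a) \<Rightarrow> bool" where
  "solves a q f f' \<longleftrightarrow> (\<forall>x\<ge>a. (f has_vector_derivative f' x) (at x within {a..})) \<and>
     has_ac_derivative a (\<lambda>x. x\<^sup>2 *\<^sub>R f' x) (\<lambda>x. q x * f x)"

text \<open>Eliminating u and v from the three almost-everywhere relations leaves p = q f outside a
  null set, which the indefinite integral does not see.\<close>

lemma is_solution_iff:
  fixes W :: "real \<Rightarrow> 'a::{real_normed_field,euclidean_space}"
  shows "is_solution a \<mu> W z f \<longleftrightarrow>
    (\<exists>f'. solves a (\<lambda>x. of_real (x\<^sup>2 * \<mu>\<^sup>2 - 1 / 4 + z\<^sup>2) + x\<^sup>2 *\<^sub>R W x) f f')"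
proof
  assume "is_solution a \<mu> W z f"
  then obtain v u p where diff: "\<And>x. x \<ge> a \<Longrightarrow> f differentiable (at x within {a..})"
    and ac: "has_ac_derivative a (\<lambda>x. x\<^sup>2 *\<^sub>R deriv_from a f x) p"
    and u: "AE x in lebesgue. x \<ge> a \<longrightarrow> u x = - p x + (x\<^sup>2 * \<mu>\<^sup>2 - 1 / 4) *\<^sub>R f x"
    and v: "AE x in lebesgue. x \<ge> a \<longrightarrow> v x = u x + x\<^sup>2 *\<^sub>R (W x * f x)"
    and eq: "AE x in lebesgue. x \<ge> a \<longrightarrow> v x + z\<^sup>2 *\<^sub>R f x = 0"
    unfolding is_solution_def H_maps_def D_maps_def by auto
  have "AE x in lebesgue. x \<ge> a \<longrightarrow> p x = (of_real (x\<^sup>2 * \<mu>\<^sup>2 - 1 / 4 + z\<^sup>2) + x\<^sup>2 *\<^sub>R W x) * f x"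
    using u v eq
  proof eventually_elim
    case (elim x)
    show ?case
    proof
      assume "x \<ge> a"
      with elim have "- p x + (x\<^sup>2 * \<mu>\<^sup>2 - 1 / 4) *\<^sub>R f x + x\<^sup>2 *\<^sub>R (W x * f x) + z\<^sup>2 *\<^sub>R f x = 0"
        by simp
      then have "p x = p x + (- p x + (x\<^sup>2 * \<mu>\<^sup>2 - 1 / 4) *\<^sub>R f x + x\<^sup>2 *\<^sub>R (W x * f x) + z\<^sup>2 *\<^sub>R f x)"
        by (simp only: add_0_right)
      also have "\<dots> = (x\<^sup>2 * \<mu>\<^sup>2 - 1 / 4) *\<^sub>R f x + x\<^sup>2 *\<^sub>R (W x * f x) + z\<^sup>2 *\<^sub>R f x"
        by (simp only: add.assoc add_minus_cancel)
      also have "\<dots> = (of_real (x\<^sup>2 * \<mu>\<^sup>2 - 1 / 4 + z\<^sup>2) + x\<^sup>2 *\<^sub>R W x) * f x"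
        by (simp add: scaleR_conv_of_real distrib_right mult.assoc)
      finally show "p x = \<dots>" .
    qed
  qed
  then have "has_ac_derivative a (\<lambda>x. x\<^sup>2 *\<^sub>R deriv_from a f x)
      (\<lambda>x. (of_real (x\<^sup>2 * \<mu>\<^sup>2 - 1 / 4 + z\<^sup>2) + x\<^sup>2 *\<^sub>R W x) * f x)"
    by (rule ac_cong_AE[OF ac]) simp
  moreover have "(f has_vector_derivative deriv_from a f x) (at x within {a..})" if "x \<ge> a" for x
    using diff[OF that] unfolding deriv_from_def by (simp add: vector_derivative_works)
  ultimately show "\<exists>f'. solves a (\<lambda>x. of_real (x\<^sup>2 * \<mu>\<^sup>2 - 1 / 4 + z\<^sup>2) + x\<^sup>2 *\<^sub>R W x) f f'"
    unfolding solves_def by blast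
next
  let ?q = "\<lambda>x. of_real (x\<^sup>2 * \<mu>\<^sup>2 - 1 / 4 + z\<^sup>2) + x\<^sup>2 *\<^sub>R W x"
  assume "\<exists>f'. solves a ?q f f'"
  then obtain f' where f: "\<And>x. x \<ge> a \<Longrightarrow> (f has_vector_derivative f' x) (at x within {a..})"
    and ac: "has_ac_derivative a (\<lambda>x. x\<^sup>2 *\<^sub>R f' x) (\<lambda>x. ?q x * f x)"
    unfolding solves_def by blast
  let ?u = "\<lambda>x. - (?q x * f x) + (x\<^sup>2 * \<mu>\<^sup>2 - 1 / 4) *\<^sub>R f x"
  have "has_ac_derivative a (\<lambda>x. x\<^sup>2 *\<^sub>R deriv_from a f x) (\<lambda>x. ?q x * f x)"
    by (rule ac_cong[OF ac]) (simp_all add: deriv_from_eq[OF f])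
  then have "D_maps a \<mu> f ?u"
    unfolding D_maps_def using f by (auto intro: differentiableI_vector)
  then have "H_maps a \<mu> W f (\<lambda>x. ?u x + x\<^sup>2 *\<^sub>R (W x * f x))"
    unfolding H_maps_def by (intro exI conjI) auto
  moreover have "?u x + x\<^sup>2 *\<^sub>R (W x * f x) + z\<^sup>2 *\<^sub>R f x = 0" for x
    by (simp add: scaleR_conv_of_real algebra_simps)
  ultimately show "is_solution a \<mu> W z f"
    unfolding is_solution_def by (intro exI conjI) auto
qed

text \<open>x^2 f' is an indefinite integral, hence continuous, and x^2 has no zero on [a,
  \<infinity>).\<close>

lemma solves_deriv_continuous:
  assumes "solves a q f f'" "a > 0"
  shows "continuous_on {a..} f'"
proof -
  have "continuous_on {a..} (\<lambda>x. inverse (x\<^sup>2) *\<^sub>R (x\<^sup>2 *\<^sub>R f' x))"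
    using assms by (intro continuous_intros ac_continuous) (auto simp: solves_def)
  then show ?thesis
    by (rule continuous_on_eq) (use assms in auto)
qed

lemma solves_ac:
  assumes "solves a q f f'" "a > 0"
  shows "has_ac_derivative a f f'"
  using assms by (intro ac_of_vector_derivative solves_deriv_continuous[OF assms]) (auto simp: solves_def)

lemma solves_continuous: "solves a q f f' \<Longrightarrow> a > 0 \<Longrightarrow> continuous_on {a..} f"
  by (rule ac_continuous[OF solves_ac])

text \<open>The product rule is applied to f (x^2 g') - (x^2 f') g, where every factor is absolutely
  continuous; the terms with q cancel.\<close>

lemma solves_wronskian_const:
  assumes f: "solves a q f f'" and g: "solves a q g g'" and "a > 0" "x \<ge> a"
  shows "x\<^sup>2 *\<^sub>R (f x * g' x - f' x * g x) = a\<^sup>2 *\<^sub>R (f a * g' a - f' a * g a)"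
proof -
  have "has_ac_derivative a (\<lambda>x. f x * (x\<^sup>2 *\<^sub>R g' x) - (x\<^sup>2 *\<^sub>R f' x) * g x)
    (\<lambda>x. (f' x * (x\<^sup>2 *\<^sub>R g' x) + f x * (q x * g x)) - ((q x * f x) * g x + (x\<^sup>2 *\<^sub>R f' x) * g' x))"
    using f g solves_ac[OF f \<open>a > 0\<close>] solves_ac[OF g \<open>a > 0\<close>] unfolding solves_def
    by (intro ac_diff ac_prod[OF bounded_bilinear_mult]) auto
  then have "has_ac_derivative a (\<lambda>x. x\<^sup>2 *\<^sub>R (f x * g' x - f' x * g x)) (\<lambda>x. 0)"
    by (rule ac_cong) (auto simp: algebra_simps)
  from ac_zero_const[OF this \<open>x \<ge> a\<close>] show ?thesis .
qed

lemma solves_lincomb: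
  assumes "solves a q f f'" "solves a q g g'"
  shows "solves a q (\<lambda>x. c * f x + d * g x) (\<lambda>x. c * f' x + d * g' x)"
  unfolding solves_def
proof (intro conjI allI impI)
  fix x assume "x \<ge> a"
  then show "((\<lambda>x. c * f x + d * g x) has_vector_derivative c * f' x + d * g' x) (at x within {a..})"
    using assms by (intro derivative_intros) (auto simp: solves_def)
next
  have "has_ac_derivative a (\<lambda>x. c * (x\<^sup>2 *\<^sub>R f' x) + d * (x\<^sup>2 *\<^sub>R g' x)) (\<lambda>x. c * (q x * f x) + d * (q x * g x))"
    using assms by (intro ac_add ac_linear[OF bounded_linear_mult_right]) (auto simp: solves_def)
  then show "has_ac_derivative a (\<lambda>x. x\<^sup>2 *\<^sub>R (c * f' x + d * g' x)) (\<lambda>x. q x * (c * f x + d * g x))"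
    by (rule ac_cong) (auto simp: algebra_simps)
qed

text \<open>
  The coefficients of f are its (constant) Wronskians with the two basis solutions.
\<close>

lemma solves_span:
  assumes f: "solves a q f f'" and g: "solves a q g g'" and h: "solves a q h h'" and "a > 0"
    and wr: "\<And>x. x \<ge> a \<Longrightarrow> x\<^sup>2 *\<^sub>R (g x * h' x - g' x * h x) = 1"
  obtains c d where "\<And>x. x \<ge> a \<Longrightarrow> f x = c * g x + d * h x" "\<And>x. x \<ge> a \<Longrightarrow> f' x = c * g' x + d * h' x"
proof -
  define c where "c = a\<^sup>2 *\<^sub>R (f a * h' a - f' a * h a)"
  define d where "d = - (a\<^sup>2 *\<^sub>R (f a * g' a - f' a * g a))"
  have *: "f x = c * g x + d * h x \<and> f' x = c * g' x + d * h' x" if "x \<ge> a" for x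
  proof -
    have cd: "c = x\<^sup>2 *\<^sub>R (f x * h' x - f' x * h x)" "d = - (x\<^sup>2 *\<^sub>R (f x * g' x - f' x * g x))"
      using solves_wronskian_const[OF f h \<open>a > 0\<close> that] solves_wronskian_const[OF f g \<open>a > 0\<close> that]
      by (auto simp: c_def d_def)
    have "c * g x + d * h x = (x\<^sup>2 *\<^sub>R (g x * h' x - g' x * h x)) * f x"
      "c * g' x + d * h' x = (x\<^sup>2 *\<^sub>R (g x * h' x - g' x * h x)) * f' x"
      unfolding cd by (simp_all add: scaleR_conv_of_real algebra_simps)
    then show ?thesis
      using wr[OF that] by simp
  qed
  show ?thesis
    by (rule that[of c d]) (use * in auto)
qed

text \<open>Spanning is \<open>solves_span\<close>. For independence, a vanishing combination is
  also differentiated at a, one-sidedly, which gives two linear equations with the Wronskian as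
  determinant.\<close>

lemma fundamental_systemI:
  fixes W :: "real \<Rightarrow> 'a::{real_normed_field,euclidean_space}"
  defines "q \<equiv> \<lambda>\<mu> z x. of_real (x\<^sup>2 * \<mu>\<^sup>2 - 1 / 4 + z\<^sup>2) + x\<^sup>2 *\<^sub>R W x"
  assumes g: "solves a (q \<mu> z) g g'" and h: "solves a (q \<mu> z) h h'" and "a > 0"
    and wr: "\<And>x. x \<ge> a \<Longrightarrow> x\<^sup>2 *\<^sub>R (g x * h' x - g' x * h x) = 1"
  shows "fundamental_system a \<mu> W z g h"
  unfolding fundamental_system_def
proof (intro conjI allI impI)
  show "is_solution a \<mu> W z g" "is_solution a \<mu> W z h"
    using g h unfolding is_solution_iff q_def by blast+
next
  fix f assume "is_solution a \<mu> W z f"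
  then obtain f' where "solves a (q \<mu> z) f f'"
    unfolding is_solution_iff q_def by blast
  from solves_span[OF this g h \<open>a > 0\<close> wr]
  show "\<exists>c d. \<forall>x\<ge>a. f x = c * g x + d * h x" by metis
next
  fix c d assume 0: "\<forall>x\<ge>a. c * g x + d * h x = 0"
  have "((\<lambda>x. c * g x + d * h x) has_vector_derivative c * g' a + d * h' a) (at a within {a..})"
    using solves_lincomb[OF g h] unfolding solves_def by blast
  moreover have "((\<lambda>x. c * g x + d * h x) has_vector_derivative 0) (at a within {a..})"
    by (rule has_vector_derivative_transform[of a "{a..}" _ "\<lambda>_. 0"]) (use 0 in auto)
  ultimately have 1: "c * g' a + d * h' a = 0"
    using deriv_from_eq order_refl by metis
  \<comment> \<open>Cramer's rule for these two equations.\<close>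
  have "c * (g a * h' a - g' a * h a) = (c * g a + d * h a) * h' a - (c * g' a + d * h' a) * h a"
    "d * (g a * h' a - g' a * h a) = (c * g' a + d * h' a) * g a - (c * g a + d * h a) * g' a"
    by (simp_all add: algebra_simps)
  then have "c * (g a * h' a - g' a * h a) = 0" "d * (g a * h' a - g' a * h a) = 0"
    using 0 1 by simp_all
  moreover have "g a * h' a - g' a * h a \<noteq> 0"
    using wr[of a] by auto
  ultimately show "c = 0" "d = 0" by auto
qed

section \<open>Bounded continuous functions, integrals over half-lines, exponentials of indefinite
  integrals\<close>

lemma Cb_tendsto:
  fixes f :: "real \<Rightarrow> 'a::real_normed_vector"
  assumes "continuous_on {a..} f" "(f \<longlongrightarrow> l) at_top"
  shows "f \<in> Cb a"
proof -
  obtain b where b: "\<And>x. x \<ge> b \<Longrightarrow> dist (f x) l < 1"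
    using tendstoD[OF assms(2), of 1] by (auto simp: eventually_at_top_linorder)
  have "f ` {a..} \<subseteq> f ` {a..b} \<union> ball l 1"
  proof (rule image_subsetI)
    fix x assume x: "x \<in> {a..}"
    show "f x \<in> f ` {a..b} \<union> ball l 1"
      using b[of x] x by (cases "b \<le> x") (auto simp: dist_commute)
  qed
  moreover have "bounded (f ` {a..b} \<union> ball l 1)"
    using assms(1) by (auto intro!: compact_imp_bounded compact_continuous_image intro: continuous_on_subset)
  ultimately show ?thesis
    using assms(1) bounded_subset unfolding Cb_def by blast
qed

lemma Cb_bounded:
  assumes "f \<in> Cb a"
  obtains B where "\<And>x. x \<ge> a \<Longrightarrow> norm (f x :: 'a::real_normed_vector) \<le> B"
proof -
  have "bounded (f ` {a..})"
    using assms by (simp add: Cb_def)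
  then obtain B where "\<forall>y\<in>f ` {a..}. norm y \<le> B"
    unfolding bounded_iff by blast
  then show ?thesis
    by (intro that[of B]) simp
qed

lemma integral_Ici_split:
  fixes f :: "real \<Rightarrow> 'a::euclidean_space"
  assumes "f absolutely_integrable_on {a..}" "x \<ge> a"
  shows "integral {x..} f = integral {a..} f - integral {a..x} f"
proof -
  have "f absolutely_integrable_on {a..x}" "f absolutely_integrable_on {x..}"
    by (rule set_integrable_subset[OF assms(1)]; use assms(2) in auto)+
  then have "(f has_integral (integral {a..x} f + integral {x..} f)) ({a..x} \<union> {x..})"
    by (intro has_integral_Un integrable_integral absint_integrable) (auto intro: negligible_subset[OF negligible_sing[of x]])
  moreover have "{a..x} \<union> {x..} = {a..}"
    using assms by auto
  ultimately show ?thesis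
    by (simp add: integral_unique)
qed

lemma tendsto_integral_Ici:
  fixes f :: "real \<Rightarrow> 'a::euclidean_space"
  assumes "f absolutely_integrable_on {a..}"
  shows "((\<lambda>x. integral {x..} f) \<longlongrightarrow> 0) at_top"
proof -
  have "((\<lambda>b. LINT x:{a..b}|lebesgue. f x) \<longlongrightarrow> (LINT x:{a..}|lebesgue. f x)) at_top"
    by (intro tendsto_set_lebesgue_integral_at_top assms) auto
  moreover have "f absolutely_integrable_on {a..b}" for b
    by (rule set_integrable_subset[OF assms]) auto
  ultimately have "((\<lambda>b. integral {a..b} f) \<longlongrightarrow> integral {a..} f) at_top"
    using assms by (simp add: set_lebesgue_integral_eq_integral(2))
  from tendsto_diff[OF tendsto_const this, of "integral {a..} f"]
  have "((\<lambda>b. integral {a..} f - integral {a..b} f) \<longlongrightarrow> 0) at_top" by simp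
  then show ?thesis
    by (rule Lim_transform_eventually)
       (rule eventually_mono[OF eventually_ge_at_top[of a]], rule integral_Ici_split[OF assms, symmetric])
qed

lemma ac_integral_Icc:
  fixes f :: "real \<Rightarrow> 'a::euclidean_space"
  assumes "\<And>x. x \<ge> a \<Longrightarrow> f absolutely_integrable_on {a..x}"
  shows "has_ac_derivative a (\<lambda>x. c + integral {a..x} f) f"
  using assms by (intro has_ac_derivativeI) auto

lemma ac_integral_Ici:
  fixes f :: "real \<Rightarrow> 'a::euclidean_space"
  assumes "f absolutely_integrable_on {a..}"
  shows "has_ac_derivative a (\<lambda>x. integral {x..} f) (\<lambda>x. - f x)"
proof (rule has_ac_derivativeI)
  fix x assume x: "x \<ge> a"
  have "f absolutely_integrable_on {a..x}"
    by (rule set_integrable_subset[OF assms]) auto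
  then show "(\<lambda>x. - f x) absolutely_integrable_on {a..x}"
    using absolutely_integrable_linear[OF _ bounded_linear_minus[OF bounded_linear_ident]]
    by (force simp: o_def)
  show "integral {x..} f = integral {a..} f + integral {a..x} (\<lambda>x. - f x)"
    using integral_Ici_split[OF assms x] by simp
qed

text \<open>The scheme of \<open>ac_prod\<close> once more: over a short interval the increment of
  exp (m) is c times that of m, with c close to every exp (m t) on the interval. Needed for the
  weights of the Volterra equations.\<close>

lemma ac_exp:
  fixes m :: "real \<Rightarrow> real"
  assumes m: "has_ac_derivative a m w"
  shows "has_ac_derivative a (\<lambda>x. exp (m x)) (\<lambda>x. w x * exp (m x))"
proof -
  have cm: "continuous_on {x..y} (\<lambda>x. exp (m x))" if "a \<le> x" for x y
    using ac_continuous[OF m] that by (auto intro!: continuous_intros intro: continuous_on_subset)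
  have iw: "(\<lambda>t. w t * H t) absolutely_integrable_on {x..y}" if "a \<le> x" "continuous_on {x..y} H" for x y H
    by (rule absolutely_integrable_continuous_bilinear_Icc
        [OF bounded_bilinear.flip[OF bounded_bilinear_mult] that(2) ac_integrable[OF m that(1)]])
  define E where "E x = exp (m x) - integral {a..x} (\<lambda>t. w t * exp (m t))" for x
  define M where "M x = integral {a..x} (\<lambda>t. norm (w t))" for x
  have in': "(\<lambda>t. norm (w t)) absolutely_integrable_on {x..y}" if "a \<le> x" for x y
    by (intro absolutely_integrable_norm[unfolded o_def] ac_integrable[OF m that])
  have "E b = E a" if "a \<le> b" for b
  proof (rule eq_if_increments_small[OF that, where m=M])
    fix e :: real assume "e > 0"
    then have "e / 2 > 0" by simp
    from uniformly_continuous_onE[OF compact_uniformly_continuous[OF cm[OF order_refl, of b] compact_Icc] this]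
    obtain d where d: "d > 0" "\<And>x y. \<lbrakk>x \<in> {a..b}; y \<in> {a..b}; dist y x < d\<rbrakk> \<Longrightarrow> dist (exp (m y)) (exp (m x)) < e / 2"
      by blast
    show "\<exists>d>0. \<forall>x y. a \<le> x \<longrightarrow> x \<le> y \<longrightarrow> y \<le> b \<longrightarrow> y - x < d \<longrightarrow> norm (E y - E x) \<le> e * (M y - M x)"
    proof (intro exI[of _ d] conjI allI impI)
      fix x y assume xy: "a \<le> x" "x \<le> y" "y \<le> b" "y - x < d"
      \<comment> \<open>By the mean value theorem c is exp \<xi> with \<xi> between m x and m y; if
        these coincide, any nearby value works and exp (m x) is taken.\<close>
      obtain c where c: "exp (m y) - exp (m x) = c * (m y - m x)" "\<bar>c - exp (m x)\<bar> \<le> \<bar>exp (m y) - exp (m x)\<bar>"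
      proof (cases "m x = m y")
        case False
        obtain \<xi> where \<xi>: "exp (m y) - exp (m x) = exp \<xi> * (m y - m x)" "\<xi> \<in> {min (m x) (m y)..max (m x) (m y)}"
        proof (cases "m x < m y")
          case True
          from MVT2[OF this, of exp exp] show thesis
            using that by (auto simp: mult.commute)
        next
          case ne: False
          with False have "m y < m x" by simp
          from MVT2[OF this, of exp exp] obtain \<xi> where "m y < \<xi>" "\<xi> < m x" "exp (m x) - exp (m y) = (m x - m y) * exp \<xi>"
            by auto
          then show thesis
            by (intro that[of \<xi>]) (auto simp: algebra_simps)
        qed
        have "\<bar>exp \<xi> - exp (m x)\<bar> \<le> \<bar>exp (m y) - exp (m x)\<bar>"
          using \<xi>(2) by (cases "m x \<le> m y") auto
        with \<xi>(1) show thesis by (rule that)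
      qed (rule that[of "exp (m x)"], auto)
      have c_near: "\<bar>c - exp (m t)\<bar> \<le> e" if "t \<in> {x..y}" for t
      proof -
        have "\<bar>exp (m y) - exp (m x)\<bar> < e / 2" "\<bar>exp (m t) - exp (m x)\<bar> < e / 2"
          using d(2)[of x y] d(2)[of x t] that xy by (simp_all add: dist_real_def)
        with c(2) show ?thesis by linarith
      qed
      have 1: "integral {a..y} (\<lambda>t. w t * exp (m t)) = integral {a..x} (\<lambda>t. w t * exp (m t)) + integral {x..y} (\<lambda>t. w t * exp (m t))"
        using xy by (intro Henstock_Kurzweil_Integration.integral_combine[symmetric] absint_integrable iw cm) auto
      have 2: "M y = M x + integral {x..y} (\<lambda>t. norm (w t))"
        unfolding M_def using xy by (intro Henstock_Kurzweil_Integration.integral_combine[symmetric] absint_integrable in') auto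
      have "c * (m y - m x) = integral {x..y} (\<lambda>t. w t * c)"
        using ac_increment[OF m xy(1,2)] by (simp add: mult.commute)
      then have "E y - E x = integral {x..y} (\<lambda>t. w t * c) - integral {x..y} (\<lambda>t. w t * exp (m t))"
        unfolding E_def 1 using c(1) by simp
      also have "\<dots> = integral {x..y} (\<lambda>t. w t * c - w t * exp (m t))"
        by (intro Henstock_Kurzweil_Integration.integral_diff[symmetric] absint_integrable iw cm continuous_intros xy)
      also have "norm \<dots> \<le> integral {x..y} (\<lambda>t. e * norm (w t))"
      proof (rule integral_norm_bound_integral)
        show "(\<lambda>t. w t * c - w t * exp (m t)) integrable_on {x..y}"
          by (intro absint_integrable set_integral_diff(1) iw cm continuous_intros xy)
        show "(\<lambda>t. e * norm (w t)) integrable_on {x..y}"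
          using absint_integrable[OF in'[OF xy(1), of y]] by (intro integrable_on_mult_right)
        fix t assume "t \<in> {x..y}"
        from mult_left_mono[OF c_near[OF this], of "\<bar>w t\<bar>"]
        show "norm (w t * c - w t * exp (m t)) \<le> e * norm (w t)"
          by (simp only: real_norm_def abs_mult mult.commute[of e] flip: right_diff_distrib)
      qed
      also have "\<dots> = e * (M y - M x)"
        by (simp add: 2)
      finally show "norm (E y - E x) \<le> e * (M y - M x)" .
    qed (use d in auto)
  qed
  note E_const = this
  have "exp (m x) = exp (m a) + integral {a..x} (\<lambda>t. w t * exp (m t))" if "a \<le> x" for x
    using E_const[OF that] by (simp add: E_def diff_eq_eq)
  with iw[OF order_refl cm[OF order_refl]] show ?thesis
    by (rule has_ac_derivativeI)
qed

section \<open>Volterra equations with integrable potentials\<close>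

text \<open>Banach's fixed point theorem for the norm sup |g| / \<omega>: writing g = \<omega> u
  makes it the plain supremum norm of u. The bounds \<delta> and M keep both directions of this
  change of function within bounded functions.\<close>

lemma weighted_fixed_point:
  fixes L :: "(real \<Rightarrow> 'a::banach) \<Rightarrow> real \<Rightarrow> 'a" and \<omega> :: "real \<Rightarrow> real"
  assumes cont: "continuous_on {a..} \<omega>" and "\<delta> > 0"
    and \<omega>: "\<And>x. x \<ge> a \<Longrightarrow> \<delta> \<le> \<omega> x" "\<And>x. x \<ge> a \<Longrightarrow> \<omega> x \<le> M"
    and L: "\<And>g. g \<in> Cb a \<Longrightarrow> L g \<in> Cb a"
    and contr: "\<And>g h r x. \<lbrakk>g \<in> Cb a; h \<in> Cb a; r \<ge> 0; \<And>t. t \<ge> a \<Longrightarrow> norm (g t - h t) \<le> r * \<omega> t; x \<ge> a\<rbrakk> \<Longrightarrow>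
                  norm (L g x - L h x) \<le> r / 2 * \<omega> x"
    and g0: "g0 \<in> Cb a"
  obtains g where "g \<in> Cb a" "\<And>x. x \<ge> a \<Longrightarrow> g x = g0 x + L g x"
proof -
  have pos: "\<omega> x > 0" if "x \<ge> a" for x
    using \<omega>(1)[OF that] \<open>\<delta> > 0\<close> by linarith
  define lift where "lift u t = \<omega> t *\<^sub>R apply_bcontfun u t" for u :: "real \<Rightarrow>\<^sub>C 'a" and t
  have lift: "lift u \<in> Cb a" for u
  proof -
    obtain B where B: "\<And>x. norm (apply_bcontfun u x) \<le> B"
      using norm_bounded by blast
    have "norm (lift u x) \<le> M * B" if "x \<ge> a" for x
      using \<omega>(2)[OF that] pos[OF that] B[of x] by (auto simp: lift_def intro!: mult_mono)
    moreover have "continuous_on {a..} (lift u)"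
      unfolding lift_def by (intro continuous_intros cont continuous_on_apply_bcontfun)
    ultimately show ?thesis
      unfolding Cb_def bounded_iff by auto
  qed
  \<comment> \<open>Bounded continuous functions live on the whole line; \<open>max a x\<close>
    continues everything by a constant to the left of a.\<close>
  define T where "T u x = (1 / \<omega> (max a x)) *\<^sub>R (g0 (max a x) + L (lift u) (max a x))" for u x
  have T: "T u \<in> bcontfun" for u
  proof -
    obtain B where B: "\<And>x. x \<ge> a \<Longrightarrow> norm (g0 x) \<le> B"
      using Cb_bounded[OF g0] by blast
    obtain B' where B': "\<And>x. x \<ge> a \<Longrightarrow> norm (L (lift u) x) \<le> B'"
      using Cb_bounded[OF L[OF lift]] by blast
    have "continuous_on UNIV (\<lambda>x. (\<lambda>y. (1 / \<omega> y) *\<^sub>R (g0 y + L (lift u) y)) (max a x))"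
    proof (rule continuous_on_compose2[of "{a..}"])
      show "continuous_on {a..} (\<lambda>y. (1 / \<omega> y) *\<^sub>R (g0 y + L (lift u) y))"
        using g0 L[OF lift, of u] pos by (intro continuous_intros cont) (auto simp: Cb_def less_le)
    qed (auto intro!: continuous_intros)
    then have "continuous_on UNIV (T u)"
      by (simp add: T_def[abs_def])
    moreover have "norm (T u x) \<le> 1 / \<delta> * (B + B')" for x
    proof -
      have "norm (g0 (max a x) + L (lift u) (max a x)) \<le> B + B'"
        by (intro norm_triangle_le add_mono B B') auto
      moreover have "1 / \<omega> (max a x) \<le> 1 / \<delta>"
        using \<omega>(1)[of "max a x"] \<open>\<delta> > 0\<close> by (intro divide_left_mono) auto
      ultimately have "1 / \<omega> (max a x) * norm (g0 (max a x) + L (lift u) (max a x)) \<le> 1 / \<delta> * (B + B')"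
        using \<open>\<delta> > 0\<close> by (intro mult_mono) auto
      then show ?thesis
        using pos[of "max a x"] by (simp add: T_def)
    qed
    ultimately show ?thesis
      by (rule bcontfun_normI)
  qed
  define F where "F u = Bcontfun (T u)" for u
  have F: "apply_bcontfun (F u) = T u" for u
    unfolding F_def by (rule Bcontfun_inverse[OF T])
  have "dist (F u) (F v) \<le> 1 / 2 * dist u v" for u v
  proof (rule dist_bound)
    fix x
    define y where "y = max a x"
    have y: "y \<ge> a" by (simp add: y_def)
    have "norm (lift u t - lift v t) \<le> dist u v * \<omega> t" if "t \<ge> a" for t
    proof -
      have "norm (lift u t - lift v t) = \<omega> t * dist (apply_bcontfun u t) (apply_bcontfun v t)"
        using pos[OF that] by (simp add: lift_def dist_norm flip: scaleR_diff_right)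
      also have "\<dots> \<le> \<omega> t * dist u v"
        using pos[OF that] by (intro mult_left_mono dist_bounded) auto
      finally show ?thesis by (simp add: mult.commute)
    qed
    then have "norm (L (lift u) y - L (lift v) y) \<le> dist u v / 2 * \<omega> y"
      by (intro contr lift y) auto
    moreover have "dist (F u x) (F v x) = norm (L (lift u) y - L (lift v) y) / \<omega> y"
      using pos[OF y] by (simp add: F T_def y_def[symmetric] dist_norm flip: scaleR_diff_right)
    ultimately show "dist (F u x) (F v x) \<le> 1 / 2 * dist u v"
      using pos[OF y] by (simp add: pos_divide_le_eq)
  qed
  then have "\<exists>!u. F u = u"
    by (intro banach_fix_type[of "1 / 2"]) auto
  then obtain u where u: "F u = u" by blast
  show thesis
  proof (rule that)
    show "lift u \<in> Cb a" by (rule lift)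
    fix x assume x: "x \<ge> a"
    then have "apply_bcontfun u x = (1 / \<omega> x) *\<^sub>R (g0 x + L (lift u) x)"
      using F[of u] u by (simp add: T_def max_absorb2)
    then show "lift u x = g0 x + L (lift u) x"
      using pos[OF x] by (simp add: lift_def)
  qed
qed

lemma absolutely_integrable_bounded_scaleR_mult:
  fixes W g :: "real \<Rightarrow> 'a::{real_normed_field,euclidean_space}" and k :: "real \<Rightarrow> real"
  assumes "W absolutely_integrable_on S" "S \<in> sets lebesgue"
    and "continuous_on S k" "continuous_on S g" "\<And>t. t \<in> S \<Longrightarrow> \<bar>k t\<bar> \<le> C" "\<And>t. t \<in> S \<Longrightarrow> norm (g t) \<le> B"
  shows "(\<lambda>t. k t *\<^sub>R (W t * g t)) absolutely_integrable_on S"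
proof -
  have "norm (k t *\<^sub>R g t) \<le> C * B" if "t \<in> S" for t
    using assms(5,6)[OF that] by (auto intro!: mult_mono intro: order_trans[OF abs_ge_zero])
  then have "bounded ((\<lambda>t. k t *\<^sub>R g t) ` S)"
    unfolding bounded_iff by auto
  then have "(\<lambda>t. (k t *\<^sub>R g t) * W t) absolutely_integrable_on S"
    using assms by (intro absolutely_integrable_continuous_bilinear[of "(*)" S "\<lambda>t. k t *\<^sub>R g t" W]
        bounded_bilinear_mult continuous_intros)
  then show ?thesis
    by (simp add: mult.commute)
qed

text \<open>
  The sets S x are {a..x} or {x..}; the kernel vanishes on the diagonal and is bounded by C, and
  the weight absorbs the norm of the potential, so that no smallness is needed.
\<close>

lemma volterra_equation:
  fixes W g0 :: "real \<Rightarrow> 'a::{real_normed_field,euclidean_space}" and S :: "real \<Rightarrow> real set"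
  assumes S: "\<And>x. x \<ge> a \<Longrightarrow> S x \<subseteq> {a..}" "\<And>x. S x \<in> sets lebesgue"
    and S_cont: "\<And>f :: real \<Rightarrow> 'a. (\<And>x. x \<ge> a \<Longrightarrow> f absolutely_integrable_on S x) \<Longrightarrow>
                   continuous_on {a..} (\<lambda>x. integral (S x) f)"
    and W: "W absolutely_integrable_on {a..}"
    and \<rho>: "continuous_on {a..} \<rho>" "\<And>x. x \<ge> a \<Longrightarrow> 0 \<le> \<rho> x" "\<And>x. x \<ge> a \<Longrightarrow> \<rho> x \<le> C"
    and \<sigma>: "continuous_on {a..} \<sigma>" "\<And>x. x \<ge> a \<Longrightarrow> 0 < \<sigma> x" "\<And>x t. x \<ge> a \<Longrightarrow> t \<in> S x \<Longrightarrow> \<sigma> x \<le> \<sigma> t"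
    and \<omega>: "continuous_on {a..} \<omega>" "\<delta> > 0" "\<And>x. x \<ge> a \<Longrightarrow> \<delta> \<le> \<omega> x" "\<And>x. x \<ge> a \<Longrightarrow> \<omega> x \<le> M"
    and \<omega>_int: "\<And>x. x \<ge> a \<Longrightarrow> 2 * C * integral (S x) (\<lambda>t. norm (W t) * \<omega> t) \<le> \<omega> x"
    and g0: "g0 \<in> Cb a"
  obtains g where "g \<in> Cb a" "\<And>x. x \<ge> a \<Longrightarrow> g x = g0 x +
      (integral (S x) (\<lambda>t. \<rho> t *\<^sub>R (W t * g t)) - \<sigma> x *\<^sub>R integral (S x) (\<lambda>t. (\<rho> t / \<sigma> t) *\<^sub>R (W t * g t)))"
proof -
  \<comment> \<open>The kernel \<rho> t (1 - \<sigma> x / \<sigma> t) is split so that neither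
    integrand depends on x; continuity in x then follows from \<open>S_cont\<close>.\<close>
  define L where "L g x = integral (S x) (\<lambda>t. \<rho> t *\<^sub>R (W t * g t)) -
      \<sigma> x *\<^sub>R integral (S x) (\<lambda>t. (\<rho> t / \<sigma> t) *\<^sub>R (W t * g t))" for g :: "real \<Rightarrow> 'a" and x
  have W_S: "W absolutely_integrable_on S x" if "x \<ge> a" for x
    by (rule set_integrable_subset[OF W S(2) S(1)[OF that]])
  have sub: "continuous_on (S x) f" if "continuous_on {a..} f" "x \<ge> a" for f :: "real \<Rightarrow> 'c::topological_space" and x
    using continuous_on_subset[OF that(1) S(1)[OF that(2)]] .
  have t_ge: "t \<ge> a" if "t \<in> S x" "x \<ge> a" for t x
    using S(1)[OF that(2)] that(1) by auto
  have int_\<rho>: "(\<lambda>t. \<rho> t *\<^sub>R (W t * g t)) absolutely_integrable_on S x"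
    and int_\<rho>\<sigma>: "(\<lambda>t. (\<rho> t / \<sigma> t) *\<^sub>R (W t * g t)) absolutely_integrable_on S x"
    if g: "g \<in> Cb a" and x: "x \<ge> a" for g x
  proof -
    obtain B where B: "\<And>x. x \<ge> a \<Longrightarrow> norm (g x) \<le> B"
      using Cb_bounded[OF g] by blast
    have gc: "continuous_on {a..} g"
      using g by (simp add: Cb_def)
    show "(\<lambda>t. \<rho> t *\<^sub>R (W t * g t)) absolutely_integrable_on S x"
      using t_ge[OF _ x] \<rho>(2,3) B
      by (intro absolutely_integrable_bounded_scaleR_mult[OF W_S[OF x] S(2) sub[OF \<rho>(1) x] sub[OF gc x], where C=C and B=B]) auto
    have bd: "\<bar>\<rho> t / \<sigma> t\<bar> \<le> C / \<sigma> x" if "t \<in> S x" for t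
    proof -
      have "t \<ge> a" by (rule t_ge[OF that x])
      then have "\<bar>\<rho> t / \<sigma> t\<bar> = \<rho> t / \<sigma> t"
        using \<rho>(2)[of t] \<sigma>(2)[of t] by simp
      also have "\<dots> \<le> C / \<sigma> x"
        using \<rho>(2)[of t] \<rho>(3)[of t] \<sigma>(2)[OF x] \<sigma>(3)[OF x that] \<open>t \<ge> a\<close> by (intro frac_le) auto
      finally show ?thesis .
    qed
    have "continuous_on {a..} (\<lambda>t. \<rho> t / \<sigma> t)"
      using \<rho>(1) \<sigma>(1,2) by (intro continuous_intros) (auto simp: less_le)
    then show "(\<lambda>t. (\<rho> t / \<sigma> t) *\<^sub>R (W t * g t)) absolutely_integrable_on S x"
      using bd t_ge[OF _ x] B
      by (intro absolutely_integrable_bounded_scaleR_mult[OF W_S[OF x] S(2) sub[OF _ x] sub[OF gc x], where C="C / \<sigma> x" and B=B]) auto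
  qed
  have Cb_diff: "(\<lambda>t. g t - h t) \<in> Cb a" if "g \<in> Cb a" "h \<in> Cb a" for g h :: "real \<Rightarrow> 'a"
    using that unfolding Cb_def by (auto intro: continuous_intros bounded_minus_comp)
  have L_bound: "norm (L g x) \<le> r / 2 * \<omega> x"
    if g: "g \<in> Cb a" and "r \<ge> 0" and r: "\<And>t. t \<ge> a \<Longrightarrow> norm (g t) \<le> r * \<omega> t" and x: "x \<ge> a" for g r x
  proof -
    have "L g x = integral (S x) (\<lambda>t. \<rho> t *\<^sub>R (W t * g t)) - integral (S x) (\<lambda>t. \<sigma> x *\<^sub>R ((\<rho> t / \<sigma> t) *\<^sub>R (W t * g t)))"
      unfolding L_def by (simp only: integral_cmul)
    also have "\<dots> = integral (S x) (\<lambda>t. \<rho> t *\<^sub>R (W t * g t) - \<sigma> x *\<^sub>R ((\<rho> t / \<sigma> t) *\<^sub>R (W t * g t)))"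
      by (intro Henstock_Kurzweil_Integration.integral_diff[symmetric] integrable_cmul absint_integrable int_\<rho> int_\<rho>\<sigma> g x)
    also have "norm \<dots> \<le> integral (S x) (\<lambda>t. (C * r) * (norm (W t) * \<omega> t))"
    proof (rule integral_norm_bound_integral)
      show "(\<lambda>t. \<rho> t *\<^sub>R (W t * g t) - \<sigma> x *\<^sub>R ((\<rho> t / \<sigma> t) *\<^sub>R (W t * g t))) integrable_on S x"
        by (intro integrable_diff integrable_cmul absint_integrable int_\<rho> int_\<rho>\<sigma> g x)
      have "(\<lambda>t. \<omega> t *\<^sub>R norm (W t)) absolutely_integrable_on S x"
      proof (rule absolutely_integrable_continuous_bilinear[OF bounded_bilinear_scaleR sub[OF \<omega>(1) x] _ S(2)])
        show "(\<lambda>t. norm (W t)) absolutely_integrable_on S x"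
          using absolutely_integrable_norm[OF W_S[OF x]] by (simp add: o_def)
        have "\<bar>\<omega> t\<bar> \<le> M" if "t \<in> S x" for t
          using \<omega>(2) \<omega>(3,4)[OF t_ge[OF that x]] by auto
        then show "bounded (\<omega> ` S x)"
          unfolding bounded_iff by auto
      qed
      from absint_integrable[OF this] show "(\<lambda>t. (C * r) * (norm (W t) * \<omega> t)) integrable_on S x"
        by (intro integrable_on_mult_right) (simp add: mult.commute)
      fix t assume t: "t \<in> S x"
      have ta: "t \<ge> a" by (rule t_ge[OF t x])
      have s: "0 < \<sigma> x" "\<sigma> x \<le> \<sigma> t" "0 < \<sigma> t"
        using \<sigma>(2)[OF x] \<sigma>(3)[OF x t] by auto
      \<comment> \<open>Recombined, the kernel is at most C: monotonicity of \<sigma> along S x puts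
        1 - \<sigma> x / \<sigma> t into [0, 1]. The cancellation at t = x is not exploited
        further.\<close>
      have "\<rho> t *\<^sub>R (W t * g t) - \<sigma> x *\<^sub>R ((\<rho> t / \<sigma> t) *\<^sub>R (W t * g t)) = (\<rho> t * (1 - \<sigma> x / \<sigma> t)) *\<^sub>R (W t * g t)"
        by (simp add: algebra_simps)
      moreover have "\<bar>\<rho> t * (1 - \<sigma> x / \<sigma> t)\<bar> \<le> C * 1"
        unfolding abs_mult using s \<rho>(2,3)[OF ta] by (intro mult_mono) auto
      ultimately have "norm (\<rho> t *\<^sub>R (W t * g t) - \<sigma> x *\<^sub>R ((\<rho> t / \<sigma> t) *\<^sub>R (W t * g t))) \<le> (C * 1) * (norm (W t) * (r * \<omega> t))"
        using r[OF ta] by (auto simp: norm_mult intro!: mult_mono)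
      then show "norm (\<rho> t *\<^sub>R (W t * g t) - \<sigma> x *\<^sub>R ((\<rho> t / \<sigma> t) *\<^sub>R (W t * g t))) \<le> (C * r) * (norm (W t) * \<omega> t)"
        by (simp add: mult_ac)
    qed
    \<comment> \<open>The factor 2 in the condition on the weight becomes the contraction constant 1
      / 2.\<close>
    also have "\<dots> = r / 2 * (2 * C * integral (S x) (\<lambda>t. norm (W t) * \<omega> t))"
      by simp
    also have "\<dots> \<le> r / 2 * \<omega> x"
      using \<omega>_int[OF x] \<open>r \<ge> 0\<close> by (intro mult_left_mono) auto
    finally show ?thesis .
  qed
  have L_diff: "L g x - L h x = L (\<lambda>t. g t - h t) x" if "g \<in> Cb a" "h \<in> Cb a" "x \<ge> a" for g h x
  proof -
    have "integral (S x) (\<lambda>t. \<rho> t *\<^sub>R (W t * (g t - h t))) =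
        integral (S x) (\<lambda>t. \<rho> t *\<^sub>R (W t * g t)) - integral (S x) (\<lambda>t. \<rho> t *\<^sub>R (W t * h t))"
      unfolding right_diff_distrib scaleR_diff_right
      using that by (intro Henstock_Kurzweil_Integration.integral_diff absint_integrable int_\<rho>)
    moreover have "integral (S x) (\<lambda>t. (\<rho> t / \<sigma> t) *\<^sub>R (W t * (g t - h t))) =
        integral (S x) (\<lambda>t. (\<rho> t / \<sigma> t) *\<^sub>R (W t * g t)) - integral (S x) (\<lambda>t. (\<rho> t / \<sigma> t) *\<^sub>R (W t * h t))"
      unfolding right_diff_distrib scaleR_diff_right
      using that by (intro Henstock_Kurzweil_Integration.integral_diff absint_integrable int_\<rho>\<sigma>)
    ultimately show ?thesis
      by (simp add: L_def scaleR_diff_right)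
  qed
  show thesis
  proof (rule weighted_fixed_point[OF \<omega>(1-4) _ _ g0])
    fix g :: "real \<Rightarrow> 'a" assume g: "g \<in> Cb a"
    obtain B where B: "\<And>x. x \<ge> a \<Longrightarrow> norm (g x) \<le> B"
      using Cb_bounded[OF g] by blast
    have "B \<ge> 0"
      using order_trans[OF norm_ge_zero B[OF order_refl]] .
    have "norm (g t) \<le> B / \<delta> * \<omega> t" if "t \<ge> a" for t
    proof -
      have "B * 1 \<le> B * (\<omega> t / \<delta>)"
        using \<omega>(2) \<omega>(3)[OF that] \<open>B \<ge> 0\<close> by (intro mult_left_mono) auto
      with B[OF that] show ?thesis by simp
    qed
    then have bd: "norm (L g x) \<le> B / \<delta> / 2 * M" if "x \<ge> a" for x
      using L_bound[OF g _ _ that, of "B / \<delta>"] \<open>B \<ge> 0\<close> \<omega>(2) mult_left_mono[OF \<omega>(4)[OF that], of "B / \<delta> / 2"] by force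
    have "continuous_on {a..} (L g)"
      unfolding L_def by (intro continuous_intros \<sigma> S_cont int_\<rho> int_\<rho>\<sigma> g)
    with bd show "L g \<in> Cb a"
      unfolding Cb_def bounded_iff by auto
  next
    fix g h :: "real \<Rightarrow> 'a" and r x
    assume *: "g \<in> Cb a" "h \<in> Cb a" "r \<ge> 0" "\<And>t. t \<ge> a \<Longrightarrow> norm (g t - h t) \<le> r * \<omega> t" "x \<ge> a"
    then show "norm (L g x - L h x) \<le> r / 2 * \<omega> x"
      unfolding L_diff[OF *(1,2,5)] by (intro L_bound Cb_diff)
  qed (use that in \<open>auto simp: L_def\<close>)
qed

text \<open>Take \<omega> = exp (m) with m the integral of l |W| from a to x. Then l |W| \<omega> is
  the derivative of \<omega>, so the left-hand side is \<omega> x - \<omega> a. Integrability of W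
  bounds \<omega> from above.\<close>

lemma weight_Icc:
  fixes W :: "real \<Rightarrow> 'a::euclidean_space"
  assumes W: "W absolutely_integrable_on {a..}" and "l > 0"
  obtains \<omega> M where "continuous_on {a..} \<omega>" "\<And>x. x \<ge> a \<Longrightarrow> 1 \<le> \<omega> x" "\<And>x. x \<ge> a \<Longrightarrow> \<omega> x \<le> M"
    "\<And>x. x \<ge> a \<Longrightarrow> l * integral {a..x} (\<lambda>t. norm (W t) * \<omega> t) \<le> \<omega> x"
proof -
  let ?w = "\<lambda>t. l * norm (W t)"
  define m where "m x = 0 + integral {a..x} ?w" for x
  have w: "?w absolutely_integrable_on {a..}"
    using absolutely_integrable_norm[OF W] by (intro set_integrable_mult_right) (simp add: o_def)
  have w': "?w absolutely_integrable_on {a..x}" for x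
    by (rule set_integrable_subset[OF w]) auto
  have ac: "has_ac_derivative a (\<lambda>x. exp (m x)) (\<lambda>x. ?w x * exp (m x))"
    unfolding m_def by (intro ac_exp ac_integral_Icc w')
  show thesis
  proof (rule that)
    show "continuous_on {a..} (\<lambda>x. exp (m x))"
      by (rule ac_continuous[OF ac])
    fix x assume x: "x \<ge> a"
    have "0 \<le> integral {a..x} ?w"
      by (rule integral_nonneg[OF absint_integrable[OF w']]) (use \<open>l > 0\<close> in auto)
    moreover have "integral {a..x} ?w \<le> integral {a..} ?w"
      by (rule integral_subset_le[OF _ absint_integrable[OF w'] absint_integrable[OF w]]) (use \<open>l > 0\<close> in auto)
    ultimately show "1 \<le> exp (m x)" "exp (m x) \<le> exp (integral {a..} ?w)"
      by (auto simp: m_def)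
    have "l * integral {a..x} (\<lambda>t. norm (W t) * exp (m t)) = integral {a..x} (\<lambda>x. ?w x * exp (m x))"
      by (simp add: mult.assoc)
    also have "\<dots> = exp (m x) - exp (m a)"
      by (rule ac_increment[OF ac order_refl x, symmetric])
    also have "\<dots> \<le> exp (m x)" by simp
    finally show "l * integral {a..x} (\<lambda>t. norm (W t) * exp (m t)) \<le> exp (m x)" .
  qed
qed

text \<open>The mirror image, with m the integral of l |W| from x to infinity; the left-hand side is
  then \<omega> x - 1.\<close>

lemma weight_Ici:
  fixes W :: "real \<Rightarrow> 'a::euclidean_space"
  assumes W: "W absolutely_integrable_on {a..}" and "l > 0"
  obtains \<omega> M where "continuous_on {a..} \<omega>" "\<And>x. x \<ge> a \<Longrightarrow> 1 \<le> \<omega> x" "\<And>x. x \<ge> a \<Longrightarrow> \<omega> x \<le> M"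
    "\<And>x. x \<ge> a \<Longrightarrow> l * integral {x..} (\<lambda>t. norm (W t) * \<omega> t) \<le> \<omega> x"
proof -
  let ?w = "\<lambda>t. l * norm (W t)"
  define m where "m x = integral {x..} ?w" for x
  have w: "?w absolutely_integrable_on {a..}"
    using absolutely_integrable_norm[OF W] by (intro set_integrable_mult_right) (simp add: o_def)
  have w': "?w absolutely_integrable_on {x..}" if "x \<ge> a" for x
    by (rule set_integrable_subset[OF w]) (use that in auto)
  have ac: "has_ac_derivative a (\<lambda>x. exp (m x)) (\<lambda>x. - ?w x * exp (m x))"
    unfolding m_def by (intro ac_exp ac_integral_Ici w)
  have m_ge: "m x \<ge> 0" if "x \<ge> a" for x
    unfolding m_def by (rule integral_nonneg[OF absint_integrable[OF w'[OF that]]]) (use \<open>l > 0\<close> in auto)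
  have m_le: "m x \<le> m a" if "x \<ge> a" for x
    unfolding m_def by (rule integral_subset_le[OF _ absint_integrable[OF w'[OF that]] absint_integrable[OF w]]) (use \<open>l > 0\<close> that in auto)
  have cont: "continuous_on {a..} (\<lambda>x. exp (m x))"
    by (rule ac_continuous[OF ac])
  have "(\<lambda>t. exp (m t) *\<^sub>R ?w t) absolutely_integrable_on {a..}"
  proof (rule absolutely_integrable_continuous_bilinear[OF bounded_bilinear_scaleR cont _ _ w])
    have "norm (exp (m x)) \<le> exp (m a)" if "x \<ge> a" for x
      using m_le[OF that] by simp
    then show "bounded ((\<lambda>x. exp (m x)) ` {a..})"
      unfolding bounded_iff by blast
  qed auto
  then have int: "(\<lambda>t. ?w t * exp (m t)) absolutely_integrable_on {a..}"
    by (simp add: mult.commute)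
  have m_lim: "(m \<longlongrightarrow> 0) at_top"
    unfolding m_def by (rule tendsto_integral_Ici[OF w])
  have key: "integral {x..} (\<lambda>t. ?w t * exp (m t)) = exp (m x) - 1" if x: "x \<ge> a" for x
  proof -
    have int_x: "(\<lambda>t. ?w t * exp (m t)) absolutely_integrable_on {x..}"
      by (rule set_integrable_subset[OF int]) (use x in auto)
    \<comment> \<open>The difference does not depend on y, and its limit at infinity, 0 - exp 0,
      determines it.\<close>
    have "integral {y..} (\<lambda>t. ?w t * exp (m t)) - exp (m y) = integral {x..} (\<lambda>t. ?w t * exp (m t)) - exp (m x)" if "y \<ge> x" for y
    proof -
      have "exp (m y) - exp (m x) = integral {x..y} (\<lambda>t. - ?w t * exp (m t))"
        by (rule ac_increment[OF ac x that])
      also have "\<dots> = - integral {x..y} (\<lambda>t. ?w t * exp (m t))"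
        by simp
      finally show ?thesis
        using integral_Ici_split[OF int_x that] by simp
    qed
    then have "eventually (\<lambda>y. integral {y..} (\<lambda>t. ?w t * exp (m t)) - exp (m y) =
        integral {x..} (\<lambda>t. ?w t * exp (m t)) - exp (m x)) at_top"
      by (intro eventually_mono[OF eventually_ge_at_top[of x]])
    moreover have "((\<lambda>y. integral {y..} (\<lambda>t. ?w t * exp (m t)) - exp (m y)) \<longlongrightarrow> 0 - exp 0) at_top"
      by (intro tendsto_intros tendsto_integral_Ici[OF int] m_lim)
    ultimately have "((\<lambda>y::real. integral {x..} (\<lambda>t. ?w t * exp (m t)) - exp (m x)) \<longlongrightarrow> 0 - exp 0) at_top"
      using tendsto_cong by fast
    then show ?thesis
      by (simp add: tendsto_const_iff)
  qed
  show thesis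
  proof (rule that[OF cont])
    fix x assume x: "x \<ge> a"
    show "1 \<le> exp (m x)" "exp (m x) \<le> exp (m a)"
      using m_ge[OF x] m_le[OF x] by auto
    have "l * integral {x..} (\<lambda>t. norm (W t) * exp (m t)) = integral {x..} (\<lambda>x. ?w x * exp (m x))"
      by (simp add: mult.assoc)
    with key[OF x] show "l * integral {x..} (\<lambda>t. norm (W t) * exp (m t)) \<le> exp (m x)"
      by simp
  qed
qed

section \<open>Perturbation of a pair of solutions\<close>

text \<open>Collects what the perturbation argument uses of psi and phi. Besides the equation, signs
  and Wronskian, only the limits of the logarithmic derivatives enter.\<close>

locale log_deriv_pair =
  fixes a \<mu> :: real and Q \<psi> \<psi>' \<phi> \<phi>' :: "real \<Rightarrow> real"
  assumes a_pos: "a > 0" and mu_pos: "\<mu> > 0" and Q_cont: "continuous_on {a..} Q"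
    and \<psi>_deriv: "\<And>x. x \<ge> a \<Longrightarrow> (\<psi> has_real_derivative \<psi>' x) (at x)"
      "\<And>x. x \<ge> a \<Longrightarrow> ((\<lambda>x. x\<^sup>2 * \<psi>' x) has_real_derivative Q x * \<psi> x) (at x)"
    and \<phi>_deriv: "\<And>x. x \<ge> a \<Longrightarrow> (\<phi> has_real_derivative \<phi>' x) (at x)"
      "\<And>x. x \<ge> a \<Longrightarrow> ((\<lambda>x. x\<^sup>2 * \<phi>' x) has_real_derivative Q x * \<phi> x) (at x)"
    and \<psi>_pos: "\<And>x. x \<ge> a \<Longrightarrow> \<psi> x > 0" and \<phi>_pos: "\<And>x. x \<ge> a \<Longrightarrow> \<phi> x > 0"
    and \<psi>'_neg: "\<And>x. x \<ge> a \<Longrightarrow> \<psi>' x < 0"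
    and wronskian: "\<And>x. x \<ge> a \<Longrightarrow> x\<^sup>2 * (\<psi> x * \<phi>' x - \<psi>' x * \<phi> x) = 1"
    and \<psi>_log_deriv: "((\<lambda>x. \<psi>' x / \<psi> x) \<longlongrightarrow> - \<mu>) at_top"
    and \<phi>_log_deriv: "((\<lambda>x. \<phi>' x / \<phi> x) \<longlongrightarrow> \<mu>) at_top"
begin

lemma cont: "continuous_on {a..} \<psi>" "continuous_on {a..} \<phi>" "continuous_on {a..} \<psi>'" "continuous_on {a..} \<phi>'"
proof -
  have *: "continuous_on {a..} f" if "\<And>x. x \<ge> a \<Longrightarrow> (f has_real_derivative f' x) (at x)" for f f'
    by (rule DERIV_continuous_on[OF has_field_derivative_at_within[OF that]]) simp
  show "continuous_on {a..} \<psi>"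
    by (rule *[OF \<psi>_deriv(1)])
  show "continuous_on {a..} \<phi>"
    by (rule *[OF \<phi>_deriv(1)])
  have **: "continuous_on {a..} f'" if "continuous_on {a..} (\<lambda>x. x\<^sup>2 * f' x)" for f' :: "real \<Rightarrow> real"
  proof (rule continuous_on_eq)
    show "continuous_on {a..} (\<lambda>x. (x\<^sup>2 * f' x) / x\<^sup>2)"
      using a_pos by (intro continuous_on_divide that continuous_intros) auto
  qed (use a_pos in auto)
  show "continuous_on {a..} \<psi>'"
    by (rule **[OF *[OF \<psi>_deriv(2)]])
  show "continuous_on {a..} \<phi>'"
    by (rule **[OF *[OF \<phi>_deriv(2)]])
qed

lemma ac: "has_ac_derivative a \<psi> \<psi>'" "has_ac_derivative a \<phi> \<phi>'"
    "has_ac_derivative a (\<lambda>x. x\<^sup>2 * \<psi>' x) (\<lambda>x. Q x * \<psi> x)"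
    "has_ac_derivative a (\<lambda>x. x\<^sup>2 * \<phi>' x) (\<lambda>x. Q x * \<phi> x)"
proof -
  show "has_ac_derivative a \<psi> \<psi>'"
    by (rule ac_of_real_derivative[OF \<psi>_deriv(1) cont(3)])
  show "has_ac_derivative a \<phi> \<phi>'"
    by (rule ac_of_real_derivative[OF \<phi>_deriv(1) cont(4)])
  show "has_ac_derivative a (\<lambda>x. x\<^sup>2 * \<psi>' x) (\<lambda>x. Q x * \<psi> x)"
    by (rule ac_of_real_derivative[OF \<psi>_deriv(2) continuous_on_mult[OF Q_cont cont(1)]])
  show "has_ac_derivative a (\<lambda>x. x\<^sup>2 * \<phi>' x) (\<lambda>x. Q x * \<phi> x)"
    by (rule ac_of_real_derivative[OF \<phi>_deriv(2) continuous_on_mult[OF Q_cont cont(2)]])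
qed

text \<open>The Green's function on the diagonal, times x^2. By the Wronskian it equals the
  reciprocal of \<phi>' / \<phi> - \<psi>' / \<psi>.\<close>

definition \<rho> :: "real \<Rightarrow> real" where "\<rho> x = x\<^sup>2 * (\<psi> x * \<phi> x)"

lemma \<rho>_pos: "x \<ge> a \<Longrightarrow> \<rho> x > 0"
  using a_pos \<psi>_pos[of x] \<phi>_pos[of x] by (simp add: \<rho>_def)

lemma \<rho>_cont: "continuous_on {a..} \<rho>"
  unfolding \<rho>_def by (intro continuous_intros cont)

text \<open>Dividing the Wronskian identity by \<rho> gives 1 / \<rho> = \<phi>' / \<phi> - \<psi>'
  / \<psi>, which tends to 2 \<mu>. So \<rho> is continuous with a finite limit.\<close>

lemma \<rho>_bound:
  obtains C where "C > 0" "\<And>x. x \<ge> a \<Longrightarrow> \<rho> x \<le> C"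
proof -
  have "((\<lambda>x. 1 / (\<phi>' x / \<phi> x - \<psi>' x / \<psi> x)) \<longlongrightarrow> 1 / (\<mu> - - \<mu>)) at_top"
    using mu_pos by (intro tendsto_intros \<psi>_log_deriv \<phi>_log_deriv) auto
  moreover have "1 / (\<phi>' x / \<phi> x - \<psi>' x / \<psi> x) = \<rho> x" if "x \<ge> a" for x
  proof -
    have "\<rho> x * (\<phi>' x / \<phi> x - \<psi>' x / \<psi> x) = x\<^sup>2 * (\<psi> x * \<phi>' x - \<psi>' x * \<phi> x)"
      using \<psi>_pos[OF that] \<phi>_pos[OF that] by (simp add: \<rho>_def field_simps)
    then have "\<rho> x * (\<phi>' x / \<phi> x - \<psi>' x / \<psi> x) = 1"
      using wronskian[OF that] by simp
    then show ?thesis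
      by (metis nonzero_eq_divide_eq mult_zero_right zero_neq_one)
  qed
  then have "eventually (\<lambda>x. 1 / (\<phi>' x / \<phi> x - \<psi>' x / \<psi> x) = \<rho> x) at_top"
    by (intro eventually_mono[OF eventually_ge_at_top[of a]])
  ultimately have "(\<rho> \<longlongrightarrow> 1 / (\<mu> - - \<mu>)) at_top"
    by (rule Lim_transform_eventually)
  from Cb_tendsto[OF \<rho>_cont this] obtain B where B: "\<And>x. x \<ge> a \<Longrightarrow> norm (\<rho> x) \<le> B"
    using Cb_bounded by blast
  show thesis
  proof (rule that)
    show "\<rho> x \<le> B" if "x \<ge> a" for x
      using B[OF that] by simp
    show "B > 0"
      using B[OF order_refl] \<rho>_pos[OF order_refl] by simp
  qed
qed

lemma ratio_deriv:
  assumes "x \<ge> a"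
  shows "((\<lambda>x. \<phi> x / \<psi> x) has_real_derivative 1 / (x\<^sup>2 * (\<psi> x)\<^sup>2)) (at x)"
proof -
  have "x > 0" using a_pos assms by linarith
  have "((\<lambda>x. \<phi> x / \<psi> x) has_real_derivative (\<phi>' x * \<psi> x - \<phi> x * \<psi>' x) / (\<psi> x * \<psi> x)) (at x)"
    using \<psi>_pos[OF assms] by (intro DERIV_divide \<psi>_deriv \<phi>_deriv assms) auto
  also have "\<phi>' x * \<psi> x - \<phi> x * \<psi>' x = 1 / x\<^sup>2"
    using wronskian[OF assms] \<open>x > 0\<close> by (simp add: field_simps)
  finally show ?thesis by (simp add: power2_eq_square)
qed

lemma ratio_mono:
  assumes "a \<le> x" "x \<le> y"
  shows "\<phi> x / \<psi> x \<le> \<phi> y / \<psi> y"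
proof (rule DERIV_nonneg_imp_nondecreasing[OF assms(2)])
  fix t assume "x \<le> t"
  with assms have "t \<ge> a" by simp
  from ratio_deriv[OF this]
  show "\<exists>d. ((\<lambda>x. \<phi> x / \<psi> x) has_real_derivative d) (at t) \<and> 0 \<le> d"
    by (intro exI conjI) auto
qed

lemma ratio_mono':
  assumes "a \<le> x" "x \<le> y"
  shows "\<psi> y / \<phi> y \<le> \<psi> x / \<phi> x"
  using ratio_mono[OF assms] \<psi>_pos[of x] \<psi>_pos[of y] \<phi>_pos[of x] \<phi>_pos[of y] assms
  by (simp add: field_simps)

text \<open>The derivative of \<phi> / \<psi> is (\<phi> / \<psi>) / \<rho>. Its numerator is
  increasing and \<rho> \<le> C, so the derivative stays above the positive constant k.\<close>

lemma ratio_at_top: "filterlim (\<lambda>x. \<phi> x / \<psi> x) at_top at_top"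
proof -
  obtain C where C: "C > 0" "\<And>x. x \<ge> a \<Longrightarrow> \<rho> x \<le> C"
    using \<rho>_bound by blast
  define k where "k = \<phi> a / \<psi> a / C"
  have k: "k > 0"
    using C \<psi>_pos[of a] \<phi>_pos[of a] by (simp add: k_def)
  have growth: "k * (x - a) \<le> \<phi> x / \<psi> x" if x: "x \<ge> a" for x
  proof -
    have "\<phi> a / \<psi> a - k * (a - a) \<le> \<phi> x / \<psi> x - k * (x - a)"
    proof (rule DERIV_nonneg_imp_nondecreasing[OF x])
      fix t assume t: "a \<le> t"
      then have "t > 0" using a_pos by linarith
      have "k \<le> \<phi> t / \<psi> t / \<rho> t"
        unfolding k_def using ratio_mono[OF order_refl t] C(2)[OF t] \<rho>_pos[OF t] \<phi>_pos[OF t] \<psi>_pos[OF t]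
        by (intro frac_le[of "\<phi> t / \<psi> t"]) auto
      also have "\<dots> = 1 / (t\<^sup>2 * (\<psi> t)\<^sup>2)"
        using \<psi>_pos[OF t] \<phi>_pos[OF t] \<open>t > 0\<close> by (simp add: \<rho>_def field_simps power2_eq_square)
      finally have "0 \<le> 1 / (t\<^sup>2 * (\<psi> t)\<^sup>2) - k * (1 - 0)" by simp
      moreover have "((\<lambda>x. \<phi> x / \<psi> x - k * (x - a)) has_real_derivative 1 / (t\<^sup>2 * (\<psi> t)\<^sup>2) - k * (1 - 0)) (at t)"
        by (intro DERIV_diff ratio_deriv t DERIV_cmult DERIV_ident DERIV_const)
      ultimately show "\<exists>d. ((\<lambda>x. \<phi> x / \<psi> x - k * (x - a)) has_real_derivative d) (at t) \<and> 0 \<le> d"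
        by blast
    qed
    then have "\<phi> a / \<psi> a \<le> \<phi> x / \<psi> x - k * (x - a)" by simp
    moreover have "\<phi> a / \<psi> a > 0"
      using \<psi>_pos[of a] \<phi>_pos[of a] by simp
    ultimately show ?thesis by linarith
  qed
  have "filterlim (\<lambda>x. k * (- a + x)) at_top at_top"
    using k by (intro filterlim_tendsto_pos_mult_at_top[OF tendsto_const]
        filterlim_tendsto_add_at_top[OF tendsto_const] filterlim_ident)
  then show ?thesis
    by (rule filterlim_at_top_mono) (use growth in \<open>auto intro!: eventually_mono[OF eventually_ge_at_top[of a]]\<close>)
qed

text \<open>The derivatives of A and B are chosen so that \<psi> A' + \<phi> B' = 0. Hence h'
  contains no A' or B', and in the derivative of x^2 h' they combine to the Wronskian times x^2 W
  h.\<close>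

lemma variation_of_parameters:
  fixes A B h W :: "real \<Rightarrow> 'a::{real_normed_field,euclidean_space}"
  assumes A: "has_ac_derivative a A (\<lambda>x. - (\<phi> x *\<^sub>R (x\<^sup>2 *\<^sub>R (W x * h x))))"
    and B: "has_ac_derivative a B (\<lambda>x. \<psi> x *\<^sub>R (x\<^sup>2 *\<^sub>R (W x * h x)))"
    and h: "\<And>x. x \<ge> a \<Longrightarrow> h x = \<psi> x *\<^sub>R A x + \<phi> x *\<^sub>R B x"
  shows "solves a (\<lambda>x. of_real (Q x) + x\<^sup>2 *\<^sub>R W x) h (\<lambda>x. \<psi>' x *\<^sub>R A x + \<phi>' x *\<^sub>R B x)"
proof -
  let ?N = "\<lambda>x. x\<^sup>2 *\<^sub>R (W x * h x)"
  let ?h' = "\<lambda>x. \<psi>' x *\<^sub>R A x + \<phi>' x *\<^sub>R B x"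
  have "has_ac_derivative a (\<lambda>x. \<psi> x *\<^sub>R A x + \<phi> x *\<^sub>R B x)
     (\<lambda>x. (\<psi>' x *\<^sub>R A x + \<psi> x *\<^sub>R (- (\<phi> x *\<^sub>R ?N x))) + (\<phi>' x *\<^sub>R B x + \<phi> x *\<^sub>R (\<psi> x *\<^sub>R ?N x)))"
    by (intro ac_add ac_prod[OF bounded_bilinear_scaleR] ac A B)
  then have h_ac: "has_ac_derivative a h ?h'"
    by (rule ac_cong) (simp_all add: h mult.commute)
  have "continuous_on {a..} ?h'"
    by (intro continuous_intros cont ac_continuous[OF A] ac_continuous[OF B])
  then have deriv: "(h has_vector_derivative ?h' x) (at x within {a..})" if "x \<ge> a" for x
    by (rule ac_vector_derivative[OF h_ac _ that])
  have "has_ac_derivative a (\<lambda>x. (x\<^sup>2 * \<psi>' x) *\<^sub>R A x + (x\<^sup>2 * \<phi>' x) *\<^sub>R B x)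
     (\<lambda>x. ((Q x * \<psi> x) *\<^sub>R A x + (x\<^sup>2 * \<psi>' x) *\<^sub>R (- (\<phi> x *\<^sub>R ?N x))) +
          ((Q x * \<phi> x) *\<^sub>R B x + (x\<^sup>2 * \<phi>' x) *\<^sub>R (\<psi> x *\<^sub>R ?N x)))"
    by (intro ac_add ac_prod[OF bounded_bilinear_scaleR] ac A B)
  then have "has_ac_derivative a (\<lambda>x. x\<^sup>2 *\<^sub>R ?h' x) (\<lambda>x. (of_real (Q x) + x\<^sup>2 *\<^sub>R W x) * h x)"
  proof (rule ac_cong)
    fix x assume x: "x \<ge> a"
    have "((Q x * \<psi> x) *\<^sub>R A x + (x\<^sup>2 * \<psi>' x) *\<^sub>R (- (\<phi> x *\<^sub>R ?N x))) +
          ((Q x * \<phi> x) *\<^sub>R B x + (x\<^sup>2 * \<phi>' x) *\<^sub>R (\<psi> x *\<^sub>R ?N x)) =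
        Q x *\<^sub>R (\<psi> x *\<^sub>R A x + \<phi> x *\<^sub>R B x) + (x\<^sup>2 * (\<psi> x * \<phi>' x - \<psi>' x * \<phi> x)) *\<^sub>R ?N x"
      by (simp add: algebra_simps)
    also have "\<dots> = Q x *\<^sub>R h x + ?N x"
      using h[OF x] wronskian[OF x] by simp
    also have "\<dots> = (of_real (Q x) + x\<^sup>2 *\<^sub>R W x) * h x"
      by (simp add: distrib_right scaleR_conv_of_real)
    finally show "((Q x * \<psi> x) *\<^sub>R A x + (x\<^sup>2 * \<psi>' x) *\<^sub>R (- (\<phi> x *\<^sub>R ?N x))) +
          ((Q x * \<phi> x) *\<^sub>R B x + (x\<^sup>2 * \<phi>' x) *\<^sub>R (\<psi> x *\<^sub>R ?N x)) = (of_real (Q x) + x\<^sup>2 *\<^sub>R W x) * h x" .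
  qed (simp add: scaleR_add_right)
  with deriv show ?thesis
    unfolding solves_def by blast
qed

text \<open>The ansatz h = \<phi> g with integration from a: the integrals vanish at a, so \<alpha>
  and \<beta> are the coefficients of \<psi> and \<phi> there.\<close>

lemma initial_value_solution:
  fixes W :: "real \<Rightarrow> 'a::{real_normed_field,euclidean_space}"
  assumes W: "W absolutely_integrable_on {a..}"
  obtains h h' where "solves a (\<lambda>x. of_real (Q x) + x\<^sup>2 *\<^sub>R W x) h h'"
    "h a = \<psi> a *\<^sub>R \<alpha> + \<phi> a *\<^sub>R \<beta>" "h' a = \<psi>' a *\<^sub>R \<alpha> + \<phi>' a *\<^sub>R \<beta>"
proof -
  obtain C where C: "C > 0" "\<And>x. x \<ge> a \<Longrightarrow> \<rho> x \<le> C"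
    using \<rho>_bound by blast
  obtain \<omega> M where \<omega>: "continuous_on {a..} \<omega>" "\<And>x. x \<ge> a \<Longrightarrow> 1 \<le> \<omega> x" "\<And>x. x \<ge> a \<Longrightarrow> \<omega> x \<le> M"
    "\<And>x. x \<ge> a \<Longrightarrow> 2 * C * integral {a..x} (\<lambda>t. norm (W t) * \<omega> t) \<le> \<omega> x"
    using weight_Icc[OF W, of "2 * C"] C(1) by auto
  \<comment> \<open>The integrals run over t \<le> x, so the Volterra lemma asks for a decreasing
    \<sigma>.\<close>
  define \<sigma> where "\<sigma> x = \<psi> x / \<phi> x" for x
  have \<sigma>_cont: "continuous_on {a..} \<sigma>"
    unfolding \<sigma>_def using \<phi>_pos by (intro continuous_intros cont) (auto simp: less_le)
  have \<sigma>_pos: "0 < \<sigma> x" if "x \<ge> a" for x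
    using \<psi>_pos[OF that] \<phi>_pos[OF that] by (simp add: \<sigma>_def)
  have \<sigma>_mono: "\<sigma> x \<le> \<sigma> t" if "x \<ge> a" "t \<in> {a..x}" for x t
    unfolding \<sigma>_def using that by (intro ratio_mono') auto
  let ?g0 = "\<lambda>x. \<sigma> x *\<^sub>R \<alpha> + \<beta>"
  have "norm (?g0 x) \<le> \<sigma> a * norm \<alpha> + norm \<beta>" if "x \<ge> a" for x
    using \<sigma>_pos[OF that] \<sigma>_mono[OF that, of a] that
    by (intro norm_triangle_le add_mono) (auto intro!: mult_right_mono)
  then have g0: "?g0 \<in> Cb a"
    unfolding Cb_def bounded_iff by (auto intro!: continuous_intros \<sigma>_cont)
  obtain g where g: "g \<in> Cb a" and g_eq: "\<And>x. x \<ge> a \<Longrightarrow> g x = ?g0 x +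
      (integral {a..x} (\<lambda>t. \<rho> t *\<^sub>R (W t * g t)) - \<sigma> x *\<^sub>R integral {a..x} (\<lambda>t. (\<rho> t / \<sigma> t) *\<^sub>R (W t * g t)))"
  proof (rule volterra_equation[OF _ _ _ W \<rho>_cont _ C(2) \<sigma>_cont \<sigma>_pos \<sigma>_mono \<omega>(1) zero_less_one \<omega>(2,3,4) g0])
    show "continuous_on {a..} (\<lambda>x. integral {a..x} f)" if "\<And>x. x \<ge> a \<Longrightarrow> f absolutely_integrable_on {a..x}" for f :: "real \<Rightarrow> 'a"
      using ac_continuous[OF ac_integral_Icc[OF that, of 0]] by simp
  qed (use \<rho>_pos in \<open>auto simp: less_imp_le\<close>)
  have gc: "continuous_on {a..} g"
    using g by (simp add: Cb_def)
  have int: "(\<lambda>t. k t *\<^sub>R (W t * g t)) absolutely_integrable_on {a..x}" if "continuous_on {a..} k" for x and k :: "real \<Rightarrow> real"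
  proof -
    have "(\<lambda>t. (k t *\<^sub>R g t) * W t) absolutely_integrable_on {a..x}"
      using that gc
      by (intro absolutely_integrable_continuous_bilinear_Icc[OF bounded_bilinear_mult] continuous_intros set_integrable_subset[OF W])
         (auto elim: continuous_on_subset)
    then show ?thesis by (simp add: mult.commute)
  qed
  define h where "h x = \<phi> x *\<^sub>R g x" for x
  \<comment> \<open>The Volterra equation reads g = \<sigma> A + B, which after multiplication by
    \<phi> is h = \<psi> A + \<phi> B.\<close>
  define A where "A x = \<alpha> + - integral {a..x} (\<lambda>t. (\<rho> t / \<sigma> t) *\<^sub>R (W t * g t))" for x
  define B where "B x = \<beta> + integral {a..x} (\<lambda>t. \<rho> t *\<^sub>R (W t * g t))" for x
  have "continuous_on {a..} (\<lambda>t. \<rho> t / \<sigma> t)"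
    using \<sigma>_pos by (intro continuous_intros \<rho>_cont \<sigma>_cont) (auto simp: less_le)
  note ints = int[OF this] int[OF \<rho>_cont]
  have "has_ac_derivative a (\<lambda>x. - (- \<alpha> + integral {a..x} (\<lambda>t. (\<rho> t / \<sigma> t) *\<^sub>R (W t * g t)))) (\<lambda>x. - ((\<rho> x / \<sigma> x) *\<^sub>R (W x * g x)))"
    by (intro ac_linear[OF bounded_linear_minus[OF bounded_linear_ident]] ac_integral_Icc ints)
  then have A: "has_ac_derivative a A (\<lambda>x. - (\<phi> x *\<^sub>R (x\<^sup>2 *\<^sub>R (W x * h x))))"
  proof (rule ac_cong)
    fix x assume x: "x \<ge> a"
    have "\<rho> x / \<sigma> x = \<phi> x * x\<^sup>2 * \<phi> x"
      using \<psi>_pos[OF x] \<phi>_pos[OF x] by (simp add: \<rho>_def \<sigma>_def)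
    then show "- ((\<rho> x / \<sigma> x) *\<^sub>R (W x * g x)) = - (\<phi> x *\<^sub>R (x\<^sup>2 *\<^sub>R (W x * h x)))"
      by (simp add: h_def mult.assoc)
  qed (simp add: A_def)
  have "has_ac_derivative a (\<lambda>x. \<beta> + integral {a..x} (\<lambda>t. \<rho> t *\<^sub>R (W t * g t))) (\<lambda>x. \<rho> x *\<^sub>R (W x * g x))"
    by (intro ac_integral_Icc ints)
  then have B: "has_ac_derivative a B (\<lambda>x. \<psi> x *\<^sub>R (x\<^sup>2 *\<^sub>R (W x * h x)))"
    by (rule ac_cong) (simp_all add: B_def \<rho>_def h_def mult_ac)
  have h: "h x = \<psi> x *\<^sub>R A x + \<phi> x *\<^sub>R B x" if "x \<ge> a" for x
  proof -
    have "\<psi> x = \<phi> x * \<sigma> x"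
      using \<phi>_pos[OF that] by (simp add: \<sigma>_def)
    then show ?thesis
      unfolding h_def by (subst g_eq[OF that]) (simp add: A_def B_def algebra_simps)
  qed
  show thesis
  proof (rule that)
    show "solves a (\<lambda>x. of_real (Q x) + x\<^sup>2 *\<^sub>R W x) h (\<lambda>x. \<psi>' x *\<^sub>R A x + \<phi>' x *\<^sub>R B x)"
      by (rule variation_of_parameters[OF A B h])
    show "h a = \<psi> a *\<^sub>R \<alpha> + \<phi> a *\<^sub>R \<beta>" "\<psi>' a *\<^sub>R A a + \<phi>' a *\<^sub>R B a = \<psi>' a *\<^sub>R \<alpha> + \<phi>' a *\<^sub>R \<beta>"
      by (simp_all add: h A_def B_def)
  qed
qed

text \<open>The ansatz h = \<psi> g with integration from infinity gives g = A + \<sigma> B for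
  \<sigma> = \<phi> / \<psi>, where A tends to 1 and \<sigma> B to 0. The derivative factor is A +
  (\<phi>' / \<psi>') B, and \<phi>' / \<psi>' is \<sigma> times a convergent quotient of
  logarithmic derivatives.\<close>

lemma decaying_solution:
  fixes W :: "real \<Rightarrow> 'a::{real_normed_field,euclidean_space}"
  assumes W: "W absolutely_integrable_on {a..}"
  obtains h h' g gt where "solves a (\<lambda>x. of_real (Q x) + x\<^sup>2 *\<^sub>R W x) h h'"
    "\<And>x. x \<ge> a \<Longrightarrow> h x = \<psi> x *\<^sub>R g x" "g \<in> Cb a" "(g \<longlongrightarrow> 1) at_top"
    "\<And>x. x \<ge> a \<Longrightarrow> h' x = \<psi>' x *\<^sub>R gt x" "gt \<in> Cb a" "(gt \<longlongrightarrow> 1) at_top"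
proof -
  obtain C where C: "C > 0" "\<And>x. x \<ge> a \<Longrightarrow> \<rho> x \<le> C"
    using \<rho>_bound by blast
  obtain \<omega> M where \<omega>: "continuous_on {a..} \<omega>" "\<And>x. x \<ge> a \<Longrightarrow> 1 \<le> \<omega> x" "\<And>x. x \<ge> a \<Longrightarrow> \<omega> x \<le> M"
    "\<And>x. x \<ge> a \<Longrightarrow> 2 * C * integral {x..} (\<lambda>t. norm (W t) * \<omega> t) \<le> \<omega> x"
    using weight_Ici[OF W, of "2 * C"] C(1) by auto
  define \<sigma> where "\<sigma> x = \<phi> x / \<psi> x" for x
  have \<sigma>_cont: "continuous_on {a..} \<sigma>"
    unfolding \<sigma>_def using \<psi>_pos by (intro continuous_intros cont) (auto simp: less_le)
  have \<sigma>_pos: "0 < \<sigma> x" if "x \<ge> a" for x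
    using \<psi>_pos[OF that] \<phi>_pos[OF that] by (simp add: \<sigma>_def)
  have \<sigma>_mono: "\<sigma> x \<le> \<sigma> t" if "x \<ge> a" "t \<in> {x..}" for x t
    unfolding \<sigma>_def using that by (intro ratio_mono) auto
  have g0: "(\<lambda>_. 1 :: 'a) \<in> Cb a"
    by (rule Cb_tendsto[OF continuous_on_const tendsto_const])
  obtain g where g: "g \<in> Cb a" and g_eq: "\<And>x. x \<ge> a \<Longrightarrow> g x = 1 +
      (integral {x..} (\<lambda>t. \<rho> t *\<^sub>R (W t * g t)) - \<sigma> x *\<^sub>R integral {x..} (\<lambda>t. (\<rho> t / \<sigma> t) *\<^sub>R (W t * g t)))"
  proof (rule volterra_equation[OF _ _ _ W \<rho>_cont _ C(2) \<sigma>_cont \<sigma>_pos \<sigma>_mono \<omega>(1) zero_less_one \<omega>(2,3,4) g0])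
    show "continuous_on {a..} (\<lambda>x. integral {x..} f)" if "\<And>x. x \<ge> a \<Longrightarrow> f absolutely_integrable_on {x..}" for f :: "real \<Rightarrow> 'a"
      using ac_continuous[OF ac_integral_Ici[OF that[OF order_refl]]] by simp
  qed (use \<rho>_pos in \<open>auto simp: less_imp_le\<close>)
  have gc: "continuous_on {a..} g"
    using g by (simp add: Cb_def)
  obtain b where b: "\<And>x. x \<ge> a \<Longrightarrow> norm (g x) \<le> b"
    using Cb_bounded[OF g] by blast
  have ratio_cont: "continuous_on {a..} (\<lambda>t. \<rho> t / \<sigma> t)"
    using \<sigma>_pos by (intro continuous_intros \<rho>_cont \<sigma>_cont) (auto simp: less_le)
  \<comment> \<open>As \<sigma> increases, 1 / \<sigma> t \<le> 1 / \<sigma> x for t \<ge> x. This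
    compensates the growing factor \<sigma> x in front of B.\<close>
  have ratio_le: "\<rho> t / \<sigma> t \<le> C / \<sigma> x" "0 \<le> \<rho> t / \<sigma> t" if "x \<ge> a" "t \<ge> x" for x t
    using \<rho>_pos[of t] C(2)[of t] \<sigma>_pos[of x] \<sigma>_pos[of t] \<sigma>_mono[of x t] that by (auto intro!: frac_le)
  have int1: "(\<lambda>t. \<rho> t *\<^sub>R (W t * g t)) absolutely_integrable_on {a..}"
    using \<rho>_pos C(2) b
    by (intro absolutely_integrable_bounded_scaleR_mult[OF W _ \<rho>_cont gc, where C=C and B=b]) (auto simp: abs_of_pos)
  have int2: "(\<lambda>t. (\<rho> t / \<sigma> t) *\<^sub>R (W t * g t)) absolutely_integrable_on {a..}"
  proof (rule absolutely_integrable_bounded_scaleR_mult[OF W _ ratio_cont gc, where C="C / \<sigma> a" and B=b])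
    show "\<bar>\<rho> t / \<sigma> t\<bar> \<le> C / \<sigma> a" if "t \<in> {a..}" for t
      using ratio_le[OF order_refl, of t] that by (simp only: abs_of_nonneg atLeast_iff)
  qed (use b in auto)
  define h where "h x = \<psi> x *\<^sub>R g x" for x
  define A where "A x = 1 + integral {x..} (\<lambda>t. \<rho> t *\<^sub>R (W t * g t))" for x
  define B where "B x = - integral {x..} (\<lambda>t. (\<rho> t / \<sigma> t) *\<^sub>R (W t * g t))" for x
  have "has_ac_derivative a (\<lambda>x. 1) (\<lambda>x. 0 :: 'a)"
    using ac_integral_Icc[of a "\<lambda>_. 0" 1] by simp
  from ac_add[OF this ac_integral_Ici[OF int1]]
  have A: "has_ac_derivative a A (\<lambda>x. - (\<phi> x *\<^sub>R (x\<^sup>2 *\<^sub>R (W x * h x))))"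
    by (rule ac_cong) (simp_all add: A_def \<rho>_def h_def mult_ac)
  have "has_ac_derivative a B (\<lambda>x. - (- ((\<rho> x / \<sigma> x) *\<^sub>R (W x * g x))))"
    unfolding B_def by (intro ac_linear[OF bounded_linear_minus[OF bounded_linear_ident]] ac_integral_Ici int2)
  then have B: "has_ac_derivative a B (\<lambda>x. \<psi> x *\<^sub>R (x\<^sup>2 *\<^sub>R (W x * h x)))"
  proof (rule ac_cong)
    fix x assume x: "x \<ge> a"
    have "\<rho> x / \<sigma> x = \<psi> x * x\<^sup>2 * \<psi> x"
      using \<psi>_pos[OF x] \<phi>_pos[OF x] by (simp add: \<rho>_def \<sigma>_def)
    then show "- (- ((\<rho> x / \<sigma> x) *\<^sub>R (W x * g x))) = \<psi> x *\<^sub>R (x\<^sup>2 *\<^sub>R (W x * h x))"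
      by (simp add: h_def mult.assoc)
  qed simp
  have g_AB: "g x = A x + \<sigma> x *\<^sub>R B x" if "x \<ge> a" for x
    by (subst g_eq[OF that]) (simp add: A_def B_def)
  have h: "h x = \<psi> x *\<^sub>R A x + \<phi> x *\<^sub>R B x" if "x \<ge> a" for x
    using g_AB[OF that] \<psi>_pos[OF that] by (simp add: h_def \<sigma>_def scaleR_add_right)
  let ?h' = "\<lambda>x. \<psi>' x *\<^sub>R A x + \<phi>' x *\<^sub>R B x"
  have solves: "solves a (\<lambda>x. of_real (Q x) + x\<^sup>2 *\<^sub>R W x) h ?h'"
    by (rule variation_of_parameters[OF A B h])
  have "((\<lambda>x. 1 + integral {x..} (\<lambda>t. \<rho> t *\<^sub>R (W t * g t))) \<longlongrightarrow> 1 + 0) at_top"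
    by (intro tendsto_intros tendsto_integral_Ici[OF int1])
  then have A_lim: "(A \<longlongrightarrow> 1) at_top"
    by (simp add: A_def[abs_def])
  have normW: "(\<lambda>t. norm (W t)) absolutely_integrable_on {a..}"
    using absolutely_integrable_norm[OF W] by (simp add: o_def)
  \<comment> \<open>The bound \<open>ratio_le\<close> cancels \<sigma> x and leaves the tail of the
    integral of |W|.\<close>
  have B_lim: "((\<lambda>x. \<sigma> x *\<^sub>R B x) \<longlongrightarrow> 0) at_top"
  proof (rule Lim_null_comparison)
    show "((\<lambda>x. C * b * integral {x..} (\<lambda>t. norm (W t))) \<longlongrightarrow> 0) at_top"
      by (intro tendsto_mult_right_zero tendsto_integral_Ici[OF normW])
    have "norm (\<sigma> x *\<^sub>R B x) \<le> C * b * integral {x..} (\<lambda>t. norm (W t))" if x: "x \<ge> a" for x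
    proof -
      have "norm (B x) \<le> integral {x..} (\<lambda>t. (C / \<sigma> x * b) * norm (W t))"
        unfolding B_def norm_minus_cancel
      proof (rule integral_norm_bound_integral)
        show "(\<lambda>t. (\<rho> t / \<sigma> t) *\<^sub>R (W t * g t)) integrable_on {x..}"
          by (intro absint_integrable set_integrable_subset[OF int2]) (use x in auto)
        show "(\<lambda>t. (C / \<sigma> x * b) * norm (W t)) integrable_on {x..}"
          by (intro integrable_on_mult_right absint_integrable set_integrable_subset[OF normW]) (use x in auto)
        fix t assume t: "t \<in> {x..}"
        have "norm ((\<rho> t / \<sigma> t) *\<^sub>R (W t * g t)) = (\<rho> t / \<sigma> t) * (norm (g t) * norm (W t))"
          using ratio_le(2)[OF x, of t] t by (simp only: norm_scaleR norm_mult abs_of_nonneg atLeast_iff mult.commute)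
        also have "\<dots> \<le> (C / \<sigma> x) * (b * norm (W t))"
          using ratio_le[OF x, of t] t x b[of t] C(1) \<sigma>_pos[OF x] order_trans[OF norm_ge_zero b[OF order_refl]]
          by (intro mult_mono) auto
        finally show "norm ((\<rho> t / \<sigma> t) *\<^sub>R (W t * g t)) \<le> (C / \<sigma> x * b) * norm (W t)"
          by (simp add: mult.assoc)
      qed
      also have "\<dots> = (C / \<sigma> x * b) * integral {x..} (\<lambda>t. norm (W t))"
        by simp
      finally have "\<sigma> x * norm (B x) \<le> \<sigma> x * ((C / \<sigma> x * b) * integral {x..} (\<lambda>t. norm (W t)))"
        using \<sigma>_pos[OF x] by (intro mult_left_mono) auto
      then show ?thesis
        using \<sigma>_pos[OF x] by simp
    qed
    then show "eventually (\<lambda>x. norm (\<sigma> x *\<^sub>R B x) \<le> C * b * integral {x..} (\<lambda>t. norm (W t))) at_top"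
      by (intro eventually_mono[OF eventually_ge_at_top[of a]])
  qed
  have g_lim: "(g \<longlongrightarrow> 1) at_top"
  proof (rule Lim_transform_eventually)
    show "((\<lambda>x. A x + \<sigma> x *\<^sub>R B x) \<longlongrightarrow> 1) at_top"
      using tendsto_add[OF A_lim B_lim] by simp
    show "eventually (\<lambda>x. A x + \<sigma> x *\<^sub>R B x = g x) at_top"
      by (intro eventually_mono[OF eventually_ge_at_top[of a]]) (simp add: g_AB)
  qed
  \<comment> \<open>The quotient h' / \<psi>', continuous because \<psi>' has no zero.\<close>
  define gt where "gt x = A x + (\<phi>' x / \<psi>' x) *\<^sub>R B x" for x
  have gt_cont: "continuous_on {a..} gt"
    unfolding gt_def using \<psi>'_neg by (intro continuous_intros cont ac_continuous[OF A] ac_continuous[OF B]) (auto simp: less_le)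
  have gt_lim: "(gt \<longlongrightarrow> 1) at_top"
  proof (rule Lim_transform_eventually)
    have "((\<lambda>x. A x + ((\<phi>' x / \<phi> x) / (\<psi>' x / \<psi> x)) *\<^sub>R (\<sigma> x *\<^sub>R B x)) \<longlongrightarrow> 1 + (\<mu> / - \<mu>) *\<^sub>R 0) at_top"
      using mu_pos by (intro tendsto_intros A_lim B_lim \<psi>_log_deriv \<phi>_log_deriv) auto
    then show "((\<lambda>x. A x + ((\<phi>' x / \<phi> x) / (\<psi>' x / \<psi> x)) *\<^sub>R (\<sigma> x *\<^sub>R B x)) \<longlongrightarrow> 1) at_top"
      by simp
    have "A x + ((\<phi>' x / \<phi> x) / (\<psi>' x / \<psi> x)) *\<^sub>R (\<sigma> x *\<^sub>R B x) = gt x" if "x \<ge> a" for x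
      using \<psi>_pos[OF that] \<phi>_pos[OF that] \<psi>'_neg[OF that] by (simp add: gt_def \<sigma>_def)
    then show "eventually (\<lambda>x. A x + ((\<phi>' x / \<phi> x) / (\<psi>' x / \<psi> x)) *\<^sub>R (\<sigma> x *\<^sub>R B x) = gt x) at_top"
      by (intro eventually_mono[OF eventually_ge_at_top[of a]])
  qed
  have h': "?h' x = \<psi>' x *\<^sub>R gt x" if "x \<ge> a" for x
    using \<psi>'_neg[OF that] by (simp add: gt_def scaleR_add_right)
  show thesis
    by (rule that[OF solves _ g g_lim h' Cb_tendsto[OF gt_cont gt_lim] gt_lim]) (simp add: h_def)
qed

end

lemma eventually_norm_near:
  fixes g :: "real \<Rightarrow> 'a::real_normed_vector"
  assumes "(g \<longlongrightarrow> l) at_top" "e > 0"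
  obtains b where "b > c" "\<And>x. x \<ge> b \<Longrightarrow> norm (g x - l) < e"
proof -
  have "eventually (\<lambda>x. x > c \<and> norm (g x - l) < e) at_top"
    using tendstoD[OF assms] eventually_gt_at_top[of c] by eventually_elim (simp add: dist_norm)
  then obtain b where "\<And>x. x \<ge> b \<Longrightarrow> x > c \<and> norm (g x - l) < e"
    unfolding eventually_at_top_linorder by blast
  then show thesis
    by (intro that[of b]) auto
qed

context log_deriv_pair begin

text \<open>
  A solution with Wronskian 1 against h = \<psi> g satisfies (k / h)' = 1 / (x h)^2, so that k / h is,
  up to a constant, an average of g^(-2) with the weight (\<phi> / \<psi>)' = 1 / (x \<psi>)^2, whose integral diverges.
\<close>

lemma growing_asymptotics:
  fixes h h' k k' g gt :: "real \<Rightarrow> 'a::real_normed_field"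
  assumes h: "\<And>x. x \<ge> a \<Longrightarrow> (h has_vector_derivative h' x) (at x within {a..})"
    and k: "\<And>x. x \<ge> a \<Longrightarrow> (k has_vector_derivative k' x) (at x within {a..})"
    and hg: "\<And>x. x \<ge> a \<Longrightarrow> h x = \<psi> x *\<^sub>R g x" and g: "(g \<longlongrightarrow> 1) at_top"
    and hgt: "\<And>x. x \<ge> a \<Longrightarrow> h' x = \<psi>' x *\<^sub>R gt x" and gt: "(gt \<longlongrightarrow> 1) at_top"
    and wr: "\<And>x. x \<ge> a \<Longrightarrow> x\<^sup>2 *\<^sub>R (h x * k' x - h' x * k x) = 1"
  shows "((\<lambda>x. k x /\<^sub>R \<phi> x) \<longlongrightarrow> 1) at_top" "((\<lambda>x. k' x /\<^sub>R \<phi>' x) \<longlongrightarrow> 1) at_top"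
proof -
  define R where "R x = \<phi> x / \<psi> x" for x
  define Y where "Y x = k x / h x" for x
  define v where "v x = inverse (g x * g x)" for x
  have R_pos: "R x > 0" if "x \<ge> a" for x
    using \<psi>_pos[OF that] \<phi>_pos[OF that] by (simp add: R_def)
  have R_top: "filterlim R at_top at_top"
    using ratio_at_top by (simp add: R_def[abs_def])
  \<comment> \<open>Where g is within distance 1 of its limit 1 it is nonzero, so k / h is defined
    from c on; before c, h may have zeros.\<close>
  obtain c where c: "c > a" and "\<And>x. x \<ge> c \<Longrightarrow> norm (g x - 1) < 1"
    using eventually_norm_near[OF g, of 1] by auto
  then have g0: "g x \<noteq> 0" if "x \<ge> c" for x
    using that by force
  have h0: "h x \<noteq> 0" if "x \<ge> c" for x
    using g0[OF that] \<psi>_pos[of x] hg[of x] that c by simp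
  have Y': "(Y has_vector_derivative (1 / (x\<^sup>2 * (\<psi> x)\<^sup>2)) *\<^sub>R v x) (at x)" if x: "x \<ge> c" for x
  proof -
    have xa: "x \<ge> a" "x > a" "x > 0" using x c a_pos by auto
    have "at x within {a..} = at x"
      using xa by (intro at_within_interior) auto
    then have d: "(h has_derivative (\<lambda>t. t *\<^sub>R h' x)) (at x)" "(k has_derivative (\<lambda>t. t *\<^sub>R k' x)) (at x)"
      using h[OF xa(1)] k[OF xa(1)] unfolding has_vector_derivative_def by simp_all
    have "(Y has_derivative (\<lambda>t. (t *\<^sub>R k' x * h x - k x * (t *\<^sub>R h' x)) / (h x * h x))) (at x)"
      unfolding Y_def using h0[OF x] d by (intro has_derivative_divide')
    also have "(\<lambda>t. (t *\<^sub>R k' x * h x - k x * (t *\<^sub>R h' x)) / (h x * h x)) =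
        (\<lambda>t. t *\<^sub>R ((h x * k' x - h' x * k x) / (h x * h x)))"
      by (simp add: fun_eq_iff scaleR_conv_of_real algebra_simps)
    also have "(h x * k' x - h' x * k x) / (h x * h x) = (1 / (x\<^sup>2 * (\<psi> x)\<^sup>2)) *\<^sub>R v x"
    proof -
      have "h x * k' x - h' x * k x = (1 / x\<^sup>2) *\<^sub>R (x\<^sup>2 *\<^sub>R (h x * k' x - h' x * k x))"
        using xa by simp
      also have "\<dots> = (1 / x\<^sup>2) *\<^sub>R 1"
        using wr[OF xa(1)] by simp
      finally have "(h x * k' x - h' x * k x) / (h x * h x) = ((1 / x\<^sup>2) *\<^sub>R 1) / ((\<psi> x *\<^sub>R g x) * (\<psi> x *\<^sub>R g x))"
        using hg[OF xa(1)] by simp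
      also have "\<dots> = (1 / (x\<^sup>2 * (\<psi> x)\<^sup>2)) *\<^sub>R v x"
        by (simp add: v_def scaleR_conv_of_real divide_inverse power2_eq_square mult_ac)
      finally show ?thesis .
    qed
    finally show ?thesis
      unfolding has_vector_derivative_def .
  qed
  have R'': "(R has_real_derivative 1 / (x\<^sup>2 * (\<psi> x)\<^sup>2)) (at x)" if "x \<ge> a" for x
    using ratio_deriv[OF that] unfolding R_def .
  note R' = R''[unfolded has_real_derivative_iff_has_vector_derivative]
  have v: "(v \<longlongrightarrow> 1) at_top"
    using tendsto_inverse[OF tendsto_mult[OF g g]] by (simp add: v_def[abs_def])
  have YR: "((\<lambda>x. Y x /\<^sub>R R x) \<longlongrightarrow> 1) at_top"
  proof (rule tendstoI)
    fix e :: real assume "e > 0"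
    then obtain b where b: "b > c" "\<And>x. x \<ge> b \<Longrightarrow> norm (v x - 1) < e / 2"
      using eventually_norm_near[OF v, of "e / 2" c] by auto
    \<comment> \<open>D' is R' (v - 1), of norm at most e / 2 times R'. Hence norm D \<le> norm (D
      b) + e / 2 R, and divergence of R absorbs the constant.\<close>
    define D where "D x = Y x - of_real (R x)" for x
    have D': "(D has_vector_derivative (1 / (x\<^sup>2 * (\<psi> x)\<^sup>2)) *\<^sub>R (v x - 1)) (at x)" if "x \<ge> b" for x
    proof -
      have "(D has_vector_derivative (1 / (x\<^sup>2 * (\<psi> x)\<^sup>2)) *\<^sub>R v x - of_real (1 / (x\<^sup>2 * (\<psi> x)\<^sup>2))) (at x)"
        unfolding D_def using that b(1) c
        by (intro has_vector_derivative_diff Y' has_vector_derivative_of_real R'') auto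
      then show ?thesis
        by (simp add: scaleR_conv_of_real diff_divide_distrib)
    qed
    have D_bound: "norm (D x - D b) \<le> e / 2 * R x" if "x > b" for x
    proof -
      have "norm (D x - D b) \<le> e / 2 * R x - e / 2 * R b"
      proof (rule differentiable_bound_general[OF that])
        show "continuous_on {b..x} D"
          using D' by (intro continuous_at_imp_continuous_on ballI has_vector_derivative_continuous) auto
        have "(R has_vector_derivative 1 / (t\<^sup>2 * (\<psi> t)\<^sup>2)) (at t)" if "t \<ge> b" for t
          using that b(1) c by (intro R') auto
        then show "continuous_on {b..x} (\<lambda>x. e / 2 * R x)"
          by (intro continuous_intros continuous_at_imp_continuous_on ballI) (auto intro: has_vector_derivative_continuous)
        fix t assume t: "b < t" "t < x"
        show "(D has_vector_derivative (1 / (t\<^sup>2 * (\<psi> t)\<^sup>2)) *\<^sub>R (v t - 1)) (at t)"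
          using t by (intro D') auto
        show "((\<lambda>x. e / 2 * R x) has_vector_derivative e / 2 * (1 / (t\<^sup>2 * (\<psi> t)\<^sup>2))) (at t)"
          using t b(1) c by (intro has_vector_derivative_mult_right R') auto
        have "norm ((1 / (t\<^sup>2 * (\<psi> t)\<^sup>2)) *\<^sub>R (v t - 1)) = (1 / (t\<^sup>2 * (\<psi> t)\<^sup>2)) * norm (v t - 1)"
          by simp
        also have "\<dots> \<le> (1 / (t\<^sup>2 * (\<psi> t)\<^sup>2)) * (e / 2)"
          using b(2)[of t] t by (intro mult_left_mono) auto
        finally show "norm ((1 / (t\<^sup>2 * (\<psi> t)\<^sup>2)) *\<^sub>R (v t - 1)) \<le> e / 2 * (1 / (t\<^sup>2 * (\<psi> t)\<^sup>2))"
          by (simp add: mult.commute)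
      qed
      moreover have "e / 2 * R b \<ge> 0"
        using R_pos[of b] b(1) c \<open>e > 0\<close> by (intro mult_nonneg_nonneg) auto
      ultimately show ?thesis by linarith
    qed
    have "eventually (\<lambda>x. R x > 2 * norm (D b) / e) at_top"
      using R_top by (simp add: filterlim_at_top_dense)
    then show "eventually (\<lambda>x. dist (Y x /\<^sub>R R x) 1 < e) at_top"
      using eventually_gt_at_top[of b]
    proof eventually_elim
      case (elim x)
      have Rx: "R x > 0"
        using elim(2) b(1) c by (intro R_pos) auto
      have "Y x /\<^sub>R R x - 1 = D x /\<^sub>R R x"
        using Rx by (simp add: D_def scaleR_conv_of_real field_simps)
      then have "dist (Y x /\<^sub>R R x) 1 = norm (D x) / R x"
        using Rx by (simp add: dist_norm divide_inverse mult.commute)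
      also have "norm (D x) \<le> e / 2 * R x + norm (D b)"
        using D_bound[OF elim(2)] norm_triangle_ineq2[of "D x" "D b"] by linarith
      also have "norm (D b) < e / 2 * R x"
        using elim(1) \<open>e > 0\<close> by (simp add: field_simps)
      finally show ?case
        using Rx by (simp add: divide_simps)
    qed
  qed
  have "((\<lambda>x. (Y x /\<^sub>R R x) * g x) \<longlongrightarrow> 1 * 1) at_top"
    by (intro tendsto_mult YR g)
  then have "((\<lambda>x. (Y x /\<^sub>R R x) * g x) \<longlongrightarrow> 1) at_top" by simp
  then show k_lim: "((\<lambda>x. k x /\<^sub>R \<phi> x) \<longlongrightarrow> 1) at_top"
  proof (rule Lim_transform_eventually)
    have "(Y x /\<^sub>R R x) * g x = k x /\<^sub>R \<phi> x" if "x \<ge> c" for x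
      using h0[OF that] g0[OF that] hg[of x] \<psi>_pos[of x] \<phi>_pos[of x] that c
      by (simp add: Y_def R_def scaleR_conv_of_real field_simps)
    then show "eventually (\<lambda>x. (Y x /\<^sub>R R x) * g x = k x /\<^sub>R \<phi> x) at_top"
      by (intro eventually_mono[OF eventually_ge_at_top[of c]])
  qed
  \<comment> \<open>Equating the two Wronskians and solving for k' gives k' / \<phi>' = (1 + q (gt k
    / \<phi> - 1)) / g. Since q converges and gt k / \<phi> tends to 1, the correction vanishes in
    the limit.\<close>
  let ?q = "\<lambda>x. (\<psi>' x / \<psi> x) / (\<phi>' x / \<phi> x)"
  have "((\<lambda>x. (1 + ?q x *\<^sub>R (gt x * (k x /\<^sub>R \<phi> x) - 1)) / g x) \<longlongrightarrow> (1 + (- \<mu> / \<mu>) *\<^sub>R (1 * 1 - 1)) / 1) at_top"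
    using mu_pos by (intro tendsto_intros \<psi>_log_deriv \<phi>_log_deriv gt g k_lim) auto
  then have "((\<lambda>x. (1 + ?q x *\<^sub>R (gt x * (k x /\<^sub>R \<phi> x) - 1)) / g x) \<longlongrightarrow> 1) at_top" by simp
  then show "((\<lambda>x. k' x /\<^sub>R \<phi>' x) \<longlongrightarrow> 1) at_top"
  proof (rule Lim_transform_eventually)
    have "eventually (\<lambda>x. \<phi>' x / \<phi> x > 0) at_top"
      using order_tendstoD(1)[OF \<phi>_log_deriv mu_pos] .
    then show "eventually (\<lambda>x. (1 + ?q x *\<^sub>R (gt x * (k x /\<^sub>R \<phi> x) - 1)) / g x = k' x /\<^sub>R \<phi>' x) at_top"
      using eventually_ge_at_top[of c]
    proof eventually_elim
      case (elim x)
      have xa: "x \<ge> a" "x > 0" using elim(2) c a_pos by auto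
      have pos: "\<psi> x > 0" "\<phi> x > 0" "\<phi>' x > 0"
        using \<psi>_pos[OF xa(1)] \<phi>_pos[OF xa(1)] elim(1) by (auto simp: zero_less_divide_iff)
      have "of_real (\<psi> x) * g x * k' x - of_real (\<psi>' x) * gt x * k x = (1 / x\<^sup>2) *\<^sub>R (x\<^sup>2 *\<^sub>R (h x * k' x - h' x * k x))"
        using xa hg[OF xa(1)] hgt[OF xa(1)] by (simp add: scaleR_conv_of_real)
      also have "\<dots> = of_real (1 / x\<^sup>2)"
        using wr[OF xa(1)] by (simp add: scaleR_conv_of_real)
      also have "1 / x\<^sup>2 = \<psi> x * \<phi>' x - \<psi>' x * \<phi> x"
        using wronskian[OF xa(1)] xa by (simp add: field_simps)
      finally have eq: "of_real (\<psi> x) * g x * k' x =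
          of_real (\<psi> x) * of_real (\<phi>' x) - of_real (\<psi>' x) * of_real (\<phi> x) + of_real (\<psi>' x) * gt x * k x"
        by (simp add: algebra_simps)
      have "(1 + ?q x *\<^sub>R (gt x * (k x /\<^sub>R \<phi> x) - 1)) / g x =
          (of_real (\<psi> x) * of_real (\<phi>' x) - of_real (\<psi>' x) * of_real (\<phi> x) + of_real (\<psi>' x) * gt x * k x) /
          (of_real (\<psi> x) * of_real (\<phi>' x) * g x)"
        using pos g0[OF elim(2)] by (simp add: scaleR_conv_of_real field_simps)
      also have "\<dots> = k' x /\<^sub>R \<phi>' x"
        unfolding eq[symmetric] using pos g0[OF elim(2)] by (simp add: scaleR_conv_of_real field_simps)
      finally show ?case .
    qed
  qed
qed

text \<open>The decaying solution h has coefficients (c, d) in a basis of initial value solutions; k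
  is any combination (c', d') with c d' - d c' = 1. Its growth needs no extra care, as
  \<open>growing_asymptotics\<close> applies to every such k.\<close>

lemma fundamental_pair:
  fixes W :: "real \<Rightarrow> 'a::{real_normed_field,euclidean_space}"
  assumes W: "W absolutely_integrable_on {a..}"
  obtains h h' k k' g gt where "solves a (\<lambda>x. of_real (Q x) + x\<^sup>2 *\<^sub>R W x) h h'" "solves a (\<lambda>x. of_real (Q x) + x\<^sup>2 *\<^sub>R W x) k k'"
    "\<And>x. x \<ge> a \<Longrightarrow> x\<^sup>2 *\<^sub>R (h x * k' x - h' x * k x) = 1"
    "\<And>x. x \<ge> a \<Longrightarrow> h x = \<psi> x *\<^sub>R g x" "g \<in> Cb a" "(g \<longlongrightarrow> 1) at_top"
    "\<And>x. x \<ge> a \<Longrightarrow> h' x = \<psi>' x *\<^sub>R gt x" "gt \<in> Cb a" "(gt \<longlongrightarrow> 1) at_top"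
    "((\<lambda>x. k x /\<^sub>R \<phi> x) \<longlongrightarrow> 1) at_top" "((\<lambda>x. k' x /\<^sub>R \<phi>' x) \<longlongrightarrow> 1) at_top"
proof -
  let ?q = "\<lambda>x. of_real (Q x) + x\<^sup>2 *\<^sub>R W x"
  obtain h h' g gt where h: "solves a ?q h h'"
    and g: "\<And>x. x \<ge> a \<Longrightarrow> h x = \<psi> x *\<^sub>R g x" "g \<in> Cb a" "(g \<longlongrightarrow> 1) at_top"
    and gt: "\<And>x. x \<ge> a \<Longrightarrow> h' x = \<psi>' x *\<^sub>R gt x" "gt \<in> Cb a" "(gt \<longlongrightarrow> 1) at_top"
    using decaying_solution[OF W] by blast
  \<comment> \<open>The data at a of u are those of \<psi>, and the data of w below are those of
    \<phi>, so u and w have Wronskian 1 at a and hence everywhere.\<close>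
  obtain u u' where u: "solves a ?q u u'" "u a = \<psi> a *\<^sub>R 1 + \<phi> a *\<^sub>R 0" "u' a = \<psi>' a *\<^sub>R 1 + \<phi>' a *\<^sub>R 0"
    using initial_value_solution[OF W] by blast
  obtain w w' where w: "solves a ?q w w'" "w a = \<psi> a *\<^sub>R 0 + \<phi> a *\<^sub>R 1" "w' a = \<psi>' a *\<^sub>R 0 + \<phi>' a *\<^sub>R 1"
    using initial_value_solution[OF W] by blast
  have uw: "x\<^sup>2 *\<^sub>R (u x * w' x - u' x * w x) = 1" if "x \<ge> a" for x
  proof -
    have "x\<^sup>2 *\<^sub>R (u x * w' x - u' x * w x) = a\<^sup>2 *\<^sub>R (u a * w' a - u' a * w a)"
      by (rule solves_wronskian_const[OF u(1) w(1) a_pos that])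
    also have "\<dots> = of_real (a\<^sup>2 * (\<psi> a * \<phi>' a - \<psi>' a * \<phi> a))"
      unfolding u(2,3) w(2,3) by (simp add: scaleR_conv_of_real)
    finally show ?thesis
      using wronskian[OF order_refl] by simp
  qed
  obtain c d where cd: "\<And>x. x \<ge> a \<Longrightarrow> h x = c * u x + d * w x" "\<And>x. x \<ge> a \<Longrightarrow> h' x = c * u' x + d * w' x"
    using solves_span[OF h u(1) w(1) a_pos uw] by blast
  \<comment> \<open>Otherwise g would vanish identically, against its limit 1.\<close>
  have "c \<noteq> 0 \<or> d \<noteq> 0"
  proof (rule ccontr)
    assume "\<not> (c \<noteq> 0 \<or> d \<noteq> 0)"
    then have "g x = 0" if "x \<ge> a" for x
      using cd(1)[OF that] g(1)[OF that] \<psi>_pos[OF that] by simp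
    then have "eventually (\<lambda>x. g x = 0) at_top"
      by (intro eventually_mono[OF eventually_ge_at_top[of a]])
    with g(3) have "((\<lambda>x::real. 0 :: 'a) \<longlongrightarrow> 1) at_top"
      using tendsto_cong by fast
    then show False
      by (simp add: tendsto_const_iff)
  qed
  then obtain c' d' where cd': "c * d' - d * c' = 1"
  proof
    assume "c \<noteq> 0"
    then show thesis by (intro that[of "1 / c" 0]) simp
  next
    assume "d \<noteq> 0"
    then show thesis by (intro that[of 0 "- (1 / d)"]) simp
  qed
  define k where "k x = c' * u x + d' * w x" for x
  define k' where "k' x = c' * u' x + d' * w' x" for x
  have k: "solves a ?q k k'"
    unfolding k_def k'_def by (rule solves_lincomb[OF u(1) w(1)])
  have wr: "x\<^sup>2 *\<^sub>R (h x * k' x - h' x * k x) = 1" if "x \<ge> a" for x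
  proof -
    have "h x * k' x - h' x * k x = (c * d' - d * c') * (u x * w' x - u' x * w x)"
      by (simp add: cd[OF that] k_def k'_def algebra_simps)
    then show ?thesis
      using uw[OF that] cd' by simp
  qed
  have deriv: "(h has_vector_derivative h' x) (at x within {a..})" "(k has_vector_derivative k' x) (at x within {a..})"
    if "x \<ge> a" for x
    using h k that by (auto simp: solves_def)
  show thesis
    by (rule that[OF h k wr g gt growing_asymptotics[OF deriv g(1,3) gt(1,3) wr]])
qed

end

section \<open>Perturbed Bessel equation\<close>

theorem theorem5p2:
  fixes a \<mu> z :: real
    and W :: "real \<Rightarrow> 'a::{real_normed_field,euclidean_space}"
  assumes "a > 0" and "\<mu> > 0" and "z \<ge> 0"
    and "W absolutely_integrable_on {a..}"
  shows "\<exists>h\<^sub>1 h\<^sub>2 g\<^sub>1 g\<^sub>2 gt\<^sub>1 gt\<^sub>2 :: real \<Rightarrow> 'a.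
    fundamental_system a \<mu> W z h\<^sub>1 h\<^sub>2 \<and>
    (\<forall>x\<ge>a. h\<^sub>1 x = psi \<mu> z x *\<^sub>R g\<^sub>1 x) \<and> g\<^sub>1 \<in> Cb a \<and> (g\<^sub>1 \<longlongrightarrow> 1) at_top \<and>
    (\<forall>x\<ge>a. h\<^sub>2 x = phi \<mu> z x *\<^sub>R g\<^sub>2 x) \<and> g\<^sub>2 \<in> Cb a \<and> (g\<^sub>2 \<longlongrightarrow> 1) at_top \<and>
    (\<forall>x\<ge>a. deriv_from a h\<^sub>1 x = deriv (psi \<mu> z) x *\<^sub>R gt\<^sub>1 x) \<and>
    gt\<^sub>1 \<in> Cb a \<and> (gt\<^sub>1 \<longlongrightarrow> 1) at_top \<and>
    (\<exists>b\<ge>a. ((\<forall>x\<ge>a. deriv (phi \<mu> z) x \<noteq> 0) \<longrightarrow> b = a) \<and>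
       (\<forall>x\<ge>b. deriv_from a h\<^sub>2 x = deriv (phi \<mu> z) x *\<^sub>R gt\<^sub>2 x) \<and> gt\<^sub>2 \<in> Cb b) \<and>
    (gt\<^sub>2 \<longlongrightarrow> 1) at_top \<and>
    (\<forall>x\<ge>a. x\<^sup>2 *\<^sub>R (h\<^sub>1 x * deriv_from a h\<^sub>2 x - deriv_from a h\<^sub>1 x * h\<^sub>2 x) = 1)"
proof -
  \<comment> \<open>The term z^2 is absorbed into the coefficient Q, so that (x^2 f')' = Q f is the
    unperturbed equation.\<close>
  interpret log_deriv_pair a \<mu> "\<lambda>x. x\<^sup>2 * \<mu>\<^sup>2 - 1 / 4 + z\<^sup>2" "psi \<mu> z" "psi' \<mu> z" "phi \<mu> z" "phi' \<mu> z"
    using assms(1-3)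
    by unfold_locales
       (auto intro!: continuous_intros psi_derivs phi_derivs psi_pos phi_pos psi'_neg psi_phi_wronskian
          tendsto_psi_log_deriv tendsto_phi_log_deriv)
  obtain h h' k k' g gt :: "real \<Rightarrow> 'a"
    where h: "solves a (\<lambda>x. of_real (x\<^sup>2 * \<mu>\<^sup>2 - 1 / 4 + z\<^sup>2) + x\<^sup>2 *\<^sub>R W x) h h'"
      and k: "solves a (\<lambda>x. of_real (x\<^sup>2 * \<mu>\<^sup>2 - 1 / 4 + z\<^sup>2) + x\<^sup>2 *\<^sub>R W x) k k'"
      and wr: "\<And>x. x \<ge> a \<Longrightarrow> x\<^sup>2 *\<^sub>R (h x * k' x - h' x * k x) = 1"
      and g: "\<And>x. x \<ge> a \<Longrightarrow> h x = psi \<mu> z x *\<^sub>R g x" "g \<in> Cb a" "(g \<longlongrightarrow> 1) at_top"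
      and gt: "\<And>x. x \<ge> a \<Longrightarrow> h' x = psi' \<mu> z x *\<^sub>R gt x" "gt \<in> Cb a" "(gt \<longlongrightarrow> 1) at_top"
      and k_lim: "((\<lambda>x. k x /\<^sub>R phi \<mu> z x) \<longlongrightarrow> 1) at_top" "((\<lambda>x. k' x /\<^sub>R phi' \<mu> z x) \<longlongrightarrow> 1) at_top"
    using fundamental_pair[OF assms(4)] by blast
  have deriv: "deriv (psi \<mu> z) x = psi' \<mu> z x" "deriv (phi \<mu> z) x = phi' \<mu> z x" if "x \<ge> a" for x
    using \<psi>_deriv(1)[OF that] \<phi>_deriv(1)[OF that] by (simp_all add: DERIV_imp_deriv)
  have deriv_from: "deriv_from a h x = h' x" "deriv_from a k x = k' x" if "x \<ge> a" for x
    using h k that by (auto simp: solves_def intro: deriv_from_eq)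
  define g2 where "g2 x = k x /\<^sub>R phi \<mu> z x" for x
  \<comment> \<open>At a zero of phi' this has the value 0 by convention; there it need not
    represent k'.\<close>
  define gt2 where "gt2 x = k' x /\<^sub>R phi' \<mu> z x" for x
  have g2: "k x = phi \<mu> z x *\<^sub>R g2 x" if "x \<ge> a" for x
    using \<phi>_pos[OF that] by (simp add: g2_def)
  have "continuous_on {a..} g2"
    unfolding g2_def using solves_continuous[OF k a_pos] \<phi>_pos by (intro continuous_intros cont) (auto simp: less_le)
  then have g2_Cb: "g2 \<in> Cb a"
    using Cb_tendsto k_lim(1) by (simp add: g2_def[abs_def])
  have gt2: "deriv_from a k x = deriv (phi \<mu> z) x *\<^sub>R gt2 x" if "x \<ge> a" "phi' \<mu> z x \<noteq> 0" for x
    using that by (simp add: gt2_def deriv_from deriv)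
  have gt2_Cb: "gt2 \<in> Cb b" if "b \<ge> a" "\<And>x. x \<ge> b \<Longrightarrow> phi' \<mu> z x \<noteq> 0" for b
  proof -
    have "continuous_on {b..} k'" "continuous_on {b..} (phi' \<mu> z)"
      using that(1) by (auto intro: continuous_on_subset[OF solves_deriv_continuous[OF k a_pos]] continuous_on_subset[OF cont(4)])
    then have "continuous_on {b..} gt2"
      unfolding gt2_def using that(2) by (intro continuous_intros) auto
    then show ?thesis
      using Cb_tendsto k_lim(2) by (simp add: gt2_def[abs_def])
  qed
  have "\<exists>b\<ge>a. ((\<forall>x\<ge>a. deriv (phi \<mu> z) x \<noteq> 0) \<longrightarrow> b = a) \<and>
       (\<forall>x\<ge>b. deriv_from a k x = deriv (phi \<mu> z) x *\<^sub>R gt2 x) \<and> gt2 \<in> Cb b"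
  proof (cases "\<forall>x\<ge>a. deriv (phi \<mu> z) x \<noteq> 0")
    case True
    then have "phi' \<mu> z x \<noteq> 0" if "x \<ge> a" for x
      using that by (simp add: deriv)
    then show ?thesis
      using gt2 gt2_Cb by (intro exI[of _ a]) auto
  next
    case False
    \<comment> \<open>The logarithmic derivative of phi tends to \<mu> > 0, so phi' has no zeros
      from some point on.\<close>
    have "eventually (\<lambda>x. phi' \<mu> z x / phi \<mu> z x > 0) at_top"
      using order_tendstoD(1)[OF \<phi>_log_deriv mu_pos] .
    then obtain b where b: "\<And>x. x \<ge> b \<Longrightarrow> phi' \<mu> z x / phi \<mu> z x > 0"
      unfolding eventually_at_top_linorder by blast
    then have "phi' \<mu> z x \<noteq> 0" if "x \<ge> max a b" for x
      using that by force
    then have nz: "phi' \<mu> z x \<noteq> 0" if "x \<ge> max a b" for x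
      using that by blast
    then have "gt2 \<in> Cb (max a b)"
      by (intro gt2_Cb) auto
    with False nz show ?thesis
      using gt2 by (intro exI[of _ "max a b"]) auto
  qed
  moreover have "fundamental_system a \<mu> W z h k"
    by (rule fundamental_systemI[OF h k a_pos wr])
  ultimately show ?thesis
    using g gt g2 g2_Cb k_lim wr
    by (intro exI[of _ h] exI[of _ k] exI[of _ g] exI[of _ g2] exI[of _ gt] exI[of _ gt2])
       (simp add: deriv deriv_from g2_def[abs_def] gt2_def[abs_def])
qed

end
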